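(* Let $(X,\tau,\mathsf d)$ be an extended metric-topological space. Assume that $(X,\mathsf d)$ is complete, let $T>0$ and let $(\mu_t)_{t\in[0,T]}\in AC^2([0,T];(\mathcal P(X),W_{\mathsf d}))$. Then there exists $\boldsymbol\eta\in\mathcal P(X^{[0,T]})$ concentrated on $AC^2([0,T];(X,\mathsf d))$ with $(\mathrm e_t)_\sharp\boldsymbol\eta=\mu_t$ for all $t\in[0,T]$ and $$\int|\dot\eta(t)|^2\,d\boldsymbol\eta(\eta)=|\dot\mu_t|^2\qquad\text{for a.e. }t\in(0,T).$$
   Context: An extended metric space $(X,\mathsf d)$ is a set with a symmetric $\mathsf d:X\times X\to[0,\infty]$ satisfying the triangle inequality and $\mathsf d(x,y)=0$ iff $x=y$ (it is complete if every $\mathsf d$-Cauchy sequence converges); for a semidistance the last condition is weakened to $\mathsf d(x,x)=0$. For a Hausdorff topology $\tau$ on $X$, $\mathrm{Lip}_b(X,\tau,\mathsf d)$ is the set of bounded, $\mathsf d$-Lipschitz, $\tau$-continuous functions $f:X\to\mathbb R$. $(X,\tau,\mathsf d)$ is an extended metric-topological space if (a) there are $(\tau\times\tau)$-continuous bounded semidistances $\mathsf d_i:X\times X\to[0,\infty)$, $i\in I$, with $\mathsf d=\sup_i\mathsf d_i$; (b) $\tau$ is generated by $\mathrm{Lip}_b(X,\tau,\mathsf d)$. For a Hausdorff space $Y$, $\mathcal P(Y)$ is the set of Radon probability measures on its Borel sets (inner regular by compact sets on all Borel sets). $W_{\mathsf d}^2(\mu,\nu)=\inf\int_{X\times X}\mathsf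 d^2\,d\boldsymbol\pi$ over Radon probability measures $\boldsymbol\pi$ on $X\times X$ with marginals $\mu,\nu$; it is an extended distance on $\mathcal P(X)$. In an extended metric space $(Y,\delta)$, $AC^2([0,T];(Y,\delta))$ is the set of curves $\eta:[0,T]\to Y$ for which there is $g\in L^2(0,T)$ with $\delta(\eta(s),\eta(t))\le\int_s^tg(r)\,dr$ for $s\le t$; the metric derivative $|\dot\eta|(t)=\limsup_{s\to t}\delta(\eta(s),\eta(t))/|s-t|$ is a limit for a.e. $t$. Here $|\dot\eta|$ is computed w.r.t. $\mathsf d$ and $|\dot\mu_t|$ w.r.t. $W_{\mathsf d}$. $X^{[0,T]}$ is the set of all maps $[0,T]\to X$ with the product topology of $\tau$ and $\mathrm e_t(\eta)=\eta(t)$; $AC^2([0,T];(X,\mathsf d))$ is a Borel subset of it. *)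

theory Defs
  imports "HOL-Probability.Probability"
begin

definition semidistance_on :: "'a set \<Rightarrow> ('a \<Rightarrow> 'a \<Rightarrow> ennreal) \<Rightarrow> bool" where
  "semidistance_on S d \<longleftrightarrow>
     (\<forall>x\<in>S. d x x = 0) \<and>
     (\<forall>x\<in>S. \<forall>y\<in>S. d x y = d y x) \<and>
     (\<forall>x\<in>S. \<forall>y\<in>S. \<forall>z\<in>S. d x z \<le> d x y + d y z)"

definition extended_metric_on :: "'a set \<Rightarrow> ('a \<Rightarrow> 'a \<Rightarrow> ennreal) \<Rightarrow> bool" where
  "extended_metric_on S d \<longleftrightarrow>
     semidistance_on S d \<and> (\<forall>x\<in>S. \<forall>y\<in>S. d x y = 0 \<longrightarrow> x = y)"

definition extended_complete_on :: "'a set \<Rightarrow> ('a \<Rightarrow> 'a \<Rightarrow> ennreal) \<Rightarrow> bool" where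
  "extended_complete_on S d \<longleftrightarrow>
     (\<forall>\<sigma> :: nat \<Rightarrow> 'a. range \<sigma> \<subseteq> S \<longrightarrow>
        (\<forall>\<epsilon>>0. \<exists>N. \<forall>m\<ge>N. \<forall>n\<ge>N. d (\<sigma> m) (\<sigma> n) < \<epsilon>) \<longrightarrow>
        (\<exists>x\<in>S. (\<lambda>n. d (\<sigma> n) x) \<longlonglongrightarrow> 0))"

text \<open>
  In \<open>ennreal\<close>, \<open>0 * \<infinity> = 0\<close>; this is harmless below, since the constant \<open>L\<close> may be increased,
  so that pairs at infinite distance impose no condition.
\<close>

definition Lip_b :: "'a topology \<Rightarrow> ('a \<Rightarrow> 'a \<Rightarrow> ennreal) \<Rightarrow> ('a \<Rightarrow> real) set" where
  "Lip_b X d =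
     {f. continuous_map X euclideanreal f \<and> bounded (f ` topspace X) \<and>
         (\<exists>L\<ge>0. \<forall>x\<in>topspace X. \<forall>y\<in>topspace X.
            ennreal \<bar>f x - f y\<bar> \<le> ennreal L * d x y)}"

text \<open>
  In the first clause on \<open>D\<close> the family \<open>(d\<^sub>i)\<close> is given through the set \<open>D\<close> of its members.
  In the last clause, \<open>X\<close> is the initial topology of \<open>Lip_b X d\<close>.
\<close>

definition extended_metric_topological_space ::
    "'a topology \<Rightarrow> ('a \<Rightarrow> 'a \<Rightarrow> ennreal) \<Rightarrow> bool" where
  "extended_metric_topological_space X d \<longleftrightarrow>
     Hausdorff_space X \<and>
     extended_metric_on (topspace X) d \<and>
     (\<exists>D :: ('a \<Rightarrow> 'a \<Rightarrow> real) set.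
        (\<forall>\<delta>\<in>D. (\<forall>x\<in>topspace X. \<forall>y\<in>topspace X. 0 \<le> \<delta> x y) \<and>
                semidistance_on (topspace X) (\<lambda>x y. ennreal (\<delta> x y)) \<and>
                continuous_map (prod_topology X X) euclideanreal (\<lambda>(x, y). \<delta> x y) \<and>
                bounded ((\<lambda>(x, y). \<delta> x y) ` (topspace X \<times> topspace X))) \<and>
        (\<forall>x\<in>topspace X. \<forall>y\<in>topspace X. d x y = (SUP \<delta>\<in>D. ennreal (\<delta> x y)))) \<and>
     X = topology_generated_by
           {{x \<in> topspace X. f x \<in> U} | f U. f \<in> Lip_b X d \<and> open U}"

definition borel_of :: "'a topology \<Rightarrow> 'a measure" where
  "borel_of Y = sigma (topspace Y) {U. openin Y U}"

text \<open>
  Intended for Hausdorff \<open>Y\<close>, where compact sets are closed and hence Borel.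
\<close>

definition radon_prob :: "'a topology \<Rightarrow> 'a measure set" where
  "radon_prob Y =
     {M. prob_space M \<and> space M = topspace Y \<and> sets M = sets (borel_of Y) \<and>
         (\<forall>B\<in>sets M. emeasure M B = (SUP K\<in>{K. compactin Y K \<and> K \<subseteq> B}. emeasure M K))}"

text \<open>
  Plans live on the Borel sets of the product topology, which in general form a larger
  \<open>\<sigma>\<close>-algebra than the product of the Borel \<open>\<sigma>\<close>-algebras.
\<close>

definition transport_plans :: "'a topology \<Rightarrow> 'a measure \<Rightarrow> 'a measure \<Rightarrow> ('a \<times> 'a) measure set" where
  "transport_plans X \<mu> \<nu> =
     {\<pi> \<in> radon_prob (prod_topology X X).
        distr \<pi> (borel_of X) fst = \<mu> \<and> distr \<pi> (borel_of X) snd = \<nu>}"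

definition ennreal_sqrt :: "ennreal \<Rightarrow> ennreal" where
  "ennreal_sqrt x = (if x = \<infinity> then \<infinity> else ennreal (sqrt (enn2real x)))"

definition wasserstein ::
    "'a topology \<Rightarrow> ('a \<Rightarrow> 'a \<Rightarrow> ennreal) \<Rightarrow> 'a measure \<Rightarrow> 'a measure \<Rightarrow> ennreal" where
  "wasserstein X d \<mu> \<nu> =
     ennreal_sqrt (INF \<pi>\<in>transport_plans X \<mu> \<nu>. \<integral>\<^sup>+ (x, y). (d x y)\<^sup>2 \<partial>\<pi>)"

text \<open>
  Only the values of \<open>\<eta>\<close> on \<open>{0..T}\<close> matter. Comparing in \<open>ereal\<close> keeps the inequality
  meaningful for a negative right-hand side, which \<open>ennreal\<close> would truncate to \<open>0\<close>.
\<close>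

definition AC2 :: "real \<Rightarrow> 'a set \<Rightarrow> ('a \<Rightarrow> 'a \<Rightarrow> ennreal) \<Rightarrow> (real \<Rightarrow> 'a) set" where
  "AC2 T S \<delta> =
     {\<eta>. (\<forall>t\<in>{0..T}. \<eta> t \<in> S) \<and>
         (\<exists>g :: real \<Rightarrow> real.
            set_borel_measurable lborel {0<..<T} g \<and>
            set_integrable lborel {0<..<T} (\<lambda>r. (g r)\<^sup>2) \<and>
            (\<forall>s t. 0 \<le> s \<and> s \<le> t \<and> t \<le> T \<longrightarrow>
               enn2ereal (\<delta> (\<eta> s) (\<eta> t)) \<le> ereal (LBINT r:{s<..<t}. g r)))}"

definition metric_derivative ::
    "real \<Rightarrow> ('a \<Rightarrow> 'a \<Rightarrow> ennreal) \<Rightarrow> (real \<Rightarrow> 'a) \<Rightarrow> real \<Rightarrow> ennreal" where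
  "metric_derivative T \<delta> \<eta> t =
     Limsup (at t within {0..T}) (\<lambda>s. \<delta> (\<eta> s) (\<eta> t) / ennreal \<bar>s - t\<bar>)"

text \<open>
  The topological space of all maps from \<open>{0..T}\<close> to \<open>X\<close>, represented as usual by functions
  that are \<open>undefined\<close> outside \<open>{0..T}\<close>.
\<close>

definition path_space :: "real \<Rightarrow> 'a topology \<Rightarrow> (real \<Rightarrow> 'a) topology" where
  "path_space T X = product_topology (\<lambda>_. X) {0..T}"

end

theory Submission
  imports Defs
begin

text \<open>
  For each level \<open>n\<close>, nearly optimal plans between the marginals at consecutive dyadic times of
  level \<open>n\<close> are glued to a Radon measure on \<open>X\<^sup>D\<close>, where \<open>D\<close> is the countable set of all
  dyadic times. As the one-time marginals are prescribed, this sequence is tight and has a Radon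
  limit point, under which the discrete energies, being lower semicontinuous, have mean at most the
  energy of the curve \<open>\<mu>\<close>. Paths with energy at most \<open>c\<close> are uniformly Hoelder continuous; on
  the set of these paths, completeness of \<open>d\<close> gives a continuous extension map to \<open>X\<close>-valued
  paths on \<open>{0..T}\<close>, so the image measure \<open>\<Lambda>\<close> is Radon. Coupling two marginals of \<open>\<Lambda>\<close>
  through \<open>\<Lambda>\<close> bounds the squared speed of \<open>\<mu>\<close> almost everywhere by the \<open>\<Lambda>\<close>-mean of the
  squared speed of the paths. The integrals over \<open>{0..T}\<close> satisfy the opposite inequality, hence
  both functions agree almost everywhere.
\<close>

section \<open>Radon measures as limits of contents\<close>

text \<open>The topology need not be metrizable and \<open>d\<close> need not be continuous for it,
  so Prokhorov's theorem and disintegration are not at hand. Radon measures are instead produced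
  from finitely additive limits: compactness of a cube gives setwise limits on all sets at once, and
  inner regularization turns such a limit into a Radon measure that is at most the limit on open
  sets. This one-sided control is enough: it passes to integrals of lower semicontinuous functions,
  and two Radon probability measures that are ordered on open sets are equal, so prescribed
  marginals survive. The detour over the countable set \<open>D\<close> is forced by tightness,
  since a product of compact sets captures almost all mass only if the errors at the single times
  are summable. Finally, the energy bound handed to the construction is the integral of the squared
  speed of \<mu> itself and not of an arbitrary admissible majorant; only then do the two opposite
  inequalities share the same total integral.\<close>

lemma compact_limit_family:
  fixes v :: "'i \<Rightarrow> 'b \<Rightarrow> real"
  assumes F: "F \<noteq> bot" and v: "\<And>i A. v i A \<in> {0..1}"
  obtains F' w where "F' \<le> F" "F' \<noteq> bot" "\<And>A. ((\<lambda>i. v i A) \<longlongrightarrow> w A) F'"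
proof -
  have "compactin (product_topology (\<lambda>_::'b. euclidean) UNIV) (PiE UNIV (\<lambda>_::'b. {0..1::real}))"
    by (simp add: compactin_PiE)
  hence cpt: "compact (PiE UNIV (\<lambda>_::'b. {0..1::real}))"
    by (simp add: euclidean_product_topology)
  have "filtermap v F \<noteq> bot" using F by (simp add: filtermap_bot_iff)
  moreover have "eventually (\<lambda>x. x \<in> PiE UNIV (\<lambda>_::'b. {0..1::real})) (filtermap v F)"
    using v by (auto simp: eventually_filtermap PiE_UNIV_domain)
  ultimately obtain x where x: "inf (nhds x) (filtermap v F) \<noteq> bot"
    using cpt unfolding compact_filter by blast
  \<comment> \<open>By Tychonoff's theorem \<open>v\<close> has a cluster point \<open>x\<close> in
    the cube. The refined filter keeps those indices at which \<open>v i\<close> is close to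
    \<open>x\<close>; it takes the place of a convergent subsequence, which need not exist in an
    uncountable product.\<close>
  define F' where "F' = inf F (filtercomap v (nhds x))"
  have "F' \<noteq> bot"
  proof
    assume "F' = bot"
    then have "eventually (\<lambda>_. False) F'" by simp
    then obtain P Q where P: "eventually P F" and Q: "eventually Q (filtercomap v (nhds x))"
      and PQ: "\<And>i. P i \<and> Q i \<Longrightarrow> False"
      unfolding F'_def eventually_inf by blast
    obtain R where R: "eventually R (nhds x)" "\<And>i. R (v i) \<Longrightarrow> Q i"
      using Q unfolding eventually_filtercomap by blast
    have "eventually (\<lambda>y. \<not> R y) (filtermap v F)"
      unfolding eventually_filtermap using P by (rule eventually_mono) (use PQ R in blast)
    with R(1) have "eventually (\<lambda>_. False) (inf (nhds x) (filtermap v F))"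
      unfolding eventually_inf by blast
    with x show False by (simp add: trivial_limit_def)
  qed
  moreover have "F' \<le> F" by (simp add: F'_def)
  moreover have "((\<lambda>i. v i A) \<longlongrightarrow> x A) F'" for A
  proof -
    have "filterlim v (nhds x) F'"
      by (rule filterlim_mono[OF filterlim_filtercomap order_refl]) (simp add: F'_def)
    then show ?thesis
      by (rule continuous_on_tendsto_compose[where f = "\<lambda>f. f A" and s = UNIV,
            OF continuous_on_product_coordinates]) auto
  qed
  ultimately show ?thesis using that by blast
qed

section \<open>Borel sets and the construction of Radon measures\<close>

lemma space_borel_of [simp]: "space (borel_of Y) = topspace Y"
  by (simp add: borel_of_def space_measure_of_conv)

lemma sets_borel_of: "sets (borel_of Y) = sigma_sets (topspace Y) {U. openin Y U}"
  unfolding borel_of_def by (rule sets_measure_of) (auto dest: openin_subset)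

lemma borel_of_open: "openin Y U \<Longrightarrow> U \<in> sets (borel_of Y)"
  by (auto simp: sets_borel_of)

lemma borel_of_closed: "closedin Y C \<Longrightarrow> C \<in> sets (borel_of Y)"
proof -
  assume C: "closedin Y C"
  then have "topspace Y - (topspace Y - C) = C" by (auto dest: closedin_subset)
  moreover have "topspace Y - (topspace Y - C) \<in> sets (borel_of Y)"
    using C sets.compl_sets[OF borel_of_open[of Y "topspace Y - C"]] by (simp add: closedin_def)
  ultimately show ?thesis by simp
qed

lemma borel_of_compact: "Hausdorff_space Y \<Longrightarrow> compactin Y K \<Longrightarrow> K \<in> sets (borel_of Y)"
  by (simp add: borel_of_closed compactin_imp_closedin)

lemma continuous_map_measurable:
  assumes "continuous_map Y Z f" shows "f \<in> measurable (borel_of Y) (borel_of Z)"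
  unfolding borel_of_def[of Z]
proof (rule measurable_measure_of)
  show "{U. openin Z U} \<subseteq> Pow (topspace Z)" by (auto dest: openin_subset)
  show "f \<in> space (borel_of Y) \<rightarrow> topspace Z" using assms by (auto simp: continuous_map_def)
  fix U assume "U \<in> {U. openin Z U}"
  then have "openin Y {x \<in> topspace Y. f x \<in> U}"
    using assms openin_continuous_map_preimage by fastforce
  moreover have "f -` U \<inter> space (borel_of Y) = {x \<in> topspace Y. f x \<in> U}" by auto
  ultimately show "f -` U \<inter> space (borel_of Y) \<in> sets (borel_of Y)"
    by (simp add: borel_of_open)
qed

lemma radon_prob_D:
  assumes "P \<in> radon_prob Y"
  shows "prob_space P" "space P = topspace Y" "sets P = sets (borel_of Y)"
    "\<And>B. B \<in> sets (borel_of Y) \<Longrightarrow>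
       emeasure P B = (SUP K\<in>{K. compactin Y K \<and> K \<subseteq> B}. emeasure P K)"
  using assms by (auto simp: radon_prob_def)

lemma radon_prob_inner:
  assumes "P \<in> radon_prob Y" "B \<in> sets (borel_of Y)" "0 < e"
  obtains K where "compactin Y K" "K \<subseteq> B" "emeasure P B \<le> emeasure P K + ennreal e"
proof (cases "emeasure P B \<le> ennreal e")
  case True
  then show ?thesis using that[of "{}"] by simp
next
  case False
  interpret prob_space P using radon_prob_D[OF assms(1)] by simp
  have "emeasure P B - ennreal e < emeasure P B"
    using False assms(3) emeasure_finite[of B]
    by (intro ennreal_between) (auto simp: less_top[symmetric] not_le intro: le_less_trans)
  also have "\<dots> = (SUP K\<in>{K. compactin Y K \<and> K \<subseteq> B}. emeasure P K)"
    using radon_prob_D(4)[OF assms(1,2)] .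
  finally obtain K where K: "compactin Y K" "K \<subseteq> B" "emeasure P B - ennreal e < emeasure P K"
    by (auto simp: less_SUP_iff)
  have "emeasure P B \<le> emeasure P K + ennreal e"
    using K(3) by (metis ennreal_minus_le_iff ennreal_neq_top less_imp_le add.commute)
  then show ?thesis using that K by blast
qed

text \<open>The content is regularized from outside on compact sets, then from inside on open sets,
  and Caratheodory's theorem is applied to the induced outer measure. As \<open>v\<close> is only
  finitely additive, part of its mass may escape from all compact sets; hence the mere inequality on
  open sets, and the hypothesis \<open>tight\<close>, which saves the total mass. The algebra may be
  smaller than the Borel \<sigma>-algebra as long as its open members form a base.\<close>

lemma radon_from_content:
  fixes Y :: "'b topology" and v :: "'b set \<Rightarrow> real" and \<A> :: "'b set set"
  assumes haus: "Hausdorff_space Y" and alg: "algebra (topspace Y) \<A>"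
    and pos: "\<And>S. S \<in> \<A> \<Longrightarrow> 0 \<le> v S"
    and add: "\<And>S T. S \<in> \<A> \<Longrightarrow> T \<in> \<A> \<Longrightarrow> S \<inter> T = {} \<Longrightarrow> v (S \<union> T) = v S + v T"
    and one: "v (topspace Y) = 1"
    and base: "\<And>U x. openin Y U \<Longrightarrow> x \<in> U \<Longrightarrow> \<exists>B\<in>\<A>. openin Y B \<and> x \<in> B \<and> B \<subseteq> U"
    and tight: "\<And>e. 0 < e \<Longrightarrow> \<exists>K. compactin Y K \<and> (\<forall>G\<in>\<A>. openin Y G \<and> K \<subseteq> G \<longrightarrow> 1 - e \<le> v G)"
  shows "\<exists>P\<in>radon_prob Y. \<forall>G\<in>\<A>. openin Y G \<longrightarrow> emeasure P G \<le> ennreal (v G)"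
proof -
  interpret A: algebra "topspace Y" \<A> by (rule alg)
  let ?\<Omega> = "topspace Y"
  have v_mono: "v S \<le> v S'" if "S \<in> \<A>" "S' \<in> \<A>" "S \<subseteq> S'" for S S'
  proof -
    have "v S' = v (S \<union> (S' - S))" using that by (simp add: Un_absorb1)
    also have "\<dots> = v S + v (S' - S)" using that by (intro add) auto
    finally show ?thesis using pos[OF A.Diff[OF that(2,1)]] by simp
  qed
  have v_Un: "v (S \<union> S') \<le> v S + v S'" if "S \<in> \<A>" "S' \<in> \<A>" for S S'
  proof -
    have "v (S \<union> (S' - S)) = v S + v (S' - S)" using that by (intro add) auto
    moreover have "v (S' - S) \<le> v S'" using that by (intro v_mono) auto
    ultimately show ?thesis by simp
  qed
  have v_empty: "v {} = 0" using add[of "{}" "{}"] by simp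
  \<comment> \<open>Finitely many base sets cover a compact set, so its open neighbourhoods may be
    taken from \<A>, where \<open>v\<close> is additive.\<close>
  have cover: "\<exists>G\<in>\<A>. openin Y G \<and> K \<subseteq> G \<and> G \<subseteq> U" if K: "compactin Y K" and U: "openin Y U" and "K \<subseteq> U" for K U
  proof -
    have "\<forall>x\<in>K. \<exists>B\<in>\<A>. openin Y B \<and> x \<in> B \<and> B \<subseteq> U" using base[OF U] that by blast
    then obtain B where B: "\<And>x. x \<in> K \<Longrightarrow> B x \<in> \<A> \<and> openin Y (B x) \<and> x \<in> B x \<and> B x \<subseteq> U"
      by metis
    have "\<exists>\<F>. finite \<F> \<and> \<F> \<subseteq> B ` K \<and> K \<subseteq> \<Union>\<F>"
      using K B unfolding compactin_def by (metis (no_types, lifting) UN_I image_iff subsetI)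
    then obtain \<F> where \<F>: "finite \<F>" "\<F> \<subseteq> B ` K" "K \<subseteq> \<Union>\<F>" by blast
    have "\<Union>\<F> \<in> \<A>" using \<F> B by (intro A.finite_Union) auto
    moreover have "openin Y (\<Union>\<F>)" using \<F> B by (intro openin_Union) blast
    moreover have "\<Union>\<F> \<subseteq> U" using \<F>(2) B by blast
    ultimately show ?thesis using \<F>(3) by blast
  qed
  \<comment> \<open>\<open>lam\<close> is meant for compact sets, \<open>ost\<close> for open sets,
    \<open>mu\<close> for all subsets. Passing through compact sets is what makes \<open>ost\<close>
    countably subadditive although \<open>v\<close> is not: a compact set meets a countable open
    cover in a finite one.\<close>
  define lam where "lam K = (INF G\<in>{G\<in>\<A>. openin Y G \<and> K \<subseteq> G}. ennreal (v G))" for K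
  define ost where "ost G = (SUP K\<in>{K. compactin Y K \<and> K \<subseteq> G}. lam K)" for G
  define mu where "mu S = (INF G\<in>{G. openin Y G \<and> S \<subseteq> G}. ost G)" for S
  have top_in: "?\<Omega> \<in> \<A>" by simp
  have lam_le: "lam K \<le> ennreal (v G)" if "G \<in> \<A>" "openin Y G" "K \<subseteq> G" for K G
    unfolding lam_def using that by (intro INF_lower) auto
  have lam_le1: "lam K \<le> 1" if "K \<subseteq> ?\<Omega>" for K
    using lam_le[OF top_in openin_topspace that] one by simp
  have lam_mono: "lam K \<le> lam L" if "K \<subseteq> L" for K L
    unfolding lam_def using that by (intro INF_superset_mono) auto
  have lam_empty: "lam {} = 0"
    using lam_le[of "{}" "{}"] v_empty by simp
  have lam_approx: "\<exists>G\<in>\<A>. openin Y G \<and> K \<subseteq> G \<and> ennreal (v G) \<le> lam K + ennreal e"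
    if "K \<subseteq> ?\<Omega>" "0 < e" for K e
  proof -
    have "lam K < lam K + ennreal e"
      using lam_le1[OF that(1)] that(2) ennreal_add_left_cancel_less[of "lam K" 0 "ennreal e"]
      by (auto simp: top_unique)
    then show ?thesis unfolding lam_def by (subst (asm) INF_less_iff) (auto intro: less_imp_le)
  qed
  have lam_Un: "lam (K \<union> L) \<le> lam K + lam L" if KL: "K \<subseteq> ?\<Omega>" "L \<subseteq> ?\<Omega>" for K L
  proof (rule ennreal_le_epsilon)
    fix e :: real assume e: "0 < e"
    obtain G where G: "G \<in> \<A>" "openin Y G" "K \<subseteq> G" "ennreal (v G) \<le> lam K + ennreal (e/2)"
      using lam_approx[OF KL(1), of "e/2"] e by auto
    obtain H where H: "H \<in> \<A>" "openin Y H" "L \<subseteq> H" "ennreal (v H) \<le> lam L + ennreal (e/2)"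
      using lam_approx[OF KL(2), of "e/2"] e by auto
    have "lam (K \<union> L) \<le> ennreal (v (G \<union> H))" using G H by (intro lam_le) auto
    also have "\<dots> \<le> ennreal (v G + v H)" using v_Un G H by (intro ennreal_leI) auto
    also have "\<dots> = ennreal (v G) + ennreal (v H)" using pos G H by simp
    also have "\<dots> \<le> (lam K + ennreal (e/2)) + (lam L + ennreal (e/2))" using G H by (intro add_mono)
    also have "\<dots> = lam K + lam L + (ennreal (e/2) + ennreal (e/2))" by (simp add: ac_simps)
    also have "ennreal (e/2) + ennreal (e/2) = ennreal e" using e by (subst ennreal_plus[symmetric]) auto
    finally show "lam (K \<union> L) \<le> lam K + lam L + ennreal e" .
  qed
  \<comment> \<open>The compact sets are separated by disjoint open sets, which \<open>cover\<close>
    shrinks into a competitor \<open>G\<close> for the union; there additivity of \<open>v\<close>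
    applies.\<close>
  have lam_disj: "lam K + lam L \<le> lam (K \<union> L)" if KL: "compactin Y K" "compactin Y L" "K \<inter> L = {}" for K L
  proof -
    obtain U V where UV: "openin Y U" "openin Y V" "K \<subseteq> U" "L \<subseteq> V" "disjnt U V"
      using haus KL unfolding Hausdorff_space_compact_sets disjnt_def by metis
    show ?thesis unfolding lam_def[of "K \<union> L"]
    proof (rule INF_greatest)
      fix G assume "G \<in> {G \<in> \<A>. openin Y G \<and> K \<union> L \<subseteq> G}"
      then have G: "G \<in> \<A>" "openin Y G" "K \<subseteq> G" "L \<subseteq> G" by auto
      obtain G1 where G1: "G1 \<in> \<A>" "openin Y G1" "K \<subseteq> G1" "G1 \<subseteq> U \<inter> G"
        using cover[OF KL(1), of "U \<inter> G"] UV G by auto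
      obtain G2 where G2: "G2 \<in> \<A>" "openin Y G2" "L \<subseteq> G2" "G2 \<subseteq> V \<inter> G"
        using cover[OF KL(2), of "V \<inter> G"] UV G by auto
      have "lam K + lam L \<le> ennreal (v G1) + ennreal (v G2)"
        using G1 G2 by (intro add_mono lam_le)
      also have "\<dots> = ennreal (v G1 + v G2)" using pos G1 G2 by simp
      also have "v G1 + v G2 = v (G1 \<union> G2)"
        using G1 G2 UV by (intro add[symmetric]) (auto simp: disjnt_def)
      also have "ennreal \<dots> \<le> ennreal (v G)" using G1 G2 G by (intro ennreal_leI v_mono) auto
      finally show "lam K + lam L \<le> ennreal (v G)" .
    qed
  qed
  have lam_ost: "lam K \<le> ost G" if "compactin Y K" "K \<subseteq> G" for K G
    unfolding ost_def using that by (intro SUP_upper) auto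
  have ost_mono: "ost G \<le> ost H" if "G \<subseteq> H" for G H
    unfolding ost_def using that by (intro SUP_subset_mono) auto
  have ost_le1: "ost G \<le> 1" for G
    unfolding ost_def by (intro SUP_least lam_le1) (auto dest: compactin_subset_topspace)
  have ost_le: "ost G \<le> ennreal (v G)" if "G \<in> \<A>" "openin Y G" for G
    unfolding ost_def using that by (intro SUP_least lam_le) auto
  have ost_approx: "\<exists>K. compactin Y K \<and> K \<subseteq> G \<and> ost G \<le> lam K + ennreal e" if "0 < e" for G e
  proof (cases "ost G \<le> ennreal e")
    case True
    then show ?thesis by (intro exI[of _ "{}"]) (simp add: lam_empty)
  next
    case False
    have "ost G < top" using ost_le1[of G] by (metis ennreal_one_less_top le_less_trans)
    then have "ost G - ennreal e < ost G"
      using False that by (intro ennreal_between) (auto simp: not_le intro: le_less_trans)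
    then obtain K where K: "compactin Y K" "K \<subseteq> G" "ost G - ennreal e < lam K"
      unfolding ost_def by (auto simp: less_SUP_iff)
    have "ost G \<le> lam K + ennreal e"
      using K(3) by (metis ennreal_minus_le_iff ennreal_neq_top less_imp_le add.commute)
    then show ?thesis using K by blast
  qed
  have lam_fin: "lam K \<le> (\<Sum>n<N. ost (G n))"
    if KG: "compactin Y K" "K \<subseteq> (\<Union>n<N. G n)" and opG: "\<And>n. openin Y (G n)" for K G and N :: nat
    using KG
  proof (induction N arbitrary: K)
    case 0
    then show ?case by (simp add: lam_empty)
  next
    case (Suc N)
    let ?H = "\<Union>n<N. G n"
    have H: "openin Y ?H" using opG by auto
    have kc: "compactin Y (K - U)" if "openin Y U" for U
    proof -
      have "K - U = (?\<Omega> - U) \<inter> K" using compactin_subset_topspace[OF Suc.prems(1)] by auto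
      then show ?thesis using closed_Int_compactin[of Y "?\<Omega> - U" K] Suc.prems that by (auto simp: openin_closedin_eq)
    qed
    \<comment> \<open>The two remainders are disjoint compact sets. Separating them by open
      \<open>U\<close> and \<open>V\<close> cuts \<open>K\<close> into two compact pieces,
      \<open>K - U\<close> inside \<open>?H\<close> and \<open>K - V\<close> inside
      \<open>G N\<close>.\<close>
    have "disjnt (K - ?H) (K - G N)" using Suc.prems(2) by (auto simp: disjnt_def lessThan_Suc)
    then obtain U V where UV: "openin Y U" "openin Y V" "K - ?H \<subseteq> U" "K - G N \<subseteq> V" "disjnt U V"
      using haus kc[OF H] kc[OF opG[of N]] unfolding Hausdorff_space_compact_sets by metis
    have K: "K = (K - U) \<union> (K - V)" using UV(5) by (auto simp: disjnt_def)
    have "lam K \<le> lam (K - U) + lam (K - V)"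
      using lam_Un[of "K - U" "K - V"] compactin_subset_topspace[OF Suc.prems(1)] K by fastforce
    also have "\<dots> \<le> (\<Sum>n<N. ost (G n)) + ost (G N)"
      using UV by (intro add_mono Suc.IH lam_ost kc) auto
    finally show ?case by simp
  qed
  have ost_csub: "ost (\<Union>n. G n) \<le> (\<Sum>n. ost (G n))" if "\<And>n. openin Y (G n)" for G :: "nat \<Rightarrow> 'b set"
    unfolding ost_def[of "\<Union>n. G n"]
  proof (rule SUP_least)
    fix K assume "K \<in> {K. compactin Y K \<and> K \<subseteq> (\<Union>n. G n)}"
    then have K: "compactin Y K" "K \<subseteq> (\<Union>n. G n)" by auto
    have "\<exists>\<F>. finite \<F> \<and> \<F> \<subseteq> range G \<and> K \<subseteq> \<Union>\<F>"
      using K that unfolding compactin_def by (metis (no_types, lifting) image_iff)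
    then obtain \<F> where \<F>: "finite \<F>" "\<F> \<subseteq> range G" "K \<subseteq> \<Union>\<F>" by blast
    obtain I where I: "finite I" "\<F> = G ` I" using finite_subset_image[OF \<F>(1,2)] by blast
    obtain N where N: "I \<subseteq> {..<N}" using finite_nat_iff_bounded I(1) by blast
    have "K \<subseteq> (\<Union>n<N. G n)" using \<F>(3) I(2) N by blast
    then have "lam K \<le> (\<Sum>n<N. ost (G n))" using K that by (intro lam_fin) auto
    also have "\<dots> \<le> (\<Sum>n. ost (G n))" by (rule sum_le_suminf) auto
    finally show "lam K \<le> (\<Sum>n. ost (G n))" .
  qed
  have mu_open: "mu G = ost G" if "openin Y G" for G
    unfolding mu_def using that ost_mono by (intro antisym INF_greatest INF_lower) auto
  have mu_mono: "mu S \<le> mu S'" if "S \<subseteq> S'" for S S'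
    unfolding mu_def using that by (intro INF_superset_mono) auto
  have mu_le1: "mu S \<le> 1" if "S \<subseteq> ?\<Omega>" for S
    using mu_mono[OF that] mu_open[of ?\<Omega>] ost_le1[of ?\<Omega>] by simp
  have mu_approx: "\<exists>G. openin Y G \<and> S \<subseteq> G \<and> ost G \<le> mu S + ennreal e" if "S \<subseteq> ?\<Omega>" "0 < e" for S e
  proof -
    have "mu S < top" using mu_le1[OF that(1)] by (metis ennreal_one_less_top le_less_trans)
    then have "mu S < mu S + ennreal e" using that(2) ennreal_add_left_cancel_less[of "mu S" 0 "ennreal e"] by auto
    then show ?thesis unfolding mu_def by (subst (asm) INF_less_iff) (auto intro: less_imp_le)
  qed
  have mu_empty: "mu {} = 0" using mu_open[of "{}"] ost_le[of "{}"] v_empty by simp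
  have mu_csub: "mu (\<Union>n. S n) \<le> (\<Sum>n. mu (S n))" if "\<And>n. S n \<subseteq> ?\<Omega>" for S :: "nat \<Rightarrow> 'b set"
  proof (rule ennreal_le_epsilon)
    fix e :: real assume e: "0 < e"
    have "\<forall>n. \<exists>G. openin Y G \<and> S n \<subseteq> G \<and> ost G \<le> mu (S n) + ennreal (e * (1/2)^Suc n)"
      using mu_approx that e by simp
    then obtain G where G: "\<And>n. openin Y (G n)" "\<And>n. S n \<subseteq> G n"
      "\<And>n. ost (G n) \<le> mu (S n) + ennreal (e * (1/2)^Suc n)" by metis
    have "mu (\<Union>n. S n) \<le> mu (\<Union>n. G n)" using G by (intro mu_mono) blast
    also have "\<dots> = ost (\<Union>n. G n)" using G by (intro mu_open) auto
    also have "\<dots> \<le> (\<Sum>n. ost (G n))" by (rule ost_csub[OF G(1)])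
    also have "\<dots> \<le> (\<Sum>n. mu (S n) + ennreal (e * (1/2)^Suc n))" using G(3) by (intro suminf_le) auto
    also have "\<dots> = (\<Sum>n. mu (S n)) + (\<Sum>n. ennreal (e * (1/2)^Suc n))" by (rule suminf_add[symmetric]) auto
    also have "(\<Sum>n. ennreal (e * (1/2)^Suc n)) = ennreal (\<Sum>n. e * (1/2)^Suc n)"
      using e power_half_series by (intro suminf_ennreal2) (auto intro: summable_mult sums_summable)
    also have "(\<Sum>n. e * (1/2)^Suc n) = e"
      using sums_unique[OF sums_mult[OF power_half_series, of e]] by simp
    finally show "mu (\<Union>n. S n) \<le> (\<Sum>n. mu (S n)) + ennreal e" .
  qed
  have mu_sub2: "mu (S \<union> S') \<le> mu S + mu S'" if "S \<subseteq> ?\<Omega>" "S' \<subseteq> ?\<Omega>" for S S'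
  proof -
    have "mu (\<Union>n. (\<lambda>n::nat. if n = 0 then S else if n = 1 then S' else {}) n) \<le> (\<Sum>n. mu ((\<lambda>n::nat. if n = 0 then S else if n = 1 then S' else {}) n))"
      using that by (intro mu_csub) auto
    also have "\<dots> = (\<Sum>n<2. mu ((\<lambda>n::nat. if n = 0 then S else if n = 1 then S' else {}) n))"
      by (rule suminf_finite) (auto simp: mu_empty)
    also have "\<dots> = mu S + mu S'" by (simp add: numeral_2_eq_2)
    also have "(\<Union>n. (\<lambda>n::nat. if n = 0 then S else if n = 1 then S' else {}) n) = S \<union> S'"
      by (auto split: if_splits)
    finally show ?thesis .
  qed
  interpret Pw: sigma_algebra ?\<Omega> "Pow ?\<Omega>" by (rule sigma_algebra_Pow)
  have oms: "outer_measure_space (Pow ?\<Omega>) mu"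
    unfolding outer_measure_space_def positive_def increasing_def countably_subadditive_def
    using mu_empty mu_mono by (auto intro!: mu_csub simp: image_subset_iff)
  \<comment> \<open>Caratheodory's condition on an open test set: nearly exhaust
    \<open>G \<inter> U\<close> by a compact \<open>K\<close>, then \<open>G - K\<close>, which
    contains \<open>G - U\<close>, by a compact \<open>L\<close>. These are disjoint, so their
    contents add up inside \<open>G\<close>.\<close>
  have open_split: "mu (G \<inter> U) + mu (G - U) \<le> mu G" if G: "openin Y G" and U: "openin Y U" for G U
  proof (rule ennreal_le_epsilon)
    fix e :: real assume e: "0 < e"
    obtain K where K: "compactin Y K" "K \<subseteq> G \<inter> U" "ost (G \<inter> U) \<le> lam K + ennreal (e/2)"
      using ost_approx[of "e/2" "G \<inter> U"] e by auto
    have oGK: "openin Y (G - K)" using compactin_imp_closedin[OF haus K(1)] G by blast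
    obtain L where L: "compactin Y L" "L \<subseteq> G - K" "ost (G - K) \<le> lam L + ennreal (e/2)"
      using ost_approx[of "e/2" "G - K"] e by auto
    have "mu (G - U) \<le> mu (G - K)" using K by (intro mu_mono) auto
    then have "mu (G \<inter> U) + mu (G - U) \<le> ost (G \<inter> U) + ost (G - K)"
      using mu_open[OF oGK] mu_open[OF openin_Int[OF G U]] by (intro add_mono) auto
    also have "\<dots> \<le> (lam K + ennreal (e/2)) + (lam L + ennreal (e/2))" using K L by (intro add_mono)
    also have "\<dots> = (lam K + lam L) + (ennreal (e/2) + ennreal (e/2))" by (simp add: ac_simps)
    also have "ennreal (e/2) + ennreal (e/2) = ennreal e" using e by (subst ennreal_plus[symmetric]) auto
    also have "lam K + lam L \<le> lam (K \<union> L)" using K L by (intro lam_disj) auto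
    also have "lam (K \<union> L) \<le> ost G" using K L by (intro lam_ost compactin_Un) auto
    finally show "mu (G \<inter> U) + mu (G - U) \<le> mu G + ennreal e" using mu_open[OF G] by (simp add: add_right_mono)
  qed
  have open_L: "U \<in> lambda_system ?\<Omega> (Pow ?\<Omega>) mu" if U: "openin Y U" for U
    unfolding Pw.lambda_system_eq
  proof (intro CollectI conjI ballI)
    show "U \<in> Pow ?\<Omega>" using openin_subset[OF U] by simp
    fix S assume "S \<in> Pow ?\<Omega>"
    then have S: "S \<subseteq> ?\<Omega>" by simp
    show "mu (S \<inter> U) + mu (S - U) = mu S"
    proof (rule antisym)
      show "mu S \<le> mu (S \<inter> U) + mu (S - U)"
        using mu_sub2[of "S \<inter> U" "S - U"] S by (simp add: Int_Diff_Un le_infI1 Diff_subset[THEN order_trans])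
      show "mu (S \<inter> U) + mu (S - U) \<le> mu S"
        unfolding mu_def[of S]
      proof (rule INF_greatest)
        fix G assume "G \<in> {G. openin Y G \<and> S \<subseteq> G}"
        then have G: "openin Y G" "S \<subseteq> G" by auto
        have "mu (S \<inter> U) + mu (S - U) \<le> mu (G \<inter> U) + mu (G - U)" using G by (intro add_mono mu_mono) auto
        then show "mu (S \<inter> U) + mu (S - U) \<le> ost G" using open_split[OF G(1) U] mu_open[OF G(1)] by simp
      qed
    qed
  qed
  have msL: "measure_space ?\<Omega> (lambda_system ?\<Omega> (Pow ?\<Omega>) mu) mu"
    by (rule Pw.caratheodory_lemma[OF oms])
  then interpret L: sigma_algebra ?\<Omega> "lambda_system ?\<Omega> (Pow ?\<Omega>) mu" by (simp add: measure_space_def)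
  have bsub: "sets (borel_of Y) \<subseteq> lambda_system ?\<Omega> (Pow ?\<Omega>) mu"
    unfolding sets_borel_of using open_L by (intro L.sigma_sets_subset) auto
  define P where "P = measure_of ?\<Omega> {U. openin Y U} mu"
  have opsub: "{U. openin Y U} \<subseteq> Pow ?\<Omega>" by (auto dest: openin_subset)
  have sP: "space P = ?\<Omega>" "sets P = sets (borel_of Y)"
    using opsub by (simp_all add: P_def sets_borel_of)
  have eP: "emeasure P B = mu B" if "B \<in> sets (borel_of Y)" for B
  proof (rule emeasure_measure_of[OF P_def opsub])
    show "positive (sets P) mu" by (simp add: positive_def mu_empty)
    show "countably_additive (sets P) mu"
      using msL bsub unfolding measure_space_def countably_additive_def sP(2) by (meson order_trans subsetD)
    show "B \<in> sets P" using that sP by simp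
  qed
  have mu_top: "mu ?\<Omega> = 1"
  proof (rule antisym)
    show "mu ?\<Omega> \<le> 1" by (simp add: mu_le1)
    show "1 \<le> mu ?\<Omega>"
    proof (rule ennreal_le_epsilon)
      fix e :: real assume e: "0 < e"
      obtain K where K: "compactin Y K" "\<forall>G\<in>\<A>. openin Y G \<and> K \<subseteq> G \<longrightarrow> 1 - e \<le> v G"
        using tight[OF e] by blast
      have "ennreal (1 - e) \<le> lam K" unfolding lam_def using K by (intro INF_greatest ennreal_leI) auto
      also have "\<dots> \<le> mu ?\<Omega>" using lam_ost[OF K(1) compactin_subset_topspace[OF K(1)]] mu_open[of ?\<Omega>] by simp
      finally have "ennreal (1 - e) + ennreal e \<le> mu ?\<Omega> + ennreal e" by (rule add_right_mono)
      moreover have "1 \<le> ennreal (1 - e) + ennreal e"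
        using e by (cases "e \<le> 1") (auto simp: ennreal_plus[symmetric] ennreal_neg simp del: ennreal_plus)
      ultimately show "1 \<le> mu ?\<Omega> + ennreal e" by (rule order_trans[rotated])
    qed
  qed
  have prob: "prob_space P"
    by (rule prob_spaceI) (simp add: sP eP borel_of_open mu_top)
  then interpret P: prob_space P .
  have "emeasure P B = (SUP K\<in>{K. compactin Y K \<and> K \<subseteq> B}. emeasure P K)" if B: "B \<in> sets P" for B
  proof (rule antisym)
    show "(SUP K\<in>{K. compactin Y K \<and> K \<subseteq> B}. emeasure P K) \<le> emeasure P B"
      using B by (intro SUP_least emeasure_mono) auto
    show "emeasure P B \<le> (SUP K\<in>{K. compactin Y K \<and> K \<subseteq> B}. emeasure P K)"
    proof (rule ennreal_le_epsilon)
      fix e :: real assume e: "0 < e"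
      have B\<Omega>: "B \<subseteq> ?\<Omega>" using sets.sets_into_space[OF B] sP by simp
      \<comment> \<open>Outer regularity of the complement yields a closed subset of
        \<open>B\<close> that misses little mass; cutting it with a compact \<open>K0\<close> of
        almost full mass makes it compact.\<close>
      obtain G where G: "openin Y G" "?\<Omega> - B \<subseteq> G" "ost G \<le> mu (?\<Omega> - B) + ennreal (e/2)"
        using mu_approx[of "?\<Omega> - B" "e/2"] e by auto
      have sG: "G \<in> sets P" using G sP by (simp add: borel_of_open)
      have "emeasure P G = emeasure P (?\<Omega> - B) + emeasure P (B \<inter> G)"
        using B sG G B\<Omega> sP openin_subset[OF G(1)] sets.compl_sets[OF B]
        by (subst plus_emeasure) (auto intro!: arg_cong[where f = "emeasure P"])
      moreover have "emeasure P G \<le> emeasure P (?\<Omega> - B) + ennreal (e/2)"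
        using G eP[of G] eP[of "?\<Omega> - B"] sG sP sets.compl_sets[OF B] mu_open[OF G(1)] by simp
      ultimately have BG: "emeasure P (B \<inter> G) \<le> ennreal (e/2)"
        using P.emeasure_finite[of "?\<Omega> - B"] by (simp add: ennreal_add_left_cancel_le)
      obtain K0 where K0: "compactin Y K0" "K0 \<subseteq> ?\<Omega>" "ost ?\<Omega> \<le> lam K0 + ennreal (e/2)"
        using ost_approx[of "e/2" ?\<Omega>] e by auto
      have sK0: "K0 \<in> sets P" using K0 sP borel_of_compact[OF haus] by simp
      have "lam K0 \<le> mu K0" unfolding mu_def using K0 lam_ost by (intro INF_greatest) auto
      moreover have "mu ?\<Omega> = emeasure P K0 + emeasure P (?\<Omega> - K0)"
        using sK0 sP K0 eP[of ?\<Omega>] sets.compl_sets[OF sK0]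
        by (subst plus_emeasure) (auto simp: Un_absorb1 borel_of_open)
      ultimately have "emeasure P K0 + emeasure P (?\<Omega> - K0) \<le> lam K0 + ennreal (e/2)"
        using K0(3) mu_open[of ?\<Omega>] by simp
      also have "\<dots> \<le> emeasure P K0 + ennreal (e/2)"
        using \<open>lam K0 \<le> mu K0\<close> eP[of K0] sK0 sP by (simp add: add_right_mono)
      finally have "emeasure P K0 + emeasure P (?\<Omega> - K0) \<le> emeasure P K0 + ennreal (e/2)" .
      then have K0c: "emeasure P (?\<Omega> - K0) \<le> ennreal (e/2)"
        using P.emeasure_finite[of K0] by (simp add: ennreal_add_left_cancel_le)
      define K where "K = (?\<Omega> - G) \<inter> K0"
      have cK: "compactin Y K" unfolding K_def using G K0 by (intro closed_Int_compactin) auto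
      have KB: "K \<subseteq> B" using G by (auto simp: K_def)
      have sK: "K \<in> sets P" using cK sP borel_of_compact[OF haus] by simp
      have "emeasure P B \<le> emeasure P (K \<union> (B \<inter> G) \<union> (?\<Omega> - K0))"
        using B sG sK sK0 B\<Omega> sP sets.compl_sets[OF sK0] by (intro emeasure_mono) (auto simp: K_def)
      also have "\<dots> \<le> emeasure P (K \<union> (B \<inter> G)) + emeasure P (?\<Omega> - K0)"
        using B sG sK sK0 sP sets.compl_sets[OF sK0] by (intro emeasure_subadditive) auto
      also have "\<dots> \<le> (emeasure P K + emeasure P (B \<inter> G)) + emeasure P (?\<Omega> - K0)"
        using B sG sK by (intro add_right_mono emeasure_subadditive) auto
      also have "\<dots> \<le> (emeasure P K + ennreal (e/2)) + ennreal (e/2)"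
        using BG K0c by (intro add_mono) auto
      also have "\<dots> = emeasure P K + ennreal e" using e by (simp add: add.assoc ennreal_plus[symmetric] del: ennreal_plus)
      also have "emeasure P K \<le> (SUP K\<in>{K. compactin Y K \<and> K \<subseteq> B}. emeasure P K)"
        using cK KB by (intro SUP_upper) auto
      finally show "emeasure P B \<le> (SUP K\<in>{K. compactin Y K \<and> K \<subseteq> B}. emeasure P K) + ennreal e"
        by (simp add: add_right_mono)
    qed
  qed
  then have "P \<in> radon_prob Y" unfolding radon_prob_def using prob sP by simp
  moreover have "\<forall>G\<in>\<A>. openin Y G \<longrightarrow> emeasure P G \<le> ennreal (v G)"
    using eP ost_le mu_open by (simp add: borel_of_open)
  ultimately show ?thesis by blast
qed

text \<open>Taking complements reverses the inequality on compact sets, and inner regularity extends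
  the reversed inequality to all Borel sets. Applied to a set and its complement it becomes an
  equality, as both total masses are 1.\<close>

lemma radon_prob_eqI:
  assumes haus: "Hausdorff_space Y" and P: "P \<in> radon_prob Y" and Q: "Q \<in> radon_prob Y"
    and le: "\<And>G. openin Y G \<Longrightarrow> emeasure P G \<le> emeasure Q G"
  shows "P = Q"
proof -
  interpret P: prob_space P using radon_prob_D[OF P] by simp
  interpret Q: prob_space Q using radon_prob_D[OF Q] by simp
  note sets [simp] = radon_prob_D(2,3)[OF P] radon_prob_D(2,3)[OF Q]
  have K: "emeasure Q K \<le> emeasure P K" if "compactin Y K" for K
  proof -
    have K: "K \<in> sets (borel_of Y)" using borel_of_compact[OF haus that] .
    have "openin Y (topspace Y - K)" using compactin_imp_closedin[OF haus that] by blast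
    then have "P.prob (topspace Y - K) \<le> Q.prob (topspace Y - K)"
      using le by (fastforce simp: P.emeasure_eq_measure Q.emeasure_eq_measure)
    then show ?thesis
      using P.prob_compl[of K] Q.prob_compl[of K] K by (simp add: P.emeasure_eq_measure Q.emeasure_eq_measure)
  qed
  have B: "emeasure Q B \<le> emeasure P B" if "B \<in> sets (borel_of Y)" for B
    unfolding radon_prob_D(4)[OF P that] radon_prob_D(4)[OF Q that]
    using K by (intro SUP_mono) auto
  show ?thesis
  proof (rule measure_eqI)
    show "sets P = sets Q" by simp
    fix B assume "B \<in> sets P"
    then have sB: "B \<in> sets (borel_of Y)" "topspace Y - B \<in> sets (borel_of Y)"
      using sets.compl_sets[of B "borel_of Y"] by auto
    have "Q.prob B \<le> P.prob B" "Q.prob (topspace Y - B) \<le> P.prob (topspace Y - B)"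
      using B[OF sB(1)] B[OF sB(2)] by (simp_all add: P.emeasure_eq_measure Q.emeasure_eq_measure)
    then show "emeasure P B = emeasure Q B"
      using P.prob_compl[of B] Q.prob_compl[of B] sB by (simp add: P.emeasure_eq_measure Q.emeasure_eq_measure)
  qed
qed

text \<open>Inner regularity of the image only needs enough compact sets with compact images, so
  continuity on each of countably many Borel sets that carry all mass will do. The extension map of
  paths is continuous in this sense only: on each set of paths of bounded energy.\<close>

lemma radon_prob_distr_piecewise:
  assumes haus: "Hausdorff_space Z" and P: "P \<in> radon_prob Y"
    and f: "f \<in> measurable (borel_of Y) (borel_of Z)"
    and S: "\<And>n. S n \<in> sets (borel_of Y)" "incseq S" "emeasure P (\<Union>n::nat. S n) = 1"
    and cont: "\<And>n. continuous_map (subtopology Y (S n)) Z f"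
  shows "distr P (borel_of Z) f \<in> radon_prob Z"
proof -
  interpret P: prob_space P using radon_prob_D[OF P] by simp
  note sets [simp] = radon_prob_D(2,3)[OF P]
  have f' [measurable]: "f \<in> measurable P (borel_of Z)"
    using f by (simp cong: measurable_cong_sets)
  let ?D = "distr P (borel_of Z) f"
  have prob: "prob_space ?D" by (rule P.prob_space_distr[OF f'])
  have "emeasure ?D B = (SUP K\<in>{K. compactin Z K \<and> K \<subseteq> B}. emeasure ?D K)" if B: "B \<in> sets (borel_of Z)" for B
  proof (rule antisym)
    show "(SUP K\<in>{K. compactin Z K \<and> K \<subseteq> B}. emeasure ?D K) \<le> emeasure ?D B"
      using B by (intro SUP_least emeasure_mono) auto
    show "emeasure ?D B \<le> (SUP K\<in>{K. compactin Z K \<and> K \<subseteq> B}. emeasure ?D K)"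
    proof (rule ennreal_le_epsilon)
      fix e :: real assume e: "0 < e"
      define A where "A = f -` B \<inter> topspace Y"
      have A: "A \<in> sets (borel_of Y)" using measurable_sets[OF f B] by (simp add: A_def)
      have "AE x in P. x \<in> (\<Union>n. S n)"
        using S by (subst P.AE_in_set_eq_1) (auto simp: P.emeasure_eq_measure)
      then have "emeasure P A = emeasure P (A \<inter> (\<Union>n. S n))"
        using A S by (intro emeasure_eq_AE) auto
      also have "A \<inter> (\<Union>n. S n) = (\<Union>n. A \<inter> S n)" by auto
      also have "emeasure P \<dots> = (SUP n. emeasure P (A \<inter> S n))"
        using A S by (intro SUP_emeasure_incseq[symmetric]) (auto simp: incseq_def)
      finally have eq: "emeasure P A = (SUP n. emeasure P (A \<inter> S n))" .
      have "\<exists>n. emeasure P A \<le> emeasure P (A \<inter> S n) + ennreal (e/2)"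
      proof (cases "emeasure P A = 0")
        case False
        have "emeasure P A - ennreal (e/2) < emeasure P A"
          using False e P.emeasure_finite[of A] by (intro ennreal_between) (auto simp: less_top[symmetric] zero_less_iff_neq_zero)
        then obtain n where "emeasure P A - ennreal (e/2) < emeasure P (A \<inter> S n)"
          unfolding eq by (subst (asm) less_SUP_iff) auto
        then show ?thesis
          by (metis ennreal_minus_le_iff ennreal_neq_top less_imp_le add.commute)
      qed simp
      then obtain n where n: "emeasure P A \<le> emeasure P (A \<inter> S n) + ennreal (e/2)" by blast
      obtain K where K: "compactin Y K" "K \<subseteq> A \<inter> S n" "emeasure P (A \<inter> S n) \<le> emeasure P K + ennreal (e/2)"
        using radon_prob_inner[OF P, of "A \<inter> S n" "e/2"] A S(1) e by auto
      have cK: "compactin Z (f ` K)"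
        using K by (intro image_compactin[OF _ cont[of n]]) (auto simp: compactin_subtopology)
      have fKB: "f ` K \<subseteq> B" using K by (auto simp: A_def)
      have sK: "f ` K \<in> sets (borel_of Z)" using borel_of_compact[OF haus cK] .
      have "emeasure ?D B = emeasure P A" using B by (simp add: emeasure_distr A_def)
      also have "\<dots> \<le> (emeasure P K + ennreal (e/2)) + ennreal (e/2)"
        using n K(3) by (meson add_right_mono order_trans)
      also have "\<dots> = emeasure P K + ennreal e" using e by (simp add: add.assoc ennreal_plus[symmetric] del: ennreal_plus)
      also have "emeasure P K \<le> emeasure ?D (f ` K)"
        using sK measurable_sets[OF f sK] K by (subst emeasure_distr) (auto intro!: emeasure_mono simp: A_def)
      also have "emeasure ?D (f ` K) \<le> (SUP K\<in>{K. compactin Z K \<and> K \<subseteq> B}. emeasure ?D K)"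
        using cK fKB by (intro SUP_upper) auto
      finally show "emeasure ?D B \<le> (SUP K\<in>{K. compactin Z K \<and> K \<subseteq> B}. emeasure ?D K) + ennreal e"
        by (simp add: add_right_mono)
    qed
  qed
  then show ?thesis using prob by (simp add: radon_prob_def)
qed

lemma radon_prob_distr:
  assumes "Hausdorff_space Z" and P: "P \<in> radon_prob Y" and f: "continuous_map Y Z f"
  shows "distr P (borel_of Z) f \<in> radon_prob Z"
proof (rule radon_prob_distr_piecewise[where S = "\<lambda>_. topspace Y"])
  show "emeasure P (\<Union>n::nat. topspace Y) = 1"
    using prob_space.emeasure_space_1[of P] radon_prob_D[OF P] by simp
qed (use assms in \<open>auto intro: continuous_map_measurable borel_of_open\<close>)

lemma radon_prob_tight:
  assumes P: "P \<in> radon_prob Y" and "0 < e"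
  obtains K where "compactin Y K" "1 - e \<le> measure P K"
proof -
  interpret P: prob_space P using radon_prob_D[OF P] by simp
  obtain K where K: "compactin Y K" "emeasure P (topspace Y) \<le> emeasure P K + ennreal e"
    using radon_prob_inner[OF P, of "topspace Y" e] assms(2) by (auto simp: borel_of_open)
  have "ennreal 1 \<le> ennreal (measure P K + e)"
    using K(2) P.emeasure_space_1 radon_prob_D[OF P] assms(2) by (simp add: P.emeasure_eq_measure)
  then have "1 - e \<le> measure P K" using assms(2) by (subst (asm) ennreal_le_iff) auto
  then show ?thesis using that K by blast
qed

section \<open>Lower semicontinuous functions\<close>

definition lsc_on :: "'b topology \<Rightarrow> ('b \<Rightarrow> ennreal) \<Rightarrow> bool" where
  "lsc_on Y \<phi> \<longleftrightarrow> (\<forall>c. openin Y {x \<in> topspace Y. c < \<phi> x})"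

lemma lsc_on_measurable: "lsc_on Y \<phi> \<Longrightarrow> \<phi> \<in> borel_measurable (borel_of Y)"
  by (rule borel_measurableI_greater) (auto simp: lsc_on_def intro!: borel_of_open)

lemma lsc_on_compose:
  assumes "lsc_on Z \<phi>" "continuous_map Y Z f" shows "lsc_on Y (\<lambda>x. \<phi> (f x))"
  unfolding lsc_on_def
proof
  fix c
  have "openin Y {x \<in> topspace Y. f x \<in> {z \<in> topspace Z. c < \<phi> z}}"
    using assms unfolding lsc_on_def by (intro openin_continuous_map_preimage) auto
  moreover have "{x \<in> topspace Y. f x \<in> {z \<in> topspace Z. c < \<phi> z}} = {x \<in> topspace Y. c < \<phi> (f x)}"
    using assms(2) by (auto simp: continuous_map_def)
  ultimately show "openin Y {x \<in> topspace Y. c < \<phi> (f x)}" by simp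
qed

lemma lsc_on_mono_continuous:
  assumes \<phi>: "lsc_on Y \<phi>" and g: "mono g" "continuous_on UNIV g"
  shows "lsc_on Y (\<lambda>x. g (\<phi> x) :: ennreal)"
  unfolding lsc_on_def
proof
  fix c
  have opn: "open {y. c < g y}" using g(2) by (intro open_Collect_less continuous_intros)
  show "openin Y {x \<in> topspace Y. c < g (\<phi> x)}"
  proof (subst openin_subopen, intro ballI)
    fix x assume x: "x \<in> {x \<in> topspace Y. c < g (\<phi> x)}"
    show "\<exists>T. openin Y T \<and> x \<in> T \<and> T \<subseteq> {x \<in> topspace Y. c < g (\<phi> x)}"
    \<comment> \<open>The least element has no left neighbourhood from which to choose
      \<open>b\<close>; there monotonicity of \<open>g\<close> already gives \<open>c < g y\<close>
      for every \<open>y\<close>.\<close>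
    proof (cases "\<phi> x = 0")
      case True
      then have "c < g y" for y using x monoD[OF g(1), of 0 y] by auto
      then show ?thesis using x by (intro exI[of _ "topspace Y"]) auto
    next
      case False
      then obtain b where b: "b < \<phi> x" "{b<..\<phi> x} \<subseteq> {y. c < g y}"
        using open_left[OF opn, of "\<phi> x" 0] x by (auto simp: zero_less_iff_neq_zero)
      have "c < g (\<phi> y)" if "b < \<phi> y" for y
      proof (cases "\<phi> y \<le> \<phi> x")
        case True then show ?thesis using b that by auto
      next
        case False
        then have "g (\<phi> x) \<le> g (\<phi> y)" using g(1) by (auto intro: monoD)
        then show ?thesis using x by auto
      qed
      then show ?thesis using b x \<phi> by (intro exI[of _ "{x \<in> topspace Y. b < \<phi> x}"]) (auto simp: lsc_on_def)
    qed
  qed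
qed

lemma lsc_on_add:
  assumes \<phi>: "lsc_on Y \<phi>" and \<psi>: "lsc_on Y \<psi>"
  shows "lsc_on Y (\<lambda>x. \<phi> x + \<psi> x)"
  unfolding lsc_on_def
proof
  fix c
  show "openin Y {x \<in> topspace Y. c < \<phi> x + \<psi> x}"
  proof (subst openin_subopen, intro ballI)
    fix x assume "x \<in> {x \<in> topspace Y. c < \<phi> x + \<psi> x}"
    then have x: "x \<in> topspace Y" "c < \<phi> x + \<psi> x" by auto
    consider "c < \<phi> x" | "c < \<psi> x" | "\<phi> x \<le> c" "\<psi> x \<le> c" by (meson not_le)
    then show "\<exists>T. openin Y T \<and> x \<in> T \<and> T \<subseteq> {x \<in> topspace Y. c < \<phi> x + \<psi> x}"
    proof cases
      case 1
      then show ?thesis using x \<phi>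
        by (intro exI[of _ "{x \<in> topspace Y. c < \<phi> x}"]) (auto simp: lsc_on_def add_increasing2 intro: less_le_trans)
    next
      case 2
      then show ?thesis using x \<psi>
        by (intro exI[of _ "{x \<in> topspace Y. c < \<psi> x}"]) (auto simp: lsc_on_def add_increasing intro: less_le_trans)
    next
      case 3
      have "c \<noteq> top" using x(2) by (metis not_top_less)
      then obtain c' where c': "c = ennreal c'" "0 \<le> c'" by (cases c) auto
      obtain a where a: "\<phi> x = ennreal a" "0 \<le> a" using 3 \<open>c \<noteq> top\<close> by (cases "\<phi> x") (auto simp: top_unique)
      obtain b where b: "\<psi> x = ennreal b" "0 \<le> b" using 3 \<open>c \<noteq> top\<close> by (cases "\<psi> x") (auto simp: top_unique)
      have "c' < a + b" "a \<le> c'" "b \<le> c'"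
        using x(2) 3 a b c' by (auto simp: ennreal_less_iff ennreal_plus[symmetric] simp del: ennreal_plus)
      \<comment> \<open>\<open>a\<close> and \<open>b\<close> are both lowered by half of the excess
        \<open>a + b - c'\<close>, so that \<open>r + s = c'\<close>. The bounds
        \<open>b \<le> c'\<close> and \<open>a \<le> c'\<close> of this case keep \<open>r\<close>
        and \<open>s\<close> nonnegative.\<close>
      define r where "r = (c' - b + a) / 2"
      define s where "s = (c' - a + b) / 2"
      have rs: "0 \<le> r" "r < a" "0 \<le> s" "s < b" "c' \<le> r + s"
        using \<open>c' < a + b\<close> \<open>a \<le> c'\<close> \<open>b \<le> c'\<close> a b by (auto simp: r_def s_def field_simps)
      have "c < \<phi> y + \<psi> y" if "ennreal r < \<phi> y" "ennreal s < \<psi> y" for y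
      proof -
        have "c \<le> ennreal r + ennreal s" using rs c' by (simp add: ennreal_plus[symmetric] del: ennreal_plus)
        also have "\<dots> < \<phi> y + \<psi> y" using that by (rule add_strict_mono)
        finally show ?thesis .
      qed
      moreover have "openin Y ({x \<in> topspace Y. ennreal r < \<phi> x} \<inter> {x \<in> topspace Y. ennreal s < \<psi> x})"
        using \<phi> \<psi> unfolding lsc_on_def by blast
      ultimately show ?thesis using x rs a b
        by (intro exI[of _ "{x \<in> topspace Y. ennreal r < \<phi> x} \<inter> {x \<in> topspace Y. ennreal s < \<psi> x}"])
           (auto simp: ennreal_less_iff)
    qed
  qed
qed

lemma lsc_on_const: "lsc_on Y (\<lambda>_. c)"
proof -
  have "{x \<in> topspace Y. r < c} = (if r < c then topspace Y else {})" for r by auto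
  then show ?thesis by (simp add: lsc_on_def)
qed

lemma lsc_on_sum:
  assumes "finite I" "\<And>i. i \<in> I \<Longrightarrow> lsc_on Y (\<phi> i)"
  shows "lsc_on Y (\<lambda>x. \<Sum>i\<in>I. \<phi> i x)"
  using assms by (induction I rule: finite_induct) (auto intro: lsc_on_const lsc_on_add)

lemma closedin_lsc_le: "lsc_on Y \<phi> \<Longrightarrow> closedin Y {x \<in> topspace Y. \<phi> x \<le> c}"
proof -
  assume "lsc_on Y \<phi>"
  moreover have "topspace Y - {x \<in> topspace Y. \<phi> x \<le> c} = {x \<in> topspace Y. c < \<phi> x}" by auto
  ultimately show ?thesis unfolding lsc_on_def closedin_def by auto
qed

lemma ennreal_power2_le_iff: "(x::ennreal)\<^sup>2 \<le> y\<^sup>2 \<longleftrightarrow> x \<le> y"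
  by (cases x; cases y) (auto simp: ennreal_power top_unique power_eq_top_ennreal)

lemma ennreal_power2_less_iff: "(x::ennreal)\<^sup>2 < y\<^sup>2 \<longleftrightarrow> x < y"
  using ennreal_power2_le_iff[of y x] by (simp add: not_le[symmetric])

lemma ennreal_sqrt_power2 [simp]: "(ennreal_sqrt x)\<^sup>2 = x"
  by (cases x) (auto simp: ennreal_sqrt_def ennreal_power)

lemma lsc_on_power2: "lsc_on Y \<phi> \<Longrightarrow> lsc_on Y (\<lambda>x. (\<phi> x)\<^sup>2)"
  using ennreal_power2_less_iff[of "ennreal_sqrt c" for c] by (simp add: lsc_on_def)

lemma lsc_on_divide_const:
  assumes "lsc_on Y \<phi>" "0 < r" shows "lsc_on Y (\<lambda>x. \<phi> x / ennreal r)"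
  using assms(1)
proof (rule lsc_on_mono_continuous)
  show "mono (\<lambda>x::ennreal. x / ennreal r)" by (intro monoI divide_right_mono_ennreal)
  show "continuous_on UNIV (\<lambda>x::ennreal. x / ennreal r)"
    using ennreal_continuous_on_cmult[of "inverse (ennreal r)" UNIV "\<lambda>x. x"] assms(2)
    by (simp add: divide_ennreal_def mult.commute inverse_ennreal continuous_on_id)
qed

text \<open>\<open>g N\<close> rounds \<open>z\<close> down to the grid \<open>{0, \<delta>, ..., N \<delta>}\<close>. It is a sum of indicators of
  superlevel sets, which are open if \<open>z\<close> is a value of a lower semicontinuous function.\<close>
lemma staircase_bounds:
  fixes z :: ennreal and \<delta> :: real
  defines "g \<equiv> \<lambda>N. \<Sum>j\<in>{1..N::nat}. ennreal \<delta> * (if ennreal (real j * \<delta>) < z then 1 else 0)"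
  assumes \<delta>: "0 < \<delta>"
  shows "ennreal (real N * \<delta>) < z \<Longrightarrow> g N = ennreal (real N * \<delta>)" and "g N \<le> z"
    and "r \<le> z \<Longrightarrow> r \<le> ennreal (real N * \<delta>) \<Longrightarrow> r \<le> g N + ennreal \<delta>"
proof -
  have g_Suc: "g (Suc N) = g N + ennreal \<delta> * (if ennreal (real (Suc N) * \<delta>) < z then 1 else 0)" for N
    by (simp add: g_def)
  have step: "ennreal (real N * \<delta>) + ennreal \<delta> = ennreal (real (Suc N) * \<delta>)" for N
    using \<delta> by (simp add: ennreal_plus[symmetric] algebra_simps del: ennreal_plus)
  show 1: "ennreal (real N * \<delta>) < z \<Longrightarrow> g N = ennreal (real N * \<delta>)" for N
  proof (induction N)
    case 0 then show ?case by (simp add: g_def)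
  next
    case (Suc N)
    have "ennreal (real N * \<delta>) \<le> ennreal (real (Suc N) * \<delta>)" using \<delta> by (intro ennreal_leI) simp
    then have "g N = ennreal (real N * \<delta>)" using Suc by (meson le_less_trans)
    then show ?case using Suc.prems step[of N] by (simp add: g_Suc)
  qed
  show "g N \<le> z"
  proof (induction N)
    case 0 then show ?case by (simp add: g_def)
  next
    case (Suc N)
    then show ?case using 1[of "Suc N"] by (cases "ennreal (real (Suc N) * \<delta>) < z") (auto simp: g_Suc)
  qed
  show "r \<le> z \<Longrightarrow> r \<le> ennreal (real N * \<delta>) \<Longrightarrow> r \<le> g N + ennreal \<delta>"
  proof (induction N)
    case 0 then show ?case by simp
  next
    case (Suc N)
    have mono: "g N + ennreal \<delta> \<le> g (Suc N) + ennreal \<delta>" by (simp add: g_Suc add_right_mono)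
    show ?case
    proof (cases "r \<le> ennreal (real N * \<delta>)")
      case True then show ?thesis using Suc mono by (meson order_trans)
    next
      case False
      then have "g N = ennreal (real N * \<delta>)" using Suc.prems by (intro 1) auto
      then have "r \<le> g N + ennreal \<delta>" using Suc.prems step[of N] by simp
      then show ?thesis using mono by (rule order_trans)
    qed
  qed
qed

text \<open>This combines the halves of Prokhorov's and of the portmanteau theorem that are needed
  later. One measure \<open>R\<close> serves all integrands and all bounds, because the cluster
  filter is fixed before them. Integrals are controlled through open superlevel sets, on which
  \<open>R\<close> is at most the limit content.\<close>

lemma radon_seq_limit:
  fixes P :: "nat \<Rightarrow> 'b measure"
  assumes haus: "Hausdorff_space Y" and P: "\<And>n. P n \<in> radon_prob Y"
    and tight: "\<And>e. 0 < e \<Longrightarrow> \<exists>K. compactin Y K \<and> (\<forall>n. 1 - e \<le> measure (P n) K)"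
  shows "\<exists>R\<in>radon_prob Y. \<forall>\<phi> C. lsc_on Y \<phi> \<longrightarrow> (\<forall>\<^sub>F n in sequentially. (\<integral>\<^sup>+x. \<phi> x \<partial>P n) \<le> C)
           \<longrightarrow> (\<integral>\<^sup>+x. \<phi> x \<partial>R) \<le> C"
proof -
  interpret P: prob_space "P n" for n using radon_prob_D[OF P] by simp
  note sets [simp] = radon_prob_D(2,3)[OF P]
  obtain F w where F: "F \<le> sequentially" "F \<noteq> bot" and w: "\<And>A. ((\<lambda>n. measure (P n) A) \<longlongrightarrow> w A) F"
    using compact_limit_family[of sequentially "\<lambda>n. measure (P n)"] by (auto simp: P.prob_le_1)
  \<comment> \<open>The setwise limit \<open>w\<close> loses countable additivity, but
    \<open>radon_from_content\<close> asks for finite additivity only. Tightness passes to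
    \<open>w\<close> since one compact set serves all \<open>n\<close>.\<close>
  have "\<exists>R\<in>radon_prob Y. \<forall>G\<in>sets (borel_of Y). openin Y G \<longrightarrow> emeasure R G \<le> ennreal (w G)"
  proof (rule radon_from_content[OF haus])
    show "algebra (topspace Y) (sets (borel_of Y))"
      using sets.algebra_axioms[of "borel_of Y"] by simp
    show "0 \<le> w S" for S by (rule tendsto_lowerbound[OF w _ F(2)]) simp
    show "w (S \<union> T) = w S + w T" if "S \<in> sets (borel_of Y)" "T \<in> sets (borel_of Y)" "S \<inter> T = {}" for S T
    proof (rule tendsto_unique[OF F(2) w])
      have "(\<lambda>n. measure (P n) (S \<union> T)) = (\<lambda>n. measure (P n) S + measure (P n) T)"
        using that by (intro ext P.finite_measure_Union) auto
      then show "((\<lambda>n. measure (P n) (S \<union> T)) \<longlongrightarrow> w S + w T) F"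
        using tendsto_add[OF w[of S] w[of T]] by simp
    qed
    show "w (topspace Y) = 1"
    proof (rule tendsto_unique[OF F(2) w])
      have "measure (P n) (topspace Y) = 1" for n using P.prob_space[of n] by simp
      then show "((\<lambda>n. measure (P n) (topspace Y)) \<longlongrightarrow> 1) F" by simp
    qed
    show "\<exists>B\<in>sets (borel_of Y). openin Y B \<and> x \<in> B \<and> B \<subseteq> U" if "openin Y U" "x \<in> U" for U x
      using that by (intro bexI[of _ U]) (auto simp: borel_of_open)
    fix e :: real assume "0 < e"
    then obtain K where K: "compactin Y K" "\<And>n. 1 - e \<le> measure (P n) K" using tight by blast
    have "1 - e \<le> w G" if "G \<in> sets (borel_of Y)" "K \<subseteq> G" for G
    proof (rule tendsto_lowerbound[OF w _ F(2)])
      have "measure (P n) K \<le> measure (P n) G" for n using that by (intro P.finite_measure_mono) auto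
      then show "\<forall>\<^sub>F n in F. 1 - e \<le> measure (P n) G" using K(2) by (intro always_eventually) (meson order_trans)
    qed
    then show "\<exists>K. compactin Y K \<and> (\<forall>G\<in>sets (borel_of Y). openin Y G \<and> K \<subseteq> G \<longrightarrow> 1 - e \<le> w G)"
      using K by blast
  qed
  then obtain R where R: "R \<in> radon_prob Y" "\<And>G. openin Y G \<Longrightarrow> emeasure R G \<le> ennreal (w G)"
    using borel_of_open by blast
  interpret R: prob_space R using radon_prob_D[OF R(1)] by simp
  note sets' [simp] = radon_prob_D(2,3)[OF R(1)]
  have "(\<integral>\<^sup>+x. \<phi> x \<partial>R) \<le> C" if \<phi>: "lsc_on Y \<phi>" and C: "\<forall>\<^sub>F n in sequentially. (\<integral>\<^sup>+x. \<phi> x \<partial>P n) \<le> C" for \<phi> C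
  proof (cases "C = top")
    case False
    have \<phi>m [measurable]: "\<phi> \<in> borel_measurable (borel_of Y)" using \<phi> by (rule lsc_on_measurable)
    define G where "G c = {x \<in> topspace Y. c < \<phi> x}" for c
    have Go: "openin Y (G c)" for c using \<phi> by (simp add: lsc_on_def G_def)
    have Gs [measurable]: "G c \<in> sets (borel_of Y)" for c using Go by (rule borel_of_open)
    \<comment> \<open>With mesh \<open>1 / (k + 1)\<close> and \<open>(k + 1)^2\<close> steps the
      grid reaches up to \<open>k + 1\<close>, so it becomes finer and exhausts the half-line at the
      same time.\<close>
    define \<delta> where "\<delta> k = 1 / real (Suc k)" for k :: nat
    have \<delta>: "0 < \<delta> k" for k by (simp add: \<delta>_def)
    define \<psi> where "\<psi> k x = (\<Sum>j\<in>{1..(Suc k)^2}. ennreal (\<delta> k) * (if ennreal (real j * \<delta> k) < \<phi> x then 1 else 0))" for k x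
    have \<psi>_ind: "\<psi> k x = (\<Sum>j\<in>{1..(Suc k)^2}. ennreal (\<delta> k) * indicator (G (ennreal (real j * \<delta> k))) x)"
      if "x \<in> topspace Y" for k x
      unfolding \<psi>_def using that
      by (intro sum.cong refl arg_cong2[where f = "(*)"]) (simp add: G_def indicator_def)
    have \<psi>_int: "(\<integral>\<^sup>+x. \<psi> k x \<partial>M) = (\<Sum>j\<in>{1..(Suc k)^2}. ennreal (\<delta> k) * emeasure M (G (ennreal (real j * \<delta> k))))"
      if "space M = topspace Y" "sets M = sets (borel_of Y)" for M k
    proof -
      have "(\<integral>\<^sup>+x. \<psi> k x \<partial>M) = (\<integral>\<^sup>+x. (\<Sum>j\<in>{1..(Suc k)^2}. ennreal (\<delta> k) * indicator (G (ennreal (real j * \<delta> k))) x) \<partial>M)"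
        using \<psi>_ind that by (intro nn_integral_cong) auto
      also have "\<dots> = (\<Sum>j\<in>{1..(Suc k)^2}. ennreal (\<delta> k) * emeasure M (G (ennreal (real j * \<delta> k))))"
        using that Gs by (subst nn_integral_sum) (auto simp: nn_integral_cmult_indicator cong: measurable_cong_sets)
      finally show ?thesis .
    qed
    have \<psi>_le: "\<psi> k x \<le> \<phi> x" for k x unfolding \<psi>_def by (rule staircase_bounds(2)[OF \<delta>])
    obtain c where c: "C = ennreal c" "0 \<le> c" using False by (cases C) auto
    have \<psi>_C: "(\<integral>\<^sup>+x. \<psi> k x \<partial>R) \<le> C" for k
    proof -
      let ?J = "{1..(Suc k)^2}" and ?G = "\<lambda>j. G (ennreal (real j * \<delta> k))"
      have w0: "0 \<le> w A" for A by (rule tendsto_lowerbound[OF w _ F(2)]) simp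
      have "(\<Sum>j\<in>?J. \<delta> k * w (?G j)) \<le> c"
      proof (rule tendsto_upperbound[OF _ _ F(2)])
        show "((\<lambda>n. \<Sum>j\<in>?J. \<delta> k * measure (P n) (?G j)) \<longlongrightarrow> (\<Sum>j\<in>?J. \<delta> k * w (?G j))) F"
          by (intro tendsto_intros w)
        have "\<forall>\<^sub>F n in sequentially. (\<Sum>j\<in>?J. \<delta> k * measure (P n) (?G j)) \<le> c"
          using C
        proof eventually_elim
          case (elim n)
          have "ennreal (\<Sum>j\<in>?J. \<delta> k * measure (P n) (?G j)) = (\<integral>\<^sup>+x. \<psi> k x \<partial>P n)"
            using \<delta>[of k] by (subst \<psi>_int) (auto simp: P.emeasure_eq_measure ennreal_mult sum_ennreal[symmetric] less_imp_le)
          also have "\<dots> \<le> (\<integral>\<^sup>+x. \<phi> x \<partial>P n)" by (intro nn_integral_mono \<psi>_le)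
          also have "\<dots> \<le> ennreal c" using elim c by simp
          finally show ?case using c by (simp add: ennreal_le_iff)
        qed
        then show "\<forall>\<^sub>F n in F. (\<Sum>j\<in>?J. \<delta> k * measure (P n) (?G j)) \<le> c"
          using F(1) by (rule filter_leD[rotated])
      qed
      have "(\<integral>\<^sup>+x. \<psi> k x \<partial>R) = (\<Sum>j\<in>?J. ennreal (\<delta> k) * emeasure R (?G j))" by (rule \<psi>_int) auto
      also have "\<dots> \<le> (\<Sum>j\<in>?J. ennreal (\<delta> k) * ennreal (w (?G j)))"
        by (intro sum_mono mult_left_mono R(2) Go) auto
      also have "\<dots> = ennreal (\<Sum>j\<in>?J. \<delta> k * w (?G j))"
        using \<delta>[of k] w0 by (simp add: ennreal_mult sum_ennreal[symmetric] less_imp_le)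
      also have "\<dots> \<le> C" using \<open>(\<Sum>j\<in>?J. \<delta> k * w (?G j)) \<le> c\<close> c by (simp add: ennreal_leI)
      finally show ?thesis .
    qed
    have \<psi>m: "\<psi> k \<in> borel_measurable R" for k
      unfolding \<psi>_def using \<phi>m by (simp cong: measurable_cong_sets)
    \<comment> \<open>Where \<open>\<phi>\<close> is infinite the argument is the same: only a
      finite \<open>r\<close> below \<open>\<phi> x\<close> has to be reached by the grid. The claim
      then follows from Fatou's lemma.\<close>
    have lim: "\<phi> x \<le> liminf (\<lambda>k. \<psi> k x)" for x
      unfolding le_Liminf_iff
    proof (intro allI impI)
      fix y assume "y < \<phi> x"
      then obtain r where r: "y < r" "r < \<phi> x" using dense by blast
      obtain r' where r': "r = ennreal r'" "0 \<le> r'" using r by (cases r) (auto simp: top_unique)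
      obtain y' where y': "y = ennreal y'" "0 \<le> y'" using r by (cases y) (auto simp: top_unique)
      have yr: "y' < r'" using r r' y' by (simp add: ennreal_less_iff)
      have "\<forall>\<^sub>F k in sequentially. r' \<le> real (Suc k)"
        by real_asymp
      moreover have "\<forall>\<^sub>F k in sequentially. 1 / real (Suc k) < r' - y'"
        using yr by (intro order_tendstoD(2)[OF lim_inverse_n'[THEN LIMSEQ_Suc]]) (auto simp: )
      ultimately show "\<forall>\<^sub>F k in sequentially. y < \<psi> k x"
      proof eventually_elim
        case (elim k)
        have "r \<le> \<psi> k x + ennreal (\<delta> k)"
          unfolding \<psi>_def
        proof (rule staircase_bounds(3)[OF \<delta>])
          show "r \<le> \<phi> x" using r by simp
          have "real ((Suc k)\<^sup>2) * \<delta> k = real (Suc k)" 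
            unfolding \<delta>_def power2_eq_square of_nat_mult by (simp del: of_nat_Suc)
          then show "r \<le> ennreal (real ((Suc k)\<^sup>2) * \<delta> k)"
            using elim r' by (simp add: ennreal_leI del: of_nat_Suc)
        qed
        show "y < \<psi> k x"
        proof (rule ccontr)
          assume "\<not> y < \<psi> k x"
          then have "\<psi> k x \<le> y" by simp
          then have "r \<le> y + ennreal (\<delta> k)" using \<open>r \<le> \<psi> k x + ennreal (\<delta> k)\<close> by (meson add_right_mono order_trans)
          then have "r' \<le> y' + \<delta> k" using r' y' \<delta>[of k]
            by (simp add: ennreal_plus[symmetric] less_imp_le del: ennreal_plus)
          then show False using elim by (simp add: \<delta>_def)
        qed
      qed
    qed
    have "(\<integral>\<^sup>+x. \<phi> x \<partial>R) \<le> (\<integral>\<^sup>+x. liminf (\<lambda>k. \<psi> k x) \<partial>R)" by (intro nn_integral_mono lim)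
    also have "\<dots> \<le> liminf (\<lambda>k. \<integral>\<^sup>+x. \<psi> k x \<partial>R)" by (rule nn_integral_liminf[OF \<psi>m])
    also have "\<dots> \<le> C" using \<psi>_C by (intro Liminf_le) auto
    finally show ?thesis .
  qed simp
  then show ?thesis using R by blast
qed

section \<open>Gluing and the Wasserstein distance\<close>

text \<open>Without disintegration: for a finite Borel partition of \<open>X\<close>, take the conditionally independent
  coupling on each cell; a limit along refining partitions is concentrated on \<open>f = g\<close>. The
  approximations live only on the product \<open>\<sigma>\<close>-algebra, hence the subalgebra in \<open>radon_from_content\<close>.\<close>
lemma radon_prob_glue:
  fixes X :: "'a topology" and Y :: "'b topology" and Z :: "'c topology"
  assumes hX: "Hausdorff_space X" and hY: "Hausdorff_space Y" and hZ: "Hausdorff_space Z"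
    and P: "P \<in> radon_prob Y" and Q: "Q \<in> radon_prob Z"
    and f: "continuous_map Y X f" and g: "continuous_map Z X g"
    and eq: "distr P (borel_of X) f = distr Q (borel_of X) g"
  obtains R where "R \<in> radon_prob (prod_topology Y Z)"
    "distr R (borel_of Y) fst = P" "distr R (borel_of Z) snd = Q"
    "AE p in R. f (fst p) = g (snd p)"
proof -
  interpret P: prob_space P using radon_prob_D[OF P] by simp
  interpret Q: prob_space Q using radon_prob_D[OF Q] by simp
  interpret PQ: pair_prob_space P Q ..
  note spP [simp] = radon_prob_D(2,3)[OF P] and spQ [simp] = radon_prob_D(2,3)[OF Q]
  define \<mu> where "\<mu> = distr P (borel_of X) f"
  have fm [measurable]: "f \<in> measurable P (borel_of X)" and gm [measurable]: "g \<in> measurable Q (borel_of X)"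
    using continuous_map_measurable[OF f] continuous_map_measurable[OF g] by (simp_all cong: measurable_cong_sets)
  have fX: "f y \<in> topspace X" if "y \<in> topspace Y" for y using f that by (auto simp: continuous_map_def)
  have gX: "g z \<in> topspace X" if "z \<in> topspace Z" for z using g that by (auto simp: continuous_map_def)
  interpret mu: prob_space \<mu> unfolding \<mu>_def by (rule P.prob_space_distr[OF fm])
  let ?\<Omega> = "topspace (prod_topology Y Z)" and ?M = "sets (P \<Otimes>\<^sub>M Q)" and ?BX = "sets (borel_of X)"
  \<comment> \<open>The cell of those points that lie in exactly the members of \<open>\<F>\<close>
    listed in \<open>a\<close>. The cells with \<open>a \<subseteq> \<F>\<close> partition
    \<open>X\<close>, and enlarging \<open>\<F>\<close> refines the partition.\<close>
  define C where "C \<F> a = {x \<in> topspace X. {A \<in> \<F>. x \<in> A} = a}" for \<F> a :: "'a set set"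
  have C_sets: "C \<F> a \<in> ?BX" if "finite \<F>" "\<F> \<subseteq> ?BX" for \<F> a
  proof (cases "a \<subseteq> \<F>")
    case True
    have "C \<F> a = topspace X \<inter> (\<Inter>A\<in>\<F>. if A \<in> a then A else topspace X - A)"
      using True unfolding C_def by (auto split: if_splits)
    also have "\<dots> \<in> ?BX"
    proof (cases "\<F> = {}")
      case False
      then show ?thesis using that sets.compl_sets[of _ "borel_of X"]
        by (intro sets.Int sets.finite_INT) (auto simp: borel_of_open)
    qed (simp add: borel_of_open)
    finally show ?thesis .
  next
    case False
    then have "C \<F> a = {}" by (auto simp: C_def)
    then show ?thesis by simp
  qed
  define cf where "cf \<F> a = f -` C \<F> a \<inter> topspace Y" for \<F> a
  define cg where "cg \<F> a = g -` C \<F> a \<inter> topspace Z" for \<F> a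
  have cf_sets: "cf \<F> a \<in> sets P" if "finite \<F>" "\<F> \<subseteq> ?BX" for \<F> a
    using measurable_sets[OF fm C_sets[OF that]] by (simp add: cf_def)
  have cg_sets: "cg \<F> a \<in> sets Q" if "finite \<F>" "\<F> \<subseteq> ?BX" for \<F> a
    using measurable_sets[OF gm C_sets[OF that]] by (simp add: cg_def)
  have mu_cf: "measure P (cf \<F> a) = measure \<mu> (C \<F> a)" if "finite \<F>" "\<F> \<subseteq> ?BX" for \<F> a
    unfolding \<mu>_def using C_sets[OF that] by (subst measure_distr) (auto simp: cf_def)
  have mu_cg: "measure Q (cg \<F> a) = measure \<mu> (C \<F> a)" if "finite \<F>" "\<F> \<subseteq> ?BX" for \<F> a
    unfolding \<mu>_def eq using C_sets[OF that] by (subst measure_distr) (auto simp: cg_def)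
  \<comment> \<open>Dividing the product measure on a pair of cells by their common mass restores
    the marginals \<open>P\<close> and \<open>Q\<close>. A null cell gets weight 0, as
    \<open>1 / 0 = 0\<close>, which is right because its preimages under \<open>f\<close> and
    \<open>g\<close> are null sets.\<close>
  define \<kappa> where "\<kappa> \<F> a = ennreal (1 / measure \<mu> (C \<F> a))" for \<F> a
  define D where "D \<F> = density (P \<Otimes>\<^sub>M Q) (\<lambda>p. \<Sum>a\<in>Pow \<F>. \<kappa> \<F> a * indicator (cf \<F> a \<times> cg \<F> a) p)" for \<F>
  have D_sets [simp]: "sets (D \<F>) = ?M" "space (D \<F>) = ?\<Omega>" for \<F>
    by (simp_all add: D_def space_pair_measure)
  have D_eq: "emeasure (D \<F>) S = (\<Sum>a\<in>Pow \<F>. \<kappa> \<F> a * emeasure (P \<Otimes>\<^sub>M Q) ((cf \<F> a \<times> cg \<F> a) \<inter> S))"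
    if F: "finite \<F>" "\<F> \<subseteq> ?BX" and S: "S \<in> ?M" for \<F> S
  proof -
    have R: "cf \<F> a \<times> cg \<F> a \<in> ?M" for a using cf_sets[OF F] cg_sets[OF F] by (rule pair_measureI)
    have "emeasure (D \<F>) S = (\<integral>\<^sup>+p. (\<Sum>a\<in>Pow \<F>. \<kappa> \<F> a * indicator (cf \<F> a \<times> cg \<F> a) p) * indicator S p \<partial>(P \<Otimes>\<^sub>M Q))"
      unfolding D_def using R S
      by (intro emeasure_density borel_measurable_sum borel_measurable_times_ennreal
          borel_measurable_const borel_measurable_indicator)
    also have "\<dots> = (\<integral>\<^sup>+p. (\<Sum>a\<in>Pow \<F>. \<kappa> \<F> a * indicator ((cf \<F> a \<times> cg \<F> a) \<inter> S) p) \<partial>(P \<Otimes>\<^sub>M Q))"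
      by (intro nn_integral_cong) (simp add: sum_distrib_right indicator_inter_arith mult.assoc)
    also have "\<dots> = (\<Sum>a\<in>Pow \<F>. \<kappa> \<F> a * emeasure (P \<Otimes>\<^sub>M Q) ((cf \<F> a \<times> cg \<F> a) \<inter> S))"
      using R S by (subst nn_integral_sum)
        (intro borel_measurable_times_ennreal borel_measurable_const borel_measurable_indicator sets.Int,
          simp_all add: nn_integral_cmult_indicator sets.Int)
    finally show ?thesis .
  qed
  have D_fst: "emeasure (D \<F>) (A \<times> topspace Z) = emeasure P A" if F: "finite \<F>" "\<F> \<subseteq> ?BX" and A: "A \<in> sets P" for \<F> A
  proof -
    have A\<Omega>: "A \<subseteq> topspace Y" using sets.sets_into_space[OF A] by simp
    have term_eq: "\<kappa> \<F> a * emeasure (P \<Otimes>\<^sub>M Q) ((cf \<F> a \<times> cg \<F> a) \<inter> (A \<times> topspace Z)) = emeasure P (A \<inter> cf \<F> a)" for a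
    proof -
      have "(cf \<F> a \<times> cg \<F> a) \<inter> (A \<times> topspace Z) = (A \<inter> cf \<F> a) \<times> cg \<F> a" by (auto simp: cg_def)
      then have "emeasure (P \<Otimes>\<^sub>M Q) ((cf \<F> a \<times> cg \<F> a) \<inter> (A \<times> topspace Z)) = emeasure P (A \<inter> cf \<F> a) * ennreal (measure \<mu> (C \<F> a))"
        using A cf_sets[OF F] cg_sets[OF F] mu_cg[OF F] by (simp add: Q.emeasure_pair_measure_Times Q.emeasure_eq_measure)
      moreover have "emeasure P (A \<inter> cf \<F> a) = 0" if "measure \<mu> (C \<F> a) = 0"
      proof -
        have "measure P (A \<inter> cf \<F> a) \<le> measure P (cf \<F> a)"
          using cf_sets[OF F] by (intro P.finite_measure_mono) auto
        then have "measure P (A \<inter> cf \<F> a) = 0" using that mu_cf[OF F] measure_nonneg[of P "A \<inter> cf \<F> a"] by simp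
        then show ?thesis by (simp add: P.emeasure_eq_measure)
      qed
      ultimately show ?thesis
        by (cases "measure \<mu> (C \<F> a) = 0")
           (auto simp: \<kappa>_def P.emeasure_eq_measure ennreal_mult[symmetric])
    qed
    have "emeasure (D \<F>) (A \<times> topspace Z) = (\<Sum>a\<in>Pow \<F>. emeasure P (A \<inter> cf \<F> a))"
      using A by (subst D_eq[OF F]) (auto simp: term_eq borel_of_open)
    also have "\<dots> = emeasure P (\<Union>a\<in>Pow \<F>. A \<inter> cf \<F> a)"
      using F(1) A cf_sets[OF F] by (intro sum_emeasure) (auto simp: disjoint_family_on_def cf_def C_def)
    also have "(\<Union>a\<in>Pow \<F>. A \<inter> cf \<F> a) = A" using A\<Omega> fX by (auto simp: cf_def C_def)
    finally show ?thesis .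
  qed
  have D_snd: "emeasure (D \<F>) (topspace Y \<times> B) = emeasure Q B" if F: "finite \<F>" "\<F> \<subseteq> ?BX" and B: "B \<in> sets Q" for \<F> B
  proof -
    have B\<Omega>: "B \<subseteq> topspace Z" using sets.sets_into_space[OF B] by simp
    have term_eq: "\<kappa> \<F> a * emeasure (P \<Otimes>\<^sub>M Q) ((cf \<F> a \<times> cg \<F> a) \<inter> (topspace Y \<times> B)) = emeasure Q (B \<inter> cg \<F> a)" for a
    proof -
      have "(cf \<F> a \<times> cg \<F> a) \<inter> (topspace Y \<times> B) = cf \<F> a \<times> (B \<inter> cg \<F> a)" by (auto simp: cf_def)
      then have "emeasure (P \<Otimes>\<^sub>M Q) ((cf \<F> a \<times> cg \<F> a) \<inter> (topspace Y \<times> B)) = ennreal (measure \<mu> (C \<F> a)) * emeasure Q (B \<inter> cg \<F> a)"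
        using B cf_sets[OF F] cg_sets[OF F] mu_cf[OF F] by (simp add: Q.emeasure_pair_measure_Times P.emeasure_eq_measure)
      moreover have "emeasure Q (B \<inter> cg \<F> a) = 0" if "measure \<mu> (C \<F> a) = 0"
      proof -
        have "measure Q (B \<inter> cg \<F> a) \<le> measure Q (cg \<F> a)"
          using cg_sets[OF F] by (intro Q.finite_measure_mono) auto
        then have "measure Q (B \<inter> cg \<F> a) = 0" using that mu_cg[OF F] measure_nonneg[of Q "B \<inter> cg \<F> a"] by simp
        then show ?thesis by (simp add: Q.emeasure_eq_measure)
      qed
      ultimately show ?thesis
        by (cases "measure \<mu> (C \<F> a) = 0")
           (auto simp: \<kappa>_def Q.emeasure_eq_measure ennreal_mult[symmetric])
    qed
    have "emeasure (D \<F>) (topspace Y \<times> B) = (\<Sum>a\<in>Pow \<F>. emeasure Q (B \<inter> cg \<F> a))"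
      using B by (subst D_eq[OF F]) (auto simp: term_eq borel_of_open)
    also have "\<dots> = emeasure Q (\<Union>a\<in>Pow \<F>. B \<inter> cg \<F> a)"
      using F(1) B cg_sets[OF F] by (intro sum_emeasure) (auto simp: disjoint_family_on_def cg_def C_def)
    also have "(\<Union>a\<in>Pow \<F>. B \<inter> cg \<F> a) = B" using B\<Omega> gX by (auto simp: cg_def C_def)
    finally show ?thesis .
  qed
  \<comment> \<open>As soon as \<open>B\<close> belongs to \<open>\<F>\<close>, every cell lies
    inside \<open>B\<close> or outside it, so no pair of equal cells meets a set on which
    \<open>f\<close> is in \<open>B\<close> and \<open>g\<close> is not.\<close>
  have D_diag: "measure (D \<F>) S = 0"
    if F: "finite \<F>" "\<F> \<subseteq> ?BX" "B \<in> \<F>" and S: "S \<in> ?M" "\<And>y z. (y, z) \<in> S \<Longrightarrow> f y \<in> B \<and> g z \<notin> B" for \<F> S B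
  proof -
    have "(cf \<F> a \<times> cg \<F> a) \<inter> S = {}" for a
    proof (rule ccontr)
      assume "\<not> ?thesis"
      then obtain y z where yz: "(y, z) \<in> S" "f y \<in> C \<F> a" "g z \<in> C \<F> a" by (auto simp: cf_def cg_def)
      then have "B \<in> a \<longleftrightarrow> f y \<in> B" "B \<in> a \<longleftrightarrow> g z \<in> B" using F(3) by (auto simp: C_def)
      then show False using S(2)[OF yz(1)] by blast
    qed
    then have "emeasure (D \<F>) S = 0" using D_eq[OF F(1,2) S(1)] by simp
    then show ?thesis by (simp add: measure_def)
  qed
  let ?G = "finite_subsets_at_top ?BX"
  have evG: "\<forall>\<^sub>F \<F> in ?G. finite \<F> \<and> \<F> \<subseteq> ?BX \<and> \<B> \<subseteq> \<F>" if "finite \<B>" "\<B> \<subseteq> ?BX" for \<B>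
    unfolding eventually_finite_subsets_at_top using that by (intro exI[of _ \<B>]) auto
  have Dprob: "prob_space (D \<F>)" if F: "finite \<F>" "\<F> \<subseteq> ?BX" for \<F>
  proof (rule prob_spaceI)
    show "emeasure (D \<F>) (space (D \<F>)) = 1"
      using D_fst[OF F, of "topspace Y"] P.emeasure_space_1 by (simp add: borel_of_open)
  qed
  \<comment> \<open>The default 0 only keeps \<open>v\<close> in the unit interval for index sets
    that the filter ignores anyway.\<close>
  define v where "v \<F> S = (if finite \<F> \<and> \<F> \<subseteq> ?BX then measure (D \<F>) S else 0)" for \<F> S
  obtain F' w where F': "F' \<le> ?G" "F' \<noteq> bot" and w: "\<And>S. ((\<lambda>\<F>. v \<F> S) \<longlongrightarrow> w S) F'"
  proof (rule compact_limit_family[of ?G v])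
    show "?G \<noteq> bot" by (rule finite_subsets_at_top_neq_bot)
    show "v \<F> S \<in> {0..1}" for \<F> S using Dprob prob_space.prob_le_1[of "D \<F>"] by (auto simp: v_def)
  qed blast
  have ev: "\<forall>\<^sub>F \<F> in F'. finite \<F> \<and> \<F> \<subseteq> ?BX \<and> \<B> \<subseteq> \<F>" if "finite \<B>" "\<B> \<subseteq> ?BX" for \<B>
    using evG[OF that] F'(1) by (rule filter_leD[rotated])
  note ev0 = ev[of "{}", simplified]
  have w_eqI: "w S = c" if "\<forall>\<^sub>F \<F> in F'. v \<F> S = c" for S c
    by (rule tendsto_unique[OF F'(2) w]) (rule tendsto_eventually[OF that])
  have w_fst: "w (A \<times> topspace Z) = measure P A" if "A \<in> sets P" for A
    by (rule w_eqI, rule eventually_mono[OF ev0]) (use D_fst that in \<open>auto simp: v_def measure_def\<close>)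
  have w_snd: "w (topspace Y \<times> B) = measure Q B" if "B \<in> sets Q" for B
    by (rule w_eqI, rule eventually_mono[OF ev0]) (use D_snd that in \<open>auto simp: v_def measure_def\<close>)
  have w_diag: "w S = 0" if "B \<in> ?BX" "S \<in> ?M" "\<And>y z. (y, z) \<in> S \<Longrightarrow> f y \<in> B \<and> g z \<notin> B" for S B
    by (rule w_eqI, rule eventually_mono[OF ev[of "{B}"]]) (use D_diag that in \<open>auto simp: v_def\<close>)
  have v_mono: "v \<F> S \<le> v \<F> S'" if "S' \<in> ?M" "S \<subseteq> S'" for \<F> S S'
    using that Dprob by (auto simp: v_def prob_space_def intro!: finite_measure.finite_measure_mono)
  have rect: "A \<times> B \<in> ?M" if "A \<in> sets P" "B \<in> sets Q" for A B using that by (rule pair_measureI)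
  have "\<exists>R\<in>radon_prob (prod_topology Y Z). \<forall>G\<in>?M. openin (prod_topology Y Z) G \<longrightarrow> emeasure R G \<le> ennreal (w G)"
  proof (rule radon_from_content)
    show "Hausdorff_space (prod_topology Y Z)" using hY hZ by (simp add: Hausdorff_space_prod_topology)
    show "algebra ?\<Omega> ?M" using sets.algebra_axioms[of "P \<Otimes>\<^sub>M Q"] by (simp add: space_pair_measure)
    show "0 \<le> w S" for S by (rule tendsto_lowerbound[OF w _ F'(2)]) (simp add: v_def)
    show "w (S \<union> T) = w S + w T" if ST: "S \<in> ?M" "T \<in> ?M" "S \<inter> T = {}" for S T
    proof (rule tendsto_unique[OF F'(2) w])
      have "v \<F> (S \<union> T) = v \<F> S + v \<F> T" for \<F>
        using ST Dprob by (auto simp: v_def prob_space_def intro!: finite_measure.finite_measure_Union)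
      then show "((\<lambda>\<F>. v \<F> (S \<union> T)) \<longlongrightarrow> w S + w T) F'"
        using tendsto_add[OF w[of S] w[of T]] by simp
    qed
    show "w ?\<Omega> = 1" using w_fst[of "topspace Y"] P.prob_space by (simp add: borel_of_open)
    show "\<exists>B\<in>?M. openin (prod_topology Y Z) B \<and> x \<in> B \<and> B \<subseteq> U" if "openin (prod_topology Y Z) U" "x \<in> U" for U x
    proof -
      have "(fst x, snd x) \<in> U" using \<open>x \<in> U\<close> by simp
      with \<open>openin (prod_topology Y Z) U\<close>
      have "\<exists>U1 U2. openin Y U1 \<and> openin Z U2 \<and> fst x \<in> U1 \<and> snd x \<in> U2 \<and> U1 \<times> U2 \<subseteq> U"
        by (rule openin_prod_topology_alt[THEN iffD1, rule_format])
      then obtain U1 U2 where "openin Y U1" "openin Z U2" "fst x \<in> U1" "snd x \<in> U2" "U1 \<times> U2 \<subseteq> U"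
        by (elim exE conjE)
      then show ?thesis
        by (intro bexI[of _ "U1 \<times> U2"]) (auto simp: openin_prod_Times_iff mem_Times_iff borel_of_open intro!: rect)
    qed
    fix e :: real assume e: "0 < e"
    obtain K1 where K1: "compactin Y K1" "1 - e/2 \<le> measure P K1" using radon_prob_tight[OF P, of "e/2"] e by auto
    obtain K2 where K2: "compactin Z K2" "1 - e/2 \<le> measure Q K2" using radon_prob_tight[OF Q, of "e/2"] e by auto
    have sK: "K1 \<in> sets P" "K2 \<in> sets Q" using K1 K2 borel_of_compact hY hZ by auto
    have "1 - e \<le> w G" if G: "G \<in> ?M" "K1 \<times> K2 \<subseteq> G" for G
    proof (rule tendsto_lowerbound[OF w _ F'(2)])
      show "\<forall>\<^sub>F \<F> in F'. 1 - e \<le> v \<F> G" using ev0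
      proof eventually_elim
        case (elim \<F>)
        then have F: "finite \<F>" "\<F> \<subseteq> ?BX" by auto
        interpret D: prob_space "D \<F>" by (rule Dprob[OF F])
        have 1: "measure (D \<F>) (K1 \<times> topspace Z) = measure P K1" using D_fst[OF F sK(1)] by (simp add: measure_def)
        have 2: "measure (D \<F>) (topspace Y \<times> K2) = measure Q K2" using D_snd[OF F sK(2)] by (simp add: measure_def)
        have s1: "K1 \<times> topspace Z \<in> ?M" and s2: "topspace Y \<times> K2 \<in> ?M"
          using sK by (auto intro!: rect simp: borel_of_open)
        have "measure (D \<F>) (K1 \<times> topspace Z) + measure (D \<F>) (topspace Y \<times> K2)
            = measure (D \<F>) ((K1 \<times> topspace Z) \<union> (topspace Y \<times> K2)) + measure (D \<F>) ((K1 \<times> topspace Z) \<inter> (topspace Y \<times> K2))"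
          using s1 s2 by (subst D.finite_measure_Union') (auto simp: D.finite_measure_Diff' Int_commute)
        also have "\<dots> \<le> 1 + measure (D \<F>) G"
          using G by (intro add_mono D.prob_le_1 D.finite_measure_mono) auto
        finally show ?case using 1 2 K1 K2 F by (simp add: v_def)
      qed
    qed
    moreover have "compactin (prod_topology Y Z) (K1 \<times> K2)" using K1 K2 by (simp add: compactin_Times)
    ultimately show "\<exists>K. compactin (prod_topology Y Z) K \<and> (\<forall>G\<in>?M. openin (prod_topology Y Z) G \<and> K \<subseteq> G \<longrightarrow> 1 - e \<le> w G)"
      by blast
  qed
  then obtain R where R: "R \<in> radon_prob (prod_topology Y Z)"
    and Rle: "\<And>G. G \<in> ?M \<Longrightarrow> openin (prod_topology Y Z) G \<Longrightarrow> emeasure R G \<le> ennreal (w G)" by blast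
  note spR [simp] = radon_prob_D(2,3)[OF R]
  have hYZ: "Hausdorff_space (prod_topology Y Z)" using hY hZ by (simp add: Hausdorff_space_prod_topology)
  have mfst: "fst \<in> measurable R (borel_of Y)" and msnd: "snd \<in> measurable R (borel_of Z)"
    using continuous_map_measurable[OF continuous_map_fst[of Y Z]] continuous_map_measurable[OF continuous_map_snd[of Y Z]]
    by (simp_all cong: measurable_cong_sets)
  have R1: "distr R (borel_of Y) fst = P"
  proof (rule radon_prob_eqI[OF hY _ P])
    show "distr R (borel_of Y) fst \<in> radon_prob Y" by (rule radon_prob_distr[OF hY R continuous_map_fst])
    fix G assume G: "openin Y G"
    have GY: "G \<subseteq> topspace Y" using openin_subset[OF G] .
    have "fst -` G \<inter> space R = G \<times> topspace Z" using GY by auto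
    then have "emeasure (distr R (borel_of Y) fst) G = emeasure R (G \<times> topspace Z)"
      using G by (simp add: emeasure_distr[OF mfst] borel_of_open)
    also have "\<dots> \<le> ennreal (w (G \<times> topspace Z))"
      using G by (intro Rle rect) (auto simp: borel_of_open openin_prod_Times_iff)
    also have "\<dots> = emeasure P G" using w_fst[of G] G by (simp add: borel_of_open P.emeasure_eq_measure)
    finally show "emeasure (distr R (borel_of Y) fst) G \<le> emeasure P G" .
  qed
  have R2: "distr R (borel_of Z) snd = Q"
  proof (rule radon_prob_eqI[OF hZ _ Q])
    show "distr R (borel_of Z) snd \<in> radon_prob Z" by (rule radon_prob_distr[OF hZ R continuous_map_snd])
    fix G assume G: "openin Z G"
    have GZ: "G \<subseteq> topspace Z" using openin_subset[OF G] .
    have "snd -` G \<inter> space R = topspace Y \<times> G" using GZ by auto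
    then have "emeasure (distr R (borel_of Z) snd) G = emeasure R (topspace Y \<times> G)"
      using G by (simp add: emeasure_distr[OF msnd] borel_of_open)
    also have "\<dots> \<le> ennreal (w (topspace Y \<times> G))"
      using G by (intro Rle rect) (auto simp: borel_of_open openin_prod_Times_iff)
    also have "\<dots> = emeasure Q G" using w_snd[of G] G by (simp add: borel_of_open Q.emeasure_eq_measure)
    finally show "emeasure (distr R (borel_of Z) snd) G \<le> emeasure Q G" .
  qed
  \<comment> \<open>This open set is covered by null open rectangles, on which \<open>f\<close> and
    \<open>g\<close> take values in disjoint open sets. The cover may be uncountable, so
    \<open>N\<close> itself is null by inner regularity: a compact part of it needs only finitely
    many rectangles.\<close>
  define N where "N = {p \<in> ?\<Omega>. f (fst p) \<noteq> g (snd p)}"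
  have N_loc: "\<exists>T. openin (prod_topology Y Z) T \<and> p \<in> T \<and> T \<subseteq> N \<and> emeasure R T = 0" if p: "p \<in> N" for p
  proof -
    obtain y z where yz: "p = (y, z)" "y \<in> topspace Y" "z \<in> topspace Z" "f y \<noteq> g z" using p by (auto simp: N_def)
    obtain U V where UV: "openin X U" "openin X V" "f y \<in> U" "g z \<in> V" "disjnt U V"
      using hX fX[OF yz(2)] gX[OF yz(3)] yz(4) unfolding Hausdorff_space_def by metis
    define T where "T = {y \<in> topspace Y. f y \<in> U} \<times> {z \<in> topspace Z. g z \<in> V}"
    have o1: "openin Y {y \<in> topspace Y. f y \<in> U}" using f UV openin_continuous_map_preimage by fastforce
    have o2: "openin Z {z \<in> topspace Z. g z \<in> V}" using g UV openin_continuous_map_preimage by fastforce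
    have oT: "openin (prod_topology Y Z) T" unfolding T_def using o1 o2 by (simp add: openin_prod_Times_iff)
    have sT: "T \<in> ?M" unfolding T_def using o1 o2 by (intro rect) (simp_all add: borel_of_open)
    have "emeasure R T \<le> ennreal (w T)" using sT oT by (rule Rle)
    also have "w T = 0"
      using UV by (intro w_diag[OF borel_of_open[OF UV(1)] sT]) (auto simp: T_def disjnt_iff)
    finally have "emeasure R T = 0" by simp
    moreover have "T \<subseteq> N" using UV by (auto simp: T_def N_def disjnt_iff)
    ultimately show ?thesis using oT yz UV by (intro exI[of _ T]) (auto simp: T_def)
  qed
  have oN: "openin (prod_topology Y Z) N" by (subst openin_subopen) (use N_loc in blast)
  have "emeasure R K = 0" if K: "compactin (prod_topology Y Z) K" "K \<subseteq> N" for K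
  proof -
    define \<U> where "\<U> = {T. openin (prod_topology Y Z) T \<and> emeasure R T = 0}"
    have "K \<subseteq> \<Union>\<U>" using N_loc K(2) unfolding \<U>_def by blast
    moreover have "\<forall>U\<in>\<U>. openin (prod_topology Y Z) U" by (simp add: \<U>_def)
    ultimately obtain \<V> where V: "finite \<V>" "\<V> \<subseteq> \<U>" "K \<subseteq> \<Union>\<V>"
      using K(1) unfolding compactin_def by meson
    have nV: "\<Union>\<V> \<in> null_sets R"
      unfolding Sup_set_def[symmetric] using V by (intro null_sets.finite_UN[of \<V> "\<lambda>x. x", simplified])
       (auto simp: \<U>_def null_sets_def borel_of_open)
    show ?thesis
      using emeasure_mono[of K "\<Union>\<V>" R] V(3) nV by (auto simp: null_sets_def)
  qed
  then have "emeasure R N \<le> 0"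
    unfolding radon_prob_D(4)[OF R borel_of_open[OF oN]] by (intro SUP_least) auto
  then have "AE p in R. f (fst p) = g (snd p)"
    using oN by (intro AE_I[of _ _ N]) (auto simp: N_def borel_of_open)
  with R R1 R2 that show ?thesis by blast
qed

lemma lsc_on_indicator: "openin Y G \<Longrightarrow> lsc_on Y (indicator G)"
proof -
  assume G: "openin Y G"
  have "{x \<in> topspace Y. c < indicator G x} = (if c < 1 then G else {})" for c :: ennreal
    using openin_subset[OF G] by (auto simp: indicator_def not_less intro: less_imp_le split: if_splits)
  then show ?thesis using G by (simp add: lsc_on_def)
qed

text \<open>The indicator of an open preimage is lower semicontinuous, so the limit marginal is at
  most \<open>\<nu>\<close> on open sets, and \<open>radon_prob_eqI\<close> turns this into
  equality. The hypothesis \<open>lim\<close> has the form in which \<open>radon_seq_limit\<close>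
  describes its limit.\<close>

lemma radon_limit_marginal:
  fixes P :: "nat \<Rightarrow> 'b measure"
  assumes P: "\<And>n. P n \<in> radon_prob Y" and R: "R \<in> radon_prob Y"
    and lim: "\<And>\<phi> C. lsc_on Y \<phi> \<Longrightarrow> \<forall>\<^sub>F n in sequentially. (\<integral>\<^sup>+x. \<phi> x \<partial>P n) \<le> C \<Longrightarrow> (\<integral>\<^sup>+x. \<phi> x \<partial>R) \<le> C"
    and Z: "Hausdorff_space Z" and h: "continuous_map Y Z h" and \<nu>: "\<nu> \<in> radon_prob Z"
    and ev: "\<forall>\<^sub>F n in sequentially. distr (P n) (borel_of Z) h = \<nu>"
  shows "distr R (borel_of Z) h = \<nu>"
proof (rule radon_prob_eqI[OF Z radon_prob_distr[OF Z R h] \<nu>])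
  fix G assume G: "openin Z G"
  define H where "H = {y \<in> topspace Y. h y \<in> G}"
  have H: "openin Y H" unfolding H_def using h G by (rule openin_continuous_map_preimage)
  have eq: "emeasure (distr M (borel_of Z) h) G = (\<integral>\<^sup>+x. indicator H x \<partial>M)" if "M \<in> radon_prob Y" for M
  proof -
    have "h \<in> measurable M (borel_of Z)"
      using continuous_map_measurable[OF h] radon_prob_D[OF that] by (simp cong: measurable_cong_sets)
    moreover have "h -` G \<inter> space M = H" using radon_prob_D[OF that] by (auto simp: H_def)
    ultimately show ?thesis using G H radon_prob_D[OF that] by (simp add: emeasure_distr borel_of_open)
  qed
  show "emeasure (distr R (borel_of Z) h) G \<le> emeasure \<nu> G"
    unfolding eq[OF R]
  proof (rule lim[OF lsc_on_indicator[OF H]])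
    show "\<forall>\<^sub>F n in sequentially. (\<integral>\<^sup>+x. indicator H x \<partial>P n) \<le> emeasure \<nu> G"
      using ev by eventually_elim (use eq[OF P] in auto)
  qed
qed

lemma measure_Times_ge:
  assumes hY: "Hausdorff_space Y" and hZ: "Hausdorff_space Z" and R: "R \<in> radon_prob (prod_topology Y Z)"
    and K1: "compactin Y K1" "1 - a \<le> measure (distr R (borel_of Y) fst) K1"
    and K2: "compactin Z K2" "1 - b \<le> measure (distr R (borel_of Z) snd) K2"
  shows "1 - (a + b) \<le> measure R (K1 \<times> K2)"
proof -
  interpret R: prob_space R using radon_prob_D[OF R] by simp
  note spR [simp] = radon_prob_D(2,3)[OF R]
  have mfst: "fst \<in> measurable R (borel_of Y)" and msnd: "snd \<in> measurable R (borel_of Z)"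
    using continuous_map_measurable[OF continuous_map_fst[of Y Z]] continuous_map_measurable[OF continuous_map_snd[of Y Z]]
    by (simp_all cong: measurable_cong_sets)
  define A where "A = fst -` K1 \<inter> space R"
  define B where "B = snd -` K2 \<inter> space R"
  have AB: "A \<in> sets R" "B \<in> sets R"
    unfolding A_def B_def using measurable_sets[OF mfst borel_of_compact[OF hY K1(1)]] measurable_sets[OF msnd borel_of_compact[OF hZ K2(1)]] by auto
  have "measure R A = measure (distr R (borel_of Y) fst) K1" "measure R B = measure (distr R (borel_of Z) snd) K2"
    unfolding A_def B_def using borel_of_compact[OF hY K1(1)] borel_of_compact[OF hZ K2(1)]
    by (simp_all add: measure_distr[OF mfst] measure_distr[OF msnd])
  moreover have KAB: "K1 \<times> K2 = A \<inter> B"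
    using compactin_subset_topspace[OF K1(1)] compactin_subset_topspace[OF K2(1)] by (auto simp: A_def B_def)
  moreover have "measure R A + measure R B = measure R (A \<union> B) + measure R (A \<inter> B)"
    using AB by (subst R.finite_measure_Union') (auto simp: R.finite_measure_Diff' Int_commute)
  ultimately show ?thesis unfolding KAB using R.prob_le_1[of "A \<union> B"] K1(2) K2(2) by linarith
qed

text \<open>For finite values the two sides differ by \<open>(b * u - a * v)^2 / (a * b)\<close>.
  With the two distances as weights this replaces Minkowski's inequality in the triangle inequality
  for the Wasserstein distance; with equal weights it compares discrete energies of consecutive
  levels.\<close>

lemma power2_add_le_weighted:
  fixes u v :: ennreal and a b :: real
  assumes "0 < a" "0 < b"
  shows "(u + v)\<^sup>2 \<le> ennreal (1 + b / a) * u\<^sup>2 + ennreal (1 + a / b) * v\<^sup>2"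
proof (cases "u = top \<or> v = top")
  case True
  then show ?thesis using assms by (auto simp: ennreal_mult_eq_top_iff ennreal_mult_top add_pos_pos)
next
  case False
  then obtain x y where xy: "u = ennreal x" "v = ennreal y" "0 \<le> x" "0 \<le> y" by (cases u; cases v) auto
  have "0 \<le> (b * x - a * y)\<^sup>2 / (a * b)" using assms by simp
  also have "\<dots> = (1 + b / a) * x\<^sup>2 + (1 + a / b) * y\<^sup>2 - (x + y)\<^sup>2"
    using assms by (simp add: field_simps power2_eq_square)
  finally have "(x + y)\<^sup>2 \<le> (1 + b / a) * x\<^sup>2 + (1 + a / b) * y\<^sup>2" by simp
  then show ?thesis using xy assms
    by (simp add: ennreal_power ennreal_plus[symmetric] ennreal_mult[symmetric] ennreal_leI add_nonneg_nonneg del: ennreal_plus)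
qed

section \<open>The Wasserstein distance on an extended metric-topological space\<close>

locale ext_metric_top =
  fixes X :: "'a topology" and d :: "'a \<Rightarrow> 'a \<Rightarrow> ennreal"
  assumes emt: "extended_metric_topological_space X d"
begin

lemma hausX: "Hausdorff_space X"
  using emt by (simp add: extended_metric_topological_space_def)

lemma hausXX: "Hausdorff_space (prod_topology X X)"
  using hausX by (simp add: Hausdorff_space_prod_topology)

lemma d_self: "x \<in> topspace X \<Longrightarrow> d x x = 0"
  and d_sym: "x \<in> topspace X \<Longrightarrow> y \<in> topspace X \<Longrightarrow> d x y = d y x"
  and d_tri: "x \<in> topspace X \<Longrightarrow> y \<in> topspace X \<Longrightarrow> z \<in> topspace X \<Longrightarrow> d x z \<le> d x y + d y z"
  and d_zero: "x \<in> topspace X \<Longrightarrow> y \<in> topspace X \<Longrightarrow> d x y = 0 \<Longrightarrow> x = y"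
  using emt unfolding extended_metric_topological_space_def extended_metric_on_def semidistance_on_def
  by blast+

text \<open>A superlevel set of a supremum of continuous functions is a union of open sets. This
  makes the transport cost and the discrete energies lower semicontinuous and measurable on the
  Borel sets of product topologies.\<close>

lemma lsc_d: "lsc_on (prod_topology X X) (\<lambda>p. d (fst p) (snd p))"
proof -
  obtain D :: "('a \<Rightarrow> 'a \<Rightarrow> real) set" where
    D: "\<And>\<delta>. \<delta> \<in> D \<Longrightarrow> continuous_map (prod_topology X X) euclideanreal (\<lambda>(x, y). \<delta> x y)"
    and d: "\<And>x y. x \<in> topspace X \<Longrightarrow> y \<in> topspace X \<Longrightarrow> d x y = (SUP \<delta>\<in>D. ennreal (\<delta> x y))"
  proof -
    have "\<exists>D :: ('a \<Rightarrow> 'a \<Rightarrow> real) set. (\<forall>x\<in>topspace X. \<forall>y\<in>topspace X. d x y = (SUP \<delta>\<in>D. ennreal (\<delta> x y))) \<and>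
        (\<forall>\<delta>\<in>D. continuous_map (prod_topology X X) euclideanreal (\<lambda>(x, y). \<delta> x y))"
      using emt unfolding extended_metric_topological_space_def
      by (elim conjE exE) (rule exI, rule conjI, assumption, blast)
    then show thesis using that by blast
  qed
  show ?thesis unfolding lsc_on_def
  proof
    fix c
    have "{p \<in> topspace (prod_topology X X). c < d (fst p) (snd p)} =
      (\<Union>\<delta>\<in>D. {p \<in> topspace (prod_topology X X). (case p of (x, y) \<Rightarrow> \<delta> x y) \<in> {r. c < ennreal r}})"
      by (auto simp: d less_SUP_iff)
    moreover have "openin (prod_topology X X) {p \<in> topspace (prod_topology X X). (case p of (x, y) \<Rightarrow> \<delta> x y) \<in> {r. c < ennreal r}}"
      if "\<delta> \<in> D" for \<delta>
    proof (rule openin_continuous_map_preimage[OF D[OF that]])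
      show "openin euclideanreal {r. c < ennreal r}"
        using open_Collect_less[of "\<lambda>_. c" ennreal] by (simp add: continuous_on_ennreal continuous_on_id)
    qed
    ultimately show "openin (prod_topology X X) {p \<in> topspace (prod_topology X X). c < d (fst p) (snd p)}"
      by auto
  qed
qed

definition cost :: "('a \<times> 'a) measure \<Rightarrow> ennreal" where
  "cost \<pi> = (\<integral>\<^sup>+p. (d (fst p) (snd p))\<^sup>2 \<partial>\<pi>)"

lemma wasserstein_power2: "(wasserstein X d \<mu> \<nu>)\<^sup>2 = (INF \<pi>\<in>transport_plans X \<mu> \<nu>. cost \<pi>)"
  by (simp add: wasserstein_def cost_def case_prod_beta')

lemma wasserstein_le: "\<pi> \<in> transport_plans X \<mu> \<nu> \<Longrightarrow> (wasserstein X d \<mu> \<nu>)\<^sup>2 \<le> cost \<pi>"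
  unfolding wasserstein_power2 by (rule INF_lower)

lemma wasserstein_approx:
  assumes "wasserstein X d \<mu> \<nu> < top" "0 < e"
  obtains \<pi> where "\<pi> \<in> transport_plans X \<mu> \<nu>" "cost \<pi> \<le> (wasserstein X d \<mu> \<nu>)\<^sup>2 + ennreal e"
proof -
  have "(INF \<pi>\<in>transport_plans X \<mu> \<nu>. cost \<pi>) < (wasserstein X d \<mu> \<nu>)\<^sup>2 + ennreal e"
    unfolding wasserstein_power2[symmetric] using assms ennreal_add_left_cancel_less[of "(wasserstein X d \<mu> \<nu>)\<^sup>2" 0 "ennreal e"]
    by (auto simp: power_eq_top_ennreal)
  then show ?thesis using that unfolding INF_less_iff by (blast intro: less_imp_le)
qed

lemma d_pair_measurable:
  assumes "continuous_map Y X f" "continuous_map Y X g"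
  shows "lsc_on Y (\<lambda>y. d (f y) (g y))" "(\<lambda>y. d (f y) (g y)) \<in> borel_measurable (borel_of Y)"
proof -
  have "continuous_map Y (prod_topology X X) (\<lambda>y. (f y, g y))"
    using assms by (simp add: continuous_map_pairwise o_def)
  from lsc_on_compose[OF lsc_d this] show "lsc_on Y (\<lambda>y. d (f y) (g y))" by simp
  then show "(\<lambda>y. d (f y) (g y)) \<in> borel_measurable (borel_of Y)" by (rule lsc_on_measurable)
qed

text \<open>Any Radon measure with two continuous maps into \<open>X\<close> induces a plan, its
  image under the pair of maps; continuity makes this image Radon on the Borel sets of the product
  topology. Laws of paths are used in this way, through two evaluations.\<close>

lemma wasserstein_le_coupling:
  assumes R: "R \<in> radon_prob Y" and f: "continuous_map Y X f" and g: "continuous_map Y X g"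
  shows "(wasserstein X d (distr R (borel_of X) f) (distr R (borel_of X) g))\<^sup>2 \<le> (\<integral>\<^sup>+y. (d (f y) (g y))\<^sup>2 \<partial>R)"
proof -
  let ?h = "\<lambda>y. (f y, g y)" and ?XX = "prod_topology X X"
  have h: "continuous_map Y ?XX ?h" using f g by (simp add: continuous_map_pairwise o_def)
  have hm: "?h \<in> measurable R (borel_of ?XX)"
    using continuous_map_measurable[OF h] radon_prob_D[OF R] by (simp cong: measurable_cong_sets)
  note fst = continuous_map_measurable[OF continuous_map_fst[of X X]]
  note snd = continuous_map_measurable[OF continuous_map_snd[of X X]]
  have "distr R (borel_of ?XX) ?h \<in> transport_plans X (distr R (borel_of X) f) (distr R (borel_of X) g)"
    unfolding transport_plans_def using radon_prob_distr[OF hausXX R h]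
    by (simp add: distr_distr[OF fst hm] distr_distr[OF snd hm] o_def)
  then have "(wasserstein X d (distr R (borel_of X) f) (distr R (borel_of X) g))\<^sup>2 \<le> cost (distr R (borel_of ?XX) ?h)"
    by (rule wasserstein_le)
  also have "\<dots> = (\<integral>\<^sup>+y. (d (f y) (g y))\<^sup>2 \<partial>R)"
    unfolding cost_def using lsc_on_measurable[OF lsc_on_power2[OF lsc_d]] hm by (subst nn_integral_distr) auto
  finally show ?thesis .
qed

lemma transport_plansD:
  assumes "\<pi> \<in> transport_plans X \<mu> \<nu>"
  shows "\<pi> \<in> radon_prob (prod_topology X X)" "distr \<pi> (borel_of X) fst = \<mu>" "distr \<pi> (borel_of X) snd = \<nu>"
  using assms by (auto simp: transport_plans_def)

lemma wasserstein_sym: "wasserstein X d \<mu> \<nu> = wasserstein X d \<nu> \<mu>"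
proof -
  have *: "(wasserstein X d \<nu> \<mu>)\<^sup>2 \<le> (wasserstein X d \<mu> \<nu>)\<^sup>2" for \<mu> \<nu>
    unfolding wasserstein_power2[of \<mu> \<nu>]
  proof (rule INF_greatest)
    fix \<pi> assume \<pi>: "\<pi> \<in> transport_plans X \<mu> \<nu>"
    note \<pi>D = transport_plansD[OF \<pi>]
    have "(wasserstein X d \<nu> \<mu>)\<^sup>2 \<le> (\<integral>\<^sup>+p. (d (snd p) (fst p))\<^sup>2 \<partial>\<pi>)"
      using wasserstein_le_coupling[OF \<pi>D(1) continuous_map_snd continuous_map_fst] \<pi>D by simp
    also have "\<dots> = cost \<pi>" unfolding cost_def
      using radon_prob_D[OF \<pi>D(1)] by (intro nn_integral_cong arg_cong[where f = "\<lambda>x. x\<^sup>2"] d_sym) auto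
    finally show "(wasserstein X d \<nu> \<mu>)\<^sup>2 \<le> cost \<pi>" .
  qed
  show ?thesis using *[of \<mu> \<nu>] *[of \<nu> \<mu>] by (simp add: ennreal_power2_le_iff antisym)
qed

text \<open>Nearly optimal plans are glued along the common marginal \<nu>, and the weighted
  inequality \<open>power2_add_le_weighted\<close> is integrated against the glued measure.\<close>

lemma wasserstein_triangle:
  assumes \<nu>: "\<nu> \<in> radon_prob X"
  shows "wasserstein X d \<mu> \<rho> \<le> wasserstein X d \<mu> \<nu> + wasserstein X d \<nu> \<rho>"
proof (cases "wasserstein X d \<mu> \<nu> = top \<or> wasserstein X d \<nu> \<rho> = top")
  case False
  then obtain a b where ab: "wasserstein X d \<mu> \<nu> = ennreal a" "wasserstein X d \<nu> \<rho> = ennreal b" "0 \<le> a" "0 \<le> b"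
    by (cases "wasserstein X d \<mu> \<nu>"; cases "wasserstein X d \<nu> \<rho>") auto
  show ?thesis
  proof (rule ennreal_le_epsilon)
    fix e :: real assume e: "0 < e"
    \<comment> \<open>The surplus \<open>e/2\<close> makes the weights positive and leaves room for
      plans that are not optimal, since
      \<open>a\<^sup>2 + (e/2)\<^sup>2 \<le> \<alpha>\<^sup>2\<close>. With these weights the final
      bound is exactly \<open>(\<alpha> + \<beta>)\<^sup>2\<close>.\<close>
    define \<alpha> where "\<alpha> = a + e/2"
    define \<beta> where "\<beta> = b + e/2"
    have pos: "0 < \<alpha>" "0 < \<beta>" using ab e by (auto simp: \<alpha>_def \<beta>_def)
    obtain \<pi> where \<pi>: "\<pi> \<in> transport_plans X \<mu> \<nu>" "cost \<pi> \<le> ennreal (\<alpha>\<^sup>2)"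
    proof (rule wasserstein_approx[of \<mu> \<nu> "(e/2)\<^sup>2"])
      fix \<pi> assume "\<pi> \<in> transport_plans X \<mu> \<nu>" "cost \<pi> \<le> (wasserstein X d \<mu> \<nu>)\<^sup>2 + ennreal ((e/2)\<^sup>2)"
      moreover have "(wasserstein X d \<mu> \<nu>)\<^sup>2 + ennreal ((e/2)\<^sup>2) = ennreal (a\<^sup>2 + (e/2)\<^sup>2)"
        using ab by (simp add: ennreal_power ennreal_plus[symmetric] del: ennreal_plus)
      moreover have "ennreal (a\<^sup>2 + (e/2)\<^sup>2) \<le> ennreal (\<alpha>\<^sup>2)"
        using ab e by (intro ennreal_leI) (simp add: \<alpha>_def power2_sum)
      ultimately show thesis using that by (metis order_trans)
    qed (use ab e in auto)
    obtain \<sigma> where \<sigma>: "\<sigma> \<in> transport_plans X \<nu> \<rho>" "cost \<sigma> \<le> ennreal (\<beta>\<^sup>2)"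
    proof (rule wasserstein_approx[of \<nu> \<rho> "(e/2)\<^sup>2"])
      fix \<sigma> assume "\<sigma> \<in> transport_plans X \<nu> \<rho>" "cost \<sigma> \<le> (wasserstein X d \<nu> \<rho>)\<^sup>2 + ennreal ((e/2)\<^sup>2)"
      moreover have "(wasserstein X d \<nu> \<rho>)\<^sup>2 + ennreal ((e/2)\<^sup>2) = ennreal (b\<^sup>2 + (e/2)\<^sup>2)"
        using ab by (simp add: ennreal_power ennreal_plus[symmetric] del: ennreal_plus)
      moreover have "ennreal (b\<^sup>2 + (e/2)\<^sup>2) \<le> ennreal (\<beta>\<^sup>2)"
        using ab e by (intro ennreal_leI) (simp add: \<beta>_def power2_sum)
      ultimately show thesis using that by (metis order_trans)
    qed (use ab e in auto)
    note \<pi>D = transport_plansD[OF \<pi>(1)] and \<sigma>D = transport_plansD[OF \<sigma>(1)]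
    let ?XX = "prod_topology X X"
    obtain R where R: "R \<in> radon_prob (prod_topology ?XX ?XX)"
      "distr R (borel_of ?XX) fst = \<pi>" "distr R (borel_of ?XX) snd = \<sigma>" "AE p in R. snd (fst p) = fst (snd p)"
    proof (rule radon_prob_glue[OF hausX hausXX hausXX \<pi>D(1) \<sigma>D(1) continuous_map_snd continuous_map_fst])
      show "distr \<pi> (borel_of X) snd = distr \<sigma> (borel_of X) fst" using \<pi>D \<sigma>D by simp
    qed
    note spR [simp] = radon_prob_D(2,3)[OF R(1)]
    have c1: "continuous_map (prod_topology ?XX ?XX) ?XX fst" and c2: "continuous_map (prod_topology ?XX ?XX) ?XX snd"
      by (rule continuous_map_fst continuous_map_snd)+
    have c11: "continuous_map (prod_topology ?XX ?XX) X (\<lambda>p. fst (fst p))" and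
      c12: "continuous_map (prod_topology ?XX ?XX) X (\<lambda>p. snd (fst p))" and
      c21: "continuous_map (prod_topology ?XX ?XX) X (\<lambda>p. fst (snd p))" and
      c22: "continuous_map (prod_topology ?XX ?XX) X (\<lambda>p. snd (snd p))"
      using continuous_map_compose[OF c1 continuous_map_fst] continuous_map_compose[OF c1 continuous_map_snd]
        continuous_map_compose[OF c2 continuous_map_fst] continuous_map_compose[OF c2 continuous_map_snd]
      by (simp_all add: o_def)
    have m1: "fst \<in> measurable R (borel_of ?XX)" and m2: "snd \<in> measurable R (borel_of ?XX)"
      using continuous_map_measurable[OF c1] continuous_map_measurable[OF c2] by (simp_all cong: measurable_cong_sets)
    note fstm = continuous_map_measurable[OF continuous_map_fst[of X X]]
    note sndm = continuous_map_measurable[OF continuous_map_snd[of X X]]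
    have "distr R (borel_of X) (\<lambda>p. fst (fst p)) = \<mu>" "distr R (borel_of X) (\<lambda>p. snd (snd p)) = \<rho>"
      using distr_distr[OF fstm m1] distr_distr[OF sndm m2] R(2,3) \<pi>D \<sigma>D by (simp_all add: o_def)
    then have "(wasserstein X d \<mu> \<rho>)\<^sup>2 \<le> (\<integral>\<^sup>+p. (d (fst (fst p)) (snd (snd p)))\<^sup>2 \<partial>R)"
      using wasserstein_le_coupling[OF R(1) c11 c22] by simp
    also have "\<dots> \<le> (\<integral>\<^sup>+p. ennreal (1 + \<beta> / \<alpha>) * (d (fst (fst p)) (snd (fst p)))\<^sup>2 + ennreal (1 + \<alpha> / \<beta>) * (d (fst (snd p)) (snd (snd p)))\<^sup>2 \<partial>R)"
      (is "_ \<le> integral\<^sup>N R ?H")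
    proof (rule nn_integral_mono_AE)
      show "AE p in R. (d (fst (fst p)) (snd (snd p)))\<^sup>2 \<le> ?H p"
        using R(4) AE_space
      proof eventually_elim
        case (elim p)
        then have "d (fst (fst p)) (snd (snd p)) \<le> d (fst (fst p)) (snd (fst p)) + d (fst (snd p)) (snd (snd p))"
          using d_tri[of "fst (fst p)" "snd (fst p)" "snd (snd p)"] by (auto simp: mem_Times_iff)
        then have "(d (fst (fst p)) (snd (snd p)))\<^sup>2 \<le> (d (fst (fst p)) (snd (fst p)) + d (fst (snd p)) (snd (snd p)))\<^sup>2"
          by (simp add: ennreal_power2_le_iff)
        also have "\<dots> \<le> ?H p" by (rule power2_add_le_weighted[OF pos])
        finally show ?case .
      qed
    qed
    also have "\<dots> = ennreal (1 + \<beta> / \<alpha>) * (\<integral>\<^sup>+p. (d (fst (fst p)) (snd (fst p)))\<^sup>2 \<partial>R) + ennreal (1 + \<alpha> / \<beta>) * (\<integral>\<^sup>+p. (d (fst (snd p)) (snd (snd p)))\<^sup>2 \<partial>R)"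
      using d_pair_measurable(2)[OF c11 c12] d_pair_measurable(2)[OF c21 c22]
      by (subst nn_integral_add) (auto simp: nn_integral_cmult cong: measurable_cong_sets)
    also have "(\<integral>\<^sup>+p. (d (fst (fst p)) (snd (fst p)))\<^sup>2 \<partial>R) = cost \<pi>"
      unfolding cost_def R(2)[symmetric] using lsc_on_measurable[OF lsc_on_power2[OF lsc_d]] m1
      by (subst nn_integral_distr) auto
    also have "(\<integral>\<^sup>+p. (d (fst (snd p)) (snd (snd p)))\<^sup>2 \<partial>R) = cost \<sigma>"
      unfolding cost_def R(3)[symmetric] using lsc_on_measurable[OF lsc_on_power2[OF lsc_d]] m2
      by (subst nn_integral_distr) auto
    also have "ennreal (1 + \<beta> / \<alpha>) * cost \<pi> + ennreal (1 + \<alpha> / \<beta>) * cost \<sigma>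
        \<le> ennreal (1 + \<beta> / \<alpha>) * ennreal (\<alpha>\<^sup>2) + ennreal (1 + \<alpha> / \<beta>) * ennreal (\<beta>\<^sup>2)"
      using \<pi>(2) \<sigma>(2) by (intro add_mono mult_left_mono) auto
    also have "\<dots> = ennreal ((1 + \<beta> / \<alpha>) * \<alpha>\<^sup>2 + (1 + \<alpha> / \<beta>) * \<beta>\<^sup>2)"
      using pos by (simp add: ennreal_mult)
    also have "(1 + \<beta> / \<alpha>) * \<alpha>\<^sup>2 + (1 + \<alpha> / \<beta>) * \<beta>\<^sup>2 = (\<alpha> + \<beta>)\<^sup>2"
      using pos by (simp add: field_simps power2_eq_square)
    also have "ennreal ((\<alpha> + \<beta>)\<^sup>2) = (ennreal (\<alpha> + \<beta>))\<^sup>2" using pos ennreal_power[of "\<alpha> + \<beta>" 2] by (simp del: ennreal_plus)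
    finally have "wasserstein X d \<mu> \<rho> \<le> ennreal (\<alpha> + \<beta>)" by (simp only: ennreal_power2_le_iff)
    also have "ennreal (\<alpha> + \<beta>) = wasserstein X d \<mu> \<nu> + wasserstein X d \<nu> \<rho> + ennreal e"
      using ab e by (simp add: \<alpha>_def \<beta>_def ennreal_plus[symmetric] algebra_simps del: ennreal_plus)
    finally show "wasserstein X d \<mu> \<rho> \<le> wasserstein X d \<mu> \<nu> + wasserstein X d \<nu> \<rho> + ennreal e" .
  qed
qed auto

text \<open>The infimum has to be attained: plans with cost tending to 0 are tight because their
  marginals are fixed, and the cost of a limit plan vanishes by lower semicontinuity. Such a plan
  lives on the diagonal.\<close>

lemma wasserstein_zero:
  assumes \<mu>: "\<mu> \<in> radon_prob X" and \<nu>: "\<nu> \<in> radon_prob X" and W: "wasserstein X d \<mu> \<nu> = 0"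
  shows "\<mu> = \<nu>"
proof -
  let ?XX = "prod_topology X X"
  have "\<exists>\<pi>. \<pi> \<in> transport_plans X \<mu> \<nu> \<and> cost \<pi> \<le> ennreal (1 / real (Suc n))" for n
    by (rule wasserstein_approx[of \<mu> \<nu> "1 / real (Suc n)"]) (use W in auto)
  then obtain \<pi> where \<pi>: "\<And>n. \<pi> n \<in> transport_plans X \<mu> \<nu>" "\<And>n. cost (\<pi> n) \<le> ennreal (1 / real (Suc n))" by metis
  note \<pi>D = transport_plansD[OF \<pi>(1)]
  have tight: "\<exists>K. compactin ?XX K \<and> (\<forall>n. 1 - e \<le> measure (\<pi> n) K)" if e: "0 < e" for e
  proof -
    obtain K1 where K1: "compactin X K1" "1 - e/2 \<le> measure \<mu> K1" using radon_prob_tight[OF \<mu>, of "e/2"] e by auto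
    obtain K2 where K2: "compactin X K2" "1 - e/2 \<le> measure \<nu> K2" using radon_prob_tight[OF \<nu>, of "e/2"] e by auto
    have "1 - (e/2 + e/2) \<le> measure (\<pi> n) (K1 \<times> K2)" for n
      using K1 K2 by (intro measure_Times_ge[OF hausX hausX \<pi>D(1)]) (simp_all add: \<pi>D)
    then show ?thesis using K1 K2 by (intro exI[of _ "K1 \<times> K2"]) (simp add: compactin_Times)
  qed
  obtain R where R: "R \<in> radon_prob ?XX"
    and lim: "\<And>\<phi> C. lsc_on ?XX \<phi> \<Longrightarrow> \<forall>\<^sub>F n in sequentially. (\<integral>\<^sup>+x. \<phi> x \<partial>\<pi> n) \<le> C \<Longrightarrow> (\<integral>\<^sup>+x. \<phi> x \<partial>R) \<le> C"
    using radon_seq_limit[OF hausXX, of \<pi>] \<pi>D(1) tight by blast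
  have R1: "distr R (borel_of X) fst = \<mu>"
    by (rule radon_limit_marginal[OF \<pi>D(1) R lim hausX continuous_map_fst \<mu>]) (simp_all add: \<pi>D)
  have R2: "distr R (borel_of X) snd = \<nu>"
    by (rule radon_limit_marginal[OF \<pi>D(1) R lim hausX continuous_map_snd \<nu>]) (simp_all add: \<pi>D)
  have lsc2: "lsc_on ?XX (\<lambda>p. (d (fst p) (snd p))\<^sup>2)" by (rule lsc_on_power2[OF lsc_d])
  have "cost R \<le> 0"
  proof (rule ennreal_le_epsilon)
    fix e :: real assume e: "0 < e"
    have "\<forall>\<^sub>F n in sequentially. 1 / real (Suc n) < e"
      using e by (intro order_tendstoD(2)[OF lim_inverse_n'[THEN LIMSEQ_Suc]])
    then have "\<forall>\<^sub>F n in sequentially. (\<integral>\<^sup>+p. (d (fst p) (snd p))\<^sup>2 \<partial>\<pi> n) \<le> ennreal e"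
    proof eventually_elim
      case (elim n)
      then have "ennreal (1 / real (Suc n)) \<le> ennreal e" by (intro ennreal_leI) simp
      then show ?case using \<pi>(2)[of n] unfolding cost_def by (rule order_trans[rotated])
    qed
    then show "cost R \<le> 0 + ennreal e" unfolding cost_def using lim[OF lsc2] by simp
  qed
  then have "AE p in R. (d (fst p) (snd p))\<^sup>2 = 0"
    using lsc_on_measurable[OF lsc2] radon_prob_D[OF R] unfolding cost_def
    by (subst (asm) le_zero_eq, subst (asm) nn_integral_0_iff_AE) (auto cong: measurable_cong_sets)
  then have "AE p in R. fst p = snd p"
    using AE_space by eventually_elim (use radon_prob_D[OF R] d_zero in \<open>auto simp: mem_Times_iff\<close>)
  moreover have "fst \<in> measurable R (borel_of X)" "snd \<in> measurable R (borel_of X)"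
    using continuous_map_measurable[OF continuous_map_fst[of X X]] continuous_map_measurable[OF continuous_map_snd[of X X]]
      radon_prob_D[OF R] by (simp_all cong: measurable_cong_sets)
  ultimately have "distr R (borel_of X) fst = distr R (borel_of X) snd" by (intro distr_cong_AE) auto
  then show ?thesis using R1 R2 by simp
qed

end

section \<open>Speed of curves\<close>

definition dyad :: "real \<Rightarrow> nat \<Rightarrow> nat \<Rightarrow> real" where
  "dyad T n i = T * real i / 2 ^ n"

text \<open>Cells are closed on the left; the end point \<open>T\<close> gets index
  \<open>2 ^ n\<close>, one past the last cell.\<close>

definition dyad_index :: "real \<Rightarrow> nat \<Rightarrow> real \<Rightarrow> nat" where
  "dyad_index T n t = nat \<lfloor>t * 2 ^ n / T\<rfloor>"

text \<open>With \<open>h\<close> the cell length this is the sum of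
  \<open>h * (\<rho> / h)\<^sup>2\<close>, the Riemann sum of the squared difference quotients; one
  factor \<open>h\<close> has cancelled.\<close>

definition step_energy :: "real \<Rightarrow> (real \<Rightarrow> real \<Rightarrow> ennreal) \<Rightarrow> nat \<Rightarrow> ennreal" where
  "step_energy T \<rho> n = (\<Sum>i<2 ^ n. (\<rho> (dyad T n i) (dyad T n (Suc i)))\<^sup>2 / ennreal (T / 2 ^ n))"

lemma dyad_index_eq_iff:
  assumes "0 < T" "0 \<le> t"
  shows "dyad_index T n t = i \<longleftrightarrow> dyad T n i \<le> t \<and> t < dyad T n (Suc i)"
proof -
  have "0 \<le> t * 2 ^ n / T" using assms by simp
  then have "dyad_index T n t = i \<longleftrightarrow> real i \<le> t * 2 ^ n / T \<and> t * 2 ^ n / T < real i + 1"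
    unfolding dyad_index_def by (simp add: nat_eq_iff floor_eq_iff)
  also have "\<dots> \<longleftrightarrow> dyad T n i \<le> t \<and> t < dyad T n (Suc i)"
    using assms(1) by (auto simp: dyad_def field_simps)
  finally show ?thesis .
qed

lemma dyad_index_bounds:
  assumes "0 < T" "0 \<le> t"
  shows "dyad T n (dyad_index T n t) \<le> t" "t < dyad T n (Suc (dyad_index T n t))"
  using dyad_index_eq_iff[OF assms, of n "dyad_index T n t"] by simp_all

lemma dyad_Suc: "dyad T n (Suc i) = dyad T n i + T / 2 ^ n"
  by (simp add: dyad_def field_simps)

lemma dyad_mono: "0 < T \<Longrightarrow> i \<le> j \<Longrightarrow> dyad T n i \<le> dyad T n j"
  by (simp add: dyad_def divide_right_mono)

lemma dyad_less_iff: "0 < T \<Longrightarrow> dyad T n i < dyad T n j \<longleftrightarrow> i < j"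
  by (simp add: dyad_def divide_less_cancel)

lemma dyad_le_iff: "0 < T \<Longrightarrow> dyad T n i \<le> dyad T n j \<longleftrightarrow> i \<le> j"
  by (simp add: dyad_def divide_le_cancel)

lemma dyad_0 [simp]: "dyad T n 0 = 0" and dyad_top [simp]: "dyad T n (2 ^ n) = T"
  by (simp_all add: dyad_def)

lemma dyad_in: "0 < T \<Longrightarrow> i \<le> 2 ^ n \<Longrightarrow> dyad T n i \<in> {0..T}"
  using dyad_mono[of T 0 i n] dyad_mono[of T i "2 ^ n" n] by simp

lemma dyad_refine: "dyad T (n + k) (i * 2 ^ k) = dyad T n i"
  by (simp add: dyad_def power_add)

lemma dyad_index_le: "0 < T \<Longrightarrow> 0 \<le> t \<Longrightarrow> t \<le> T \<Longrightarrow> dyad_index T n t \<le> 2 ^ n"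
  using dyad_index_bounds(1)[of T t n] dyad_le_iff[of T n "dyad_index T n t" "2 ^ n"] by simp

lemma dyad_index_less: "0 < T \<Longrightarrow> 0 \<le> t \<Longrightarrow> t < T \<Longrightarrow> dyad_index T n t < 2 ^ n"
  using dyad_index_bounds(1)[of T t n] dyad_less_iff[of T n "dyad_index T n t" "2 ^ n"] by simp

lemma dyad_index_dyad: "0 < T \<Longrightarrow> dyad_index T n (dyad T n i) = i"
  by (subst dyad_index_eq_iff) (simp, simp add: dyad_def, simp add: dyad_less_iff)

lemma dyad_index_div:
  assumes "0 < T" "0 \<le> t"
  shows "dyad_index T (n + k) t div 2 ^ k = dyad_index T n t"
proof -
  have "t * 2 ^ n / T = (t * 2 ^ (n + k) / T) / real_of_int (2 ^ k)" by (simp add: power_add)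
  then have "\<lfloor>t * 2 ^ n / T\<rfloor> = \<lfloor>t * 2 ^ (n + k) / T\<rfloor> div 2 ^ k"
    using floor_divide_real_eq_div[of "2 ^ k" "t * 2 ^ (n + k) / T"] by simp
  moreover have "0 \<le> \<lfloor>t * 2 ^ (n + k) / T\<rfloor>" using assms by simp
  ultimately show ?thesis unfolding dyad_index_def by (simp add: nat_div_distrib nat_power_eq)
qed

lemma measurable_dyad_index [measurable]: "dyad_index T n \<in> measurable borel (count_space UNIV)"
proof -
  have "(\<lambda>t. nat \<lfloor>t * 2 ^ n / T\<rfloor>) \<in> measurable borel (count_space UNIV)"
    by measurable
  then show ?thesis by (simp add: dyad_index_def[abs_def])
qed

lemma dyad_index_tendsto:
  assumes "0 < T" "0 \<le> t" shows "(\<lambda>n. dyad T n (dyad_index T n t)) \<longlonglongrightarrow> t"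
proof (rule tendsto_sandwich)
  show "\<forall>\<^sub>F n in sequentially. t - T / 2 ^ n \<le> dyad T n (dyad_index T n t)"
    using dyad_index_bounds(2)[OF assms] by (auto simp: dyad_Suc intro!: always_eventually less_imp_le) (smt (verit))
  show "\<forall>\<^sub>F n in sequentially. dyad T n (dyad_index T n t) \<le> t"
    using dyad_index_bounds(1)[OF assms] by simp
  have "(\<lambda>n. t - T * (1 / 2) ^ n) \<longlonglongrightarrow> t - T * 0"
    by (intro tendsto_intros LIMSEQ_power_zero) simp
  then show "(\<lambda>n. t - T / 2 ^ n) \<longlonglongrightarrow> t" by (simp add: power_divide)
qed simp

lemma step_width_tendsto: "(\<lambda>n. T / 2 ^ n :: real) \<longlonglongrightarrow> 0"
proof -
  have "(\<lambda>n. T * (1 / 2) ^ n :: real) \<longlonglongrightarrow> T * 0" by (intro tendsto_intros LIMSEQ_power_zero) simp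
  then show ?thesis by (simp add: power_divide)
qed

lemma nn_integral_step:
  assumes "0 < T"
  shows "(\<integral>\<^sup>+t\<in>{0..<T}. a (dyad_index T n t) \<partial>lborel) = (\<Sum>i<2 ^ n. a i * ennreal (T / 2 ^ n))"
proof -
  have "a (dyad_index T n t) * indicator {0..<T} t = (\<Sum>i<2 ^ n. a i * indicator {dyad T n i..<dyad T n (Suc i)} t)" for t
  proof (cases "t \<in> {0..<T}")
    case True
    then have "indicator {dyad T n i..<dyad T n (Suc i)} t = (if i = dyad_index T n t then 1 else 0 :: ennreal)" for i
      using dyad_index_eq_iff[OF assms, of t n i] by (auto simp: indicator_def)
    then have "(\<Sum>i<2 ^ n. a i * indicator {dyad T n i..<dyad T n (Suc i)} t) = (\<Sum>i<2 ^ n. if i = dyad_index T n t then a i else 0)"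
      by (intro sum.cong) auto
    also have "\<dots> = a (dyad_index T n t)" using dyad_index_less[OF assms, of t n] True by (simp add: sum.delta)
    finally show ?thesis using True by simp
  next
    case False
    have "t \<notin> {dyad T n i..<dyad T n (Suc i)}" if "i < 2 ^ n" for i
      using False dyad_mono[OF assms, of 0 i n] dyad_mono[OF assms, of "Suc i" "2 ^ n" n] that by auto
    then show ?thesis using False by (simp add: sum.neutral)
  qed
  then have "(\<integral>\<^sup>+t\<in>{0..<T}. a (dyad_index T n t) \<partial>lborel) =
      (\<integral>\<^sup>+t. (\<Sum>i<2 ^ n. a i * indicator {dyad T n i..<dyad T n (Suc i)} t) \<partial>lborel)" by simp
  also have "\<dots> = (\<Sum>i<2 ^ n. a i * ennreal (T / 2 ^ n))"
    using assms by (subst nn_integral_sum)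
      (auto simp: nn_integral_cmult_indicator dyad_Suc intro!: sum.cong)
  finally show ?thesis .
qed

lemma semidistance_chain:
  assumes "semidistance_on S \<rho>" "\<And>l. l \<le> N \<Longrightarrow> x l \<in> S"
  shows "\<rho> (x 0) (x N) \<le> (\<Sum>l<N. \<rho> (x l) (x (Suc l)))"
  using assms(2)
proof (induction N)
  case 0
  then show ?case using assms(1) by (simp add: semidistance_on_def)
next
  case (Suc N)
  have "\<rho> (x 0) (x (Suc N)) \<le> \<rho> (x 0) (x N) + \<rho> (x N) (x (Suc N))"
    using assms(1) Suc.prems unfolding semidistance_on_def by simp
  also have "\<dots> \<le> (\<Sum>l<N. \<rho> (x l) (x (Suc l))) + \<rho> (x N) (x (Suc N))"
    using Suc by (intro add_right_mono) auto
  finally show ?case by simp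
qed

text \<open>The difference quotients along dyadic partitions form a submartingale bounded in \<open>L\<^sup>2\<close>; hence they converge in \<open>L\<^sup>2\<close>, and their limit is the speed.\<close>

lemma dyadic_speed:
  assumes T: "0 < T" and \<rho>: "semidistance_on {0..T} \<rho>"
    and E: "\<And>n. step_energy T \<rho> n \<le> C" and C: "C < top"
  obtains g :: "real \<Rightarrow> real" where "g \<in> borel_measurable borel" "\<And>t. 0 \<le> g t"
    "(\<integral>\<^sup>+t\<in>{0..<T}. ennreal ((g t)\<^sup>2) \<partial>lborel) \<le> C"
    "\<And>n i j. i \<le> j \<Longrightarrow> j \<le> 2 ^ n \<Longrightarrow>
       \<rho> (dyad T n i) (dyad T n j) \<le> (\<integral>\<^sup>+t\<in>{dyad T n i..<dyad T n j}. ennreal (g t) \<partial>lborel)"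
    "AE t in lborel. t \<in> {0..<T} \<longrightarrow> ennreal (g t) \<le>
       limsup (\<lambda>n. \<rho> (dyad T n (dyad_index T n t)) (dyad T n (Suc (dyad_index T n t))) / ennreal (T / 2 ^ n))"
proof -
  define h where "h n = T / 2 ^ n" for n :: nat
  have h: "0 < h n" for n using T by (simp add: h_def)
  \<comment> \<open>The difference quotients as real numbers. No information is lost, since bounded
    energy makes the distances of neighbouring grid times finite.\<close>
  define c where "c n i = enn2real (\<rho> (dyad T n i) (dyad T n (Suc i))) / h n" for n i
  have c0: "0 \<le> c n i" for n i using h[of n] by (simp add: c_def)
  have \<rho>c: "\<rho> (dyad T n i) (dyad T n (Suc i)) = ennreal (h n * c n i)" if i: "i < 2 ^ n" for n i
  proof -
    have "(\<rho> (dyad T n i) (dyad T n (Suc i)))\<^sup>2 / ennreal (h n) \<le> step_energy T \<rho> n"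
      unfolding step_energy_def h_def[symmetric] using i by (intro sum_nonneg_leq_bound[OF _ _ refl]) auto
    also have "\<dots> < top" using E C by (rule le_less_trans)
    finally have "\<rho> (dyad T n i) (dyad T n (Suc i)) < top"
      by (cases "\<rho> (dyad T n i) (dyad T n (Suc i))") (auto simp: ennreal_top_divide)
    then show ?thesis using h[of n] by (simp add: c_def)
  qed
  define e where "e n = h n * (\<Sum>i<2 ^ n. (c n i)\<^sup>2)" for n
  have e0: "0 \<le> e n" for n unfolding e_def by (intro mult_nonneg_nonneg less_imp_le[OF h] sum_nonneg) simp
  have e_eq: "ennreal (e n) = step_energy T \<rho> n" for n
  proof -
    have "(\<rho> (dyad T n i) (dyad T n (Suc i)))\<^sup>2 / ennreal (h n) = ennreal (h n * (c n i)\<^sup>2)" if "i < 2 ^ n" for i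
    proof -
      have "(h n * c n i)\<^sup>2 / h n = h n * (c n i)\<^sup>2" using h[of n] by (simp add: power2_eq_square)
      then show ?thesis using h[of n] c0[of n i] \<rho>c[OF that]
        by (simp add: ennreal_power divide_ennreal)
    qed
    then show ?thesis using h[of n]
      by (simp add: step_energy_def h_def[symmetric] e_def sum_distrib_left less_imp_le)
  qed
  obtain C' where C': "C = ennreal C'" "0 \<le> C'" using C by (cases C) auto
  have eC: "e n \<le> C'" for n using E[of n] e_eq[of n] C' by (simp add: e_def[symmetric]) (metis ennreal_le_iff)
  \<comment> \<open>The submartingale property: by the triangle inequality a coarse quotient is at
    most the mean of the finer quotients inside its cell.\<close>
  have refine: "(2 ^ k) * c n i \<le> (\<Sum>l<2 ^ k. c (n + k) (i * 2 ^ k + l))" if i: "i < 2 ^ n" for n k i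
  proof -
    have lt: "i * 2 ^ k + l < 2 ^ (n + k)" if "l < 2 ^ k" for l
    proof -
      have "i * 2 ^ k + l < Suc i * 2 ^ k" using that by simp
      also have "\<dots> \<le> 2 ^ n * 2 ^ k" using i by (intro mult_le_mono1) simp
      finally show ?thesis by (simp add: power_add)
    qed
    have le: "i * 2 ^ k + l \<le> 2 ^ (n + k)" if "l \<le> 2 ^ k" for l
    proof -
      have "i * 2 ^ k + l \<le> Suc i * 2 ^ k" using that by simp
      also have "\<dots> \<le> 2 ^ n * 2 ^ k" using i by (intro mult_le_mono1) simp
      finally show ?thesis by (simp add: power_add)
    qed
    have "\<rho> (dyad T (n + k) (i * 2 ^ k + 0)) (dyad T (n + k) (i * 2 ^ k + 2 ^ k)) \<le>
        (\<Sum>l<2 ^ k. \<rho> (dyad T (n + k) (i * 2 ^ k + l)) (dyad T (n + k) (i * 2 ^ k + Suc l)))"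
      by (rule semidistance_chain[OF \<rho>]) (intro dyad_in T le)
    moreover have "i * 2 ^ k + 2 ^ k = Suc i * 2 ^ k" by simp
    ultimately have "\<rho> (dyad T n i) (dyad T n (Suc i)) \<le>
        (\<Sum>l<2 ^ k. \<rho> (dyad T (n + k) (i * 2 ^ k + l)) (dyad T (n + k) (Suc (i * 2 ^ k + l))))"
      by (simp only: dyad_refine add_0_right add_Suc_right)
    also have "\<dots> = (\<Sum>l<2 ^ k. ennreal (h (n + k) * c (n + k) (i * 2 ^ k + l)))"
      using lt \<rho>c by (intro sum.cong) auto
    also have "\<dots> = ennreal (\<Sum>l<2 ^ k. h (n + k) * c (n + k) (i * 2 ^ k + l))"
      using h[of "n + k"] c0 by (intro sum_ennreal) (simp add: less_imp_le)
    finally have "h n * c n i \<le> (\<Sum>l<2 ^ k. h (n + k) * c (n + k) (i * 2 ^ k + l))"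
      unfolding \<rho>c[OF i] using h[of "n + k"] c0
      by (subst (asm) ennreal_le_iff) (auto intro!: sum_nonneg mult_nonneg_nonneg less_imp_le[OF h])
    moreover have "h n = h (n + k) * 2 ^ k" by (simp add: h_def power_add)
    ultimately have "h (n + k) * (2 ^ k * c n i) \<le> h (n + k) * (\<Sum>l<2 ^ k. c (n + k) (i * 2 ^ k + l))"
      by (simp add: sum_distrib_left mult.assoc)
    then show ?thesis using h[of "n + k"] by simp
  qed
  \<comment> \<open>The squared distance of two levels is bounded by the energy gained between them:
    expand the square on each coarse cell and estimate the mixed term by \<open>refine\<close>,
    using \<open>c n i \<ge> 0\<close>. Energies increase and are bounded, so the levels form a
    Cauchy sequence.\<close>
  have L2: "h (n + k) * (\<Sum>j<2 ^ (n + k). (c (n + k) j - c n (j div 2 ^ k))\<^sup>2) \<le> e (n + k) - e n" for n k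
  proof -
    let ?K = "2 ^ k :: nat" and ?m = "n + k"
    have group: "(\<Sum>j<2 ^ ?m. f j) = (\<Sum>i<2 ^ n. \<Sum>l<?K. f (i * ?K + l))" for f :: "nat \<Rightarrow> real"
    proof -
      have "(\<Sum>j<2 ^ ?m. f j) = (\<Sum>i<2 ^ n. sum f {i * ?K..<i * ?K + ?K})"
        by (simp add: sum.nat_group power_add)
      also have "\<dots> = (\<Sum>i<2 ^ n. \<Sum>l<?K. f (i * ?K + l))"
        by (rule sum.cong[OF refl], subst sum.atLeastLessThan_shift_0) (simp add: atLeast0LessThan)
      finally show ?thesis .
    qed
    have "(\<Sum>j<2 ^ ?m. (c ?m j - c n (j div ?K))\<^sup>2) = (\<Sum>i<2 ^ n. \<Sum>l<?K. (c ?m (i * ?K + l) - c n i)\<^sup>2)"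
      unfolding group by (intro sum.cong refl) simp
    also have "\<dots> \<le> (\<Sum>i<2 ^ n. (\<Sum>l<?K. (c ?m (i * ?K + l))\<^sup>2) - real ?K * (c n i)\<^sup>2)"
    proof (rule sum_mono)
      fix i :: nat assume "i \<in> {..<2 ^ n}"
      then have r: "2 ^ k * c n i \<le> (\<Sum>l<?K. c ?m (i * ?K + l))" using refine[of i n k] by simp
      have "(\<Sum>l<?K. (c ?m (i * ?K + l) - c n i)\<^sup>2) =
          (\<Sum>l<?K. (c ?m (i * ?K + l))\<^sup>2 - 2 * c n i * c ?m (i * ?K + l) + (c n i)\<^sup>2)"
        by (intro sum.cong refl) (simp add: power2_diff)
      also have "\<dots> = (\<Sum>l<?K. (c ?m (i * ?K + l))\<^sup>2) - 2 * c n i * (\<Sum>l<?K. c ?m (i * ?K + l)) + real ?K * (c n i)\<^sup>2"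
        by (simp add: sum.distrib sum_subtractf sum_distrib_left)
      also have "\<dots> \<le> (\<Sum>l<?K. (c ?m (i * ?K + l))\<^sup>2) - 2 * c n i * (2 ^ k * c n i) + real ?K * (c n i)\<^sup>2"
        using mult_left_mono[OF r, of "2 * c n i"] c0[of n i] by simp
      also have "\<dots> = (\<Sum>l<?K. (c ?m (i * ?K + l))\<^sup>2) - real ?K * (c n i)\<^sup>2"
        by (simp add: power2_eq_square algebra_simps)
      finally show "(\<Sum>l<?K. (c ?m (i * ?K + l) - c n i)\<^sup>2) \<le> (\<Sum>l<?K. (c ?m (i * ?K + l))\<^sup>2) - real ?K * (c n i)\<^sup>2" .
    qed
    also have "\<dots> = (\<Sum>j<2 ^ ?m. (c ?m j)\<^sup>2) - real ?K * (\<Sum>i<2 ^ n. (c n i)\<^sup>2)"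
      unfolding group by (simp add: sum_subtractf sum_distrib_left)
    finally have "h ?m * (\<Sum>j<2 ^ ?m. (c ?m j - c n (j div ?K))\<^sup>2) \<le> h ?m * ((\<Sum>j<2 ^ ?m. (c ?m j)\<^sup>2) - real ?K * (\<Sum>i<2 ^ n. (c n i)\<^sup>2))"
      using h[of ?m] by (intro mult_left_mono) auto
    also have "\<dots> = e ?m - e n" by (simp add: e_def h_def power_add algebra_simps)
    finally show ?thesis .
  qed
  have e_mono: "e n \<le> e (n + k)" for n k
  proof -
    have "0 \<le> h (n + k) * (\<Sum>j<2 ^ (n + k). (c (n + k) j - c n (j div 2 ^ k))\<^sup>2)"
      by (intro mult_nonneg_nonneg less_imp_le[OF h] sum_nonneg) simp
    with L2[where n = n and k = k] show ?thesis by linarith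
  qed
  define gg where "gg n t = c n (dyad_index T n t)" for n t
  have gm [measurable]: "gg n \<in> borel_measurable borel" for n
    unfolding gg_def by measurable
  have gg0: "0 \<le> gg n t" for n t by (simp add: gg_def c0)
  \<comment> \<open>Cauchy-Schwarz passes from the quadratic estimate to the L1 norm, because the
    almost everywhere convergent subsequence below is extracted from an L1-Cauchy sequence.\<close>
  have L1: "(\<integral>\<^sup>+t\<in>{0..<T}. ennreal \<bar>gg (n + k) t - gg n t\<bar> \<partial>lborel) \<le> ennreal (sqrt (T * (e (n + k) - e n)))" for n k
  proof -
    let ?m = "n + k"
    define x where "x j = \<bar>c ?m j - c n (j div 2 ^ k)\<bar>" for j
    have "(\<integral>\<^sup>+t\<in>{0..<T}. ennreal \<bar>gg ?m t - gg n t\<bar> \<partial>lborel) = (\<integral>\<^sup>+t\<in>{0..<T}. ennreal (x (dyad_index T ?m t)) \<partial>lborel)"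
      using T by (intro nn_integral_cong) (auto simp: gg_def x_def dyad_index_div indicator_def)
    also have "\<dots> = (\<Sum>j<2 ^ ?m. ennreal (x j) * ennreal (h ?m))"
      unfolding h_def by (rule nn_integral_step[OF T])
    also have "\<dots> = ennreal (h ?m * (\<Sum>j<2 ^ ?m. x j))"
      using h[of ?m] by (simp add: x_def ennreal_mult[symmetric] sum_distrib_left mult.commute less_imp_le)
    also have "\<dots> \<le> ennreal (sqrt (T * (e ?m - e n)))"
    proof (intro ennreal_leI real_le_rsqrt)
      have "(h ?m * (\<Sum>j<2 ^ ?m. x j))\<^sup>2 = (h ?m)\<^sup>2 * (\<Sum>j<2 ^ ?m. x j)\<^sup>2" by (rule power_mult_distrib)
      also have "\<dots> \<le> (h ?m)\<^sup>2 * ((\<Sum>j<2 ^ ?m. (x j)\<^sup>2) * 2 ^ ?m)"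
        using sum_squared_le_sum_of_squares[of x "{..<2 ^ ?m}"] by (intro mult_left_mono) auto
      also have "\<dots> = T * (h ?m * (\<Sum>j<2 ^ ?m. (x j)\<^sup>2))"
        by (simp add: h_def power2_eq_square)
      also have "\<dots> \<le> T * (e ?m - e n)"
        using L2[where n = n and k = k] T by (intro mult_left_mono) (auto simp: x_def)
      finally show "(h ?m * (\<Sum>j<2 ^ ?m. x j))\<^sup>2 \<le> T * (e ?m - e n)" .
    qed
    finally show ?thesis .
  qed
  have "incseq e" unfolding incseq_def using e_mono by (metis le_iff_add)
  then obtain L where "e \<longlonglongrightarrow> L" using incseq_convergent[of e C'] eC by blast
  then have Ce: "Cauchy e" by (rule LIMSEQ_imp_Cauchy)
  have L1e: "\<exists>N. \<forall>i\<ge>N. \<forall>j\<ge>N. (\<integral>\<^sup>+t\<in>{0..<T}. ennreal \<bar>gg i t - gg j t\<bar> \<partial>lborel) < ennreal \<epsilon>" if \<epsilon>: "0 < \<epsilon>" for \<epsilon> :: real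
  proof -
    obtain N where N: "\<And>i j. i \<ge> N \<Longrightarrow> j \<ge> N \<Longrightarrow> dist (e i) (e j) < \<epsilon>\<^sup>2 / T"
      using Ce \<epsilon> T unfolding Cauchy_def by (metis divide_pos_pos zero_less_power)
    have *: "(\<integral>\<^sup>+t\<in>{0..<T}. ennreal \<bar>gg (n + k) t - gg n t\<bar> \<partial>lborel) < ennreal \<epsilon>" if "n \<ge> N" for n k
    proof -
      have "e (n + k) - e n < \<epsilon>\<^sup>2 / T" using N[of "n + k" n] that by (auto simp: dist_real_def)
      then have "T * (e (n + k) - e n) < \<epsilon>\<^sup>2" using T by (simp add: field_simps)
      then have "sqrt (T * (e (n + k) - e n)) < \<epsilon>" using \<epsilon> by (intro real_less_lsqrt) auto
      then have "ennreal (sqrt (T * (e (n + k) - e n))) < ennreal \<epsilon>" using \<epsilon> by (intro ennreal_lessI)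
      with L1[where n = n and k = k] show ?thesis by (rule le_less_trans)
    qed
    show ?thesis
    proof (intro exI[of _ N] allI impI)
      fix i j assume "N \<le> i" "N \<le> j"
      then show "(\<integral>\<^sup>+t\<in>{0..<T}. ennreal \<bar>gg i t - gg j t\<bar> \<partial>lborel) < ennreal \<epsilon>"
        using *[of j "i - j"] *[of i "j - i"] by (cases "j \<le> i") (auto simp: abs_minus_commute)
    qed
  qed
  define M0 where "M0 = restrict_space lborel {0..<T}"
  have gM0: "gg n \<in> borel_measurable M0" for n
    unfolding M0_def by (intro measurable_restrict_space1) simp
  have int0: "(\<integral>\<^sup>+t. f t \<partial>M0) = (\<integral>\<^sup>+t\<in>{0..<T}. f t \<partial>lborel)" for f :: "real \<Rightarrow> ennreal"
    unfolding M0_def by (rule nn_integral_restrict_space) simp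
  have integ: "integrable M0 (gg n)" for n
  proof (rule integrableI_bounded[OF gM0])
    have "(\<integral>\<^sup>+t. ennreal (norm (gg n t)) \<partial>M0) = (\<Sum>i<2 ^ n. ennreal (c n i) * ennreal (T / 2 ^ n))"
      unfolding int0 using nn_integral_step[OF T, of "\<lambda>i. ennreal (c n i)" n] by (simp add: gg_def c0)
    also have "\<dots> < \<infinity>" by (simp add: ennreal_mult_less_top)
    finally show "(\<integral>\<^sup>+t. ennreal (norm (gg n t)) \<partial>M0) < \<infinity>" .
  qed
  obtain r where r: "strict_mono r" "AE t in M0. Cauchy (\<lambda>i. gg (r i) t)"
  proof (rule cauchy_L1_AE_cauchy_subseq[OF integ])
    fix \<epsilon> :: real assume \<epsilon>: "0 < \<epsilon>"
    obtain N where N: "\<And>i j. i \<ge> N \<Longrightarrow> j \<ge> N \<Longrightarrow> (\<integral>\<^sup>+t\<in>{0..<T}. ennreal \<bar>gg i t - gg j t\<bar> \<partial>lborel) < ennreal \<epsilon>"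
      using L1e[OF \<epsilon>] by blast
    have "(LINT t|M0. norm (gg i t - gg j t)) < \<epsilon>" if "i \<ge> N" "j \<ge> N" for i j
    proof -
      have "ennreal (LINT t|M0. norm (gg i t - gg j t)) = (\<integral>\<^sup>+t. ennreal (norm (gg i t - gg j t)) \<partial>M0)"
        using integ by (intro nn_integral_eq_integral[symmetric]) auto
      also have "\<dots> < ennreal \<epsilon>" unfolding int0 using N[OF that] by simp
      finally show ?thesis using \<epsilon> by (simp add: ennreal_less_iff)
    qed
    then show "\<exists>N. \<forall>i\<ge>N. \<forall>j\<ge>N. (LINT t|M0. norm (gg i t - gg j t)) < \<epsilon>" by blast
  qed
  \<comment> \<open>The maximum makes \<open>g\<close> nonnegative also at points without a limit; a
    limit of the quotients is nonnegative and is not changed.\<close>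
  define g where "g t = max 0 (lim (\<lambda>i. gg (r i) t))" for t
  have g_meas [measurable]: "g \<in> borel_measurable borel"
    unfolding g_def by (intro borel_measurable_max borel_measurable_const borel_measurable_lim_metric) simp
  have AEc: "AE t in lborel. t \<in> {0..<T} \<longrightarrow> (\<lambda>i. gg (r i) t) \<longlonglongrightarrow> g t"
  proof -
    have "AE t in lborel. t \<in> {0..<T} \<longrightarrow> Cauchy (\<lambda>i. gg (r i) t)"
      using r(2) unfolding M0_def by (subst (asm) AE_restrict_space_iff) auto
    then show ?thesis
    proof eventually_elim
      case (elim t)
      show ?case
      proof
        assume "t \<in> {0..<T}"
        then have cv: "(\<lambda>i. gg (r i) t) \<longlonglongrightarrow> lim (\<lambda>i. gg (r i) t)"
          using elim by (simp add: Cauchy_convergent_iff convergent_LIMSEQ_iff)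
        then have "0 \<le> lim (\<lambda>i. gg (r i) t)" by (rule LIMSEQ_le_const) (use gg0 in auto)
        with cv show "(\<lambda>i. gg (r i) t) \<longlonglongrightarrow> g t" by (simp add: g_def max_def)
      qed
    qed
  qed
  have P1: "(\<integral>\<^sup>+t\<in>{0..<T}. ennreal ((g t)\<^sup>2) \<partial>lborel) \<le> C"
  proof -
    have "(\<integral>\<^sup>+t\<in>{0..<T}. ennreal ((g t)\<^sup>2) \<partial>lborel) \<le> (\<integral>\<^sup>+t. liminf (\<lambda>i. ennreal ((gg (r i) t)\<^sup>2) * indicator {0..<T} t) \<partial>lborel)"
    proof (rule nn_integral_mono_AE)
      show "AE t in lborel. ennreal ((g t)\<^sup>2) * indicator {0..<T} t \<le> liminf (\<lambda>i. ennreal ((gg (r i) t)\<^sup>2) * indicator {0..<T} t)"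
        using AEc
      proof eventually_elim
        case (elim t)
        show ?case
        proof (cases "t \<in> {0..<T}")
          case True
          then have "(\<lambda>i. ennreal ((gg (r i) t)\<^sup>2)) \<longlonglongrightarrow> ennreal ((g t)\<^sup>2)" using elim by (intro tendsto_intros) auto
          from lim_imp_Liminf[OF sequentially_bot this] show ?thesis using True by simp
        qed simp
      qed
    qed
    also have "\<dots> \<le> liminf (\<lambda>i. \<integral>\<^sup>+t\<in>{0..<T}. ennreal ((gg (r i) t)\<^sup>2) \<partial>lborel)"
      by (intro nn_integral_liminf) measurable
    also have "\<dots> \<le> C"
    proof (intro Liminf_le always_eventually allI)
      fix i
      have "(\<integral>\<^sup>+t\<in>{0..<T}. ennreal ((gg (r i) t)\<^sup>2) \<partial>lborel) = (\<Sum>j<2 ^ r i. ennreal ((c (r i) j)\<^sup>2) * ennreal (h (r i)))"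
        unfolding gg_def h_def by (rule nn_integral_step[OF T])
      also have "\<dots> = ennreal (e (r i))"
        using h[of "r i"] by (simp add: e_def sum_distrib_left ennreal_mult[symmetric] mult.commute less_imp_le)
      also have "\<dots> \<le> C" using eC C' by (simp add: ennreal_leI)
      finally show "(\<integral>\<^sup>+t\<in>{0..<T}. ennreal ((gg (r i) t)\<^sup>2) \<partial>lborel) \<le> C" .
    qed simp
    finally show ?thesis .
  qed
  have P2: "\<rho> (dyad T n i) (dyad T n j) \<le> (\<integral>\<^sup>+t\<in>{dyad T n i..<dyad T n j}. ennreal (g t) \<partial>lborel)"
    if ij: "i \<le> j" "j \<le> 2 ^ n" for n i j
  proof (rule ennreal_le_epsilon)
    fix \<epsilon> :: real assume \<epsilon>: "0 < \<epsilon>"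
    let ?I = "{dyad T n i..<dyad T n j}"
    have I: "?I \<subseteq> {0..<T}" using dyad_in[OF T, of i n] dyad_in[OF T, of j n] ij by auto
    obtain N where N: "\<And>i j. i \<ge> N \<Longrightarrow> j \<ge> N \<Longrightarrow> (\<integral>\<^sup>+t\<in>{0..<T}. ennreal \<bar>gg i t - gg j t\<bar> \<partial>lborel) < ennreal \<epsilon>"
      using L1e[OF \<epsilon>] by blast
    \<comment> \<open>This level is fine enough for the estimate provided by \<open>N\<close>, and
      it refines level \<open>n\<close>, so both times remain grid times. Closeness of
      \<open>gg m\<close> to \<open>g\<close> itself follows by Fatou's lemma along the subsequence
      \<open>r\<close>.\<close>
    define m where "m = n + N"
    have "(\<integral>\<^sup>+t\<in>{0..<T}. ennreal \<bar>gg m t - g t\<bar> \<partial>lborel) \<le> (\<integral>\<^sup>+t. liminf (\<lambda>i. ennreal \<bar>gg m t - gg (r i) t\<bar> * indicator {0..<T} t) \<partial>lborel)"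
    proof (rule nn_integral_mono_AE)
      show "AE t in lborel. ennreal \<bar>gg m t - g t\<bar> * indicator {0..<T} t \<le> liminf (\<lambda>i. ennreal \<bar>gg m t - gg (r i) t\<bar> * indicator {0..<T} t)"
        using AEc
      proof eventually_elim
        case (elim t)
        show ?case
        proof (cases "t \<in> {0..<T}")
          case True
          then have "(\<lambda>i. ennreal \<bar>gg m t - gg (r i) t\<bar>) \<longlonglongrightarrow> ennreal \<bar>gg m t - g t\<bar>" using elim by (intro tendsto_intros) auto
          from lim_imp_Liminf[OF sequentially_bot this] show ?thesis using True by simp
        qed simp
      qed
    qed
    also have "\<dots> \<le> liminf (\<lambda>i. \<integral>\<^sup>+t\<in>{0..<T}. ennreal \<bar>gg m t - gg (r i) t\<bar> \<partial>lborel)"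
      by (intro nn_integral_liminf) measurable
    also have "\<dots> \<le> ennreal \<epsilon>"
    proof (rule Liminf_le)
      show "\<forall>\<^sub>F i in sequentially. (\<integral>\<^sup>+t\<in>{0..<T}. ennreal \<bar>gg m t - gg (r i) t\<bar> \<partial>lborel) \<le> ennreal \<epsilon>"
        using eventually_ge_at_top[of N]
      proof eventually_elim
        case (elim i)
        then have "N \<le> r i" using seq_suble[OF r(1), of i] by simp
        then show ?case using N[of m "r i"] by (simp add: m_def less_imp_le)
      qed
    qed simp
    finally have close: "(\<integral>\<^sup>+t\<in>{0..<T}. ennreal \<bar>gg m t - g t\<bar> \<partial>lborel) \<le> ennreal \<epsilon>" .
    let ?i = "i * 2 ^ N" and ?j = "j * 2 ^ N"
    have dij: "dyad T m ?i = dyad T n i" "dyad T m ?j = dyad T n j" unfolding m_def by (rule dyad_refine)+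
    have jm: "?j \<le> 2 ^ m" using ij(2) unfolding m_def power_add by (rule mult_le_mono1)
    have "\<rho> (dyad T m (?i + 0)) (dyad T m (?i + (?j - ?i))) \<le> (\<Sum>l<?j - ?i. \<rho> (dyad T m (?i + l)) (dyad T m (?i + Suc l)))"
      using jm mult_le_mono1[OF ij(1), of "2 ^ N"] by (intro semidistance_chain[OF \<rho>] dyad_in T) linarith
    then have "\<rho> (dyad T n i) (dyad T n j) \<le> (\<Sum>l<?j - ?i. \<rho> (dyad T m (?i + l)) (dyad T m (Suc (?i + l))))"
      using ij by (simp add: dij)
    also have "\<dots> = (\<Sum>l<?j - ?i. ennreal (c m (?i + l)) * ennreal (T / 2 ^ m))"
      using jm h[of m] c0 by (intro sum.cong refl) (auto simp: \<rho>c ennreal_mult[symmetric] h_def[symmetric] mult.commute)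
    also have "\<dots> = (\<Sum>l\<in>{?i..<?j}. ennreal (c m l) * ennreal (T / 2 ^ m))"
      using sum.shift_bounds_nat_ivl[of "\<lambda>l. ennreal (c m l) * ennreal (T / 2 ^ m)" 0 ?i "?j - ?i"] ij
      by (simp add: atLeast0LessThan add.commute)
    also have "\<dots> = (\<Sum>l<2 ^ m. (ennreal (c m l) * indicator {?i..<?j} l) * ennreal (T / 2 ^ m))"
      using jm by (intro sum.mono_neutral_cong_left) (auto simp: indicator_def)
    also have "\<dots> = (\<integral>\<^sup>+t\<in>{0..<T}. ennreal (gg m t) * indicator {?i..<?j} (dyad_index T m t) \<partial>lborel)"
      unfolding gg_def by (rule nn_integral_step[OF T, symmetric])
    also have "\<dots> \<le> (\<integral>\<^sup>+t. ennreal (g t) * indicator ?I t + ennreal \<bar>gg m t - g t\<bar> * indicator {0..<T} t \<partial>lborel)"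
    proof (rule nn_integral_mono)
      fix t
      show "ennreal (gg m t) * indicator {?i..<?j} (dyad_index T m t) * indicator {0..<T} t
          \<le> ennreal (g t) * indicator ?I t + ennreal \<bar>gg m t - g t\<bar> * indicator {0..<T} t"
      proof (cases "t \<in> {0..<T} \<and> dyad_index T m t \<in> {?i..<?j}")
        case True
        then have t: "0 \<le> t" "t < T" by auto
        have "dyad T m ?i \<le> t" using dyad_index_bounds(1)[OF T t(1), of m] dyad_mono[OF T, of ?i "dyad_index T m t" m] True by auto
        moreover have "t < dyad T m ?j" using dyad_index_bounds(2)[OF T t(1), of m] dyad_mono[OF T, of "Suc (dyad_index T m t)" ?j m] True by auto
        ultimately have "t \<in> ?I" by (simp add: dij)
        moreover have "ennreal (gg m t) \<le> ennreal (g t + \<bar>gg m t - g t\<bar>)" by (intro ennreal_leI) simp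
        moreover have "0 \<le> g t" by (simp add: g_def)
        ultimately show ?thesis using True by simp
      qed (auto simp: indicator_def)
    qed
    also have "\<dots> = (\<integral>\<^sup>+t\<in>?I. ennreal (g t) \<partial>lborel) + (\<integral>\<^sup>+t\<in>{0..<T}. ennreal \<bar>gg m t - g t\<bar> \<partial>lborel)"
      by (intro nn_integral_add) measurable
    also have "\<dots> \<le> (\<integral>\<^sup>+t\<in>?I. ennreal (g t) \<partial>lborel) + ennreal \<epsilon>" using close by (rule add_left_mono)
    finally show "\<rho> (dyad T n i) (dyad T n j) \<le> (\<integral>\<^sup>+t\<in>?I. ennreal (g t) \<partial>lborel) + ennreal \<epsilon>" .
  qed
  have P3: "AE t in lborel. t \<in> {0..<T} \<longrightarrow> ennreal (g t) \<le>
       limsup (\<lambda>n. \<rho> (dyad T n (dyad_index T n t)) (dyad T n (Suc (dyad_index T n t))) / ennreal (T / 2 ^ n))"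
    using AEc
  proof eventually_elim
    case (elim t)
    show ?case
    proof
      assume t: "t \<in> {0..<T}"
      have q: "\<rho> (dyad T n (dyad_index T n t)) (dyad T n (Suc (dyad_index T n t))) / ennreal (T / 2 ^ n) = ennreal (gg n t)" for n
        using \<rho>c[OF dyad_index_less[OF T, of t n]] t h[of n] c0
        by (simp add: h_def[symmetric] divide_ennreal gg_def)
      have "(\<lambda>i. ennreal (gg (r i) t)) \<longlonglongrightarrow> ennreal (g t)" using elim t by (intro tendsto_intros) auto
      then have "ennreal (g t) = limsup ((\<lambda>n. ennreal (gg n t)) \<circ> r)"
        by (simp add: lim_imp_Limsup o_def)
      also have "\<dots> \<le> limsup (\<lambda>n. ennreal (gg n t))" by (rule limsup_subseq_mono[OF r(1)])
      finally show "ennreal (g t) \<le>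
       limsup (\<lambda>n. \<rho> (dyad T n (dyad_index T n t)) (dyad T n (Suc (dyad_index T n t))) / ennreal (T / 2 ^ n))"
        unfolding q .
    qed
  qed
  show thesis by (rule that[OF g_meas _ P1 P2 P3]) (auto simp: g_def)
qed

section \<open>The metric derivative of a curve\<close>

lemma nn_integral_Ioo_Ico:
  "(\<integral>\<^sup>+r\<in>{s<..<t::real}. f r \<partial>lborel) = (\<integral>\<^sup>+r\<in>{s..<t}. f r \<partial>lborel)"
  by (intro nn_integral_cong_AE, use AE_lborel_singleton[of s] in eventually_elim) (auto simp: indicator_def)

lemma nn_set_integral_mono:
  assumes "A \<subseteq> B" shows "(\<integral>\<^sup>+r\<in>A. f r \<partial>M) \<le> (\<integral>\<^sup>+r\<in>B. f r \<partial>M)"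
  using assms by (intro nn_integral_mono) (auto simp: indicator_def)

lemma set_Cauchy_Schwarz_lborel:
  assumes [measurable]: "f \<in> borel_measurable borel" and st: "s \<le> t"
  shows "(\<integral>\<^sup>+r\<in>{s..<t::real}. f r \<partial>lborel)\<^sup>2 \<le> ennreal (t - s) * (\<integral>\<^sup>+r\<in>{s..<t}. (f r)\<^sup>2 \<partial>lborel)"
proof -
  have "(\<integral>\<^sup>+r\<in>{s..<t}. f r \<partial>lborel)\<^sup>2 = (\<integral>\<^sup>+r. (f r * indicator {s..<t} r) * indicator {s..<t} r \<partial>lborel)\<^sup>2"
    by (intro arg_cong[where f = "\<lambda>x. x\<^sup>2"] nn_integral_cong) (auto simp: indicator_def)
  also have "\<dots> \<le> (\<integral>\<^sup>+r. (f r * indicator {s..<t} r)\<^sup>2 \<partial>lborel) * (\<integral>\<^sup>+r. (indicator {s..<t} r)\<^sup>2 \<partial>lborel)"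
    by (rule Cauchy_Schwarz_nn_integral) measurable
  also have "(\<integral>\<^sup>+r. (f r * indicator {s..<t} r)\<^sup>2 \<partial>lborel) = (\<integral>\<^sup>+r\<in>{s..<t}. (f r)\<^sup>2 \<partial>lborel)"
    by (intro nn_integral_cong) (auto simp: indicator_def)
  also have "(\<integral>\<^sup>+r. (indicator {s..<t} r)\<^sup>2 \<partial>lborel) = (\<integral>\<^sup>+r. indicator {s..<t} r \<partial>lborel)"
    by (intro nn_integral_cong) (auto simp: indicator_def)
  also have "\<dots> = ennreal (t - s)" using st by simp
  finally show ?thesis by (simp add: mult.commute)
qed

text \<open>With the distance pulled back to the time axis, one theory of speeds serves both the
  paths in \<open>X\<close> and the curve of measures.\<close>

definition mder :: "real \<Rightarrow> (real \<Rightarrow> real \<Rightarrow> ennreal) \<Rightarrow> real \<Rightarrow> ennreal" where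
  "mder T \<rho> t = Limsup (at t within {0..T}) (\<lambda>s. \<rho> s t / ennreal \<bar>s - t\<bar>)"

lemma AE_lborel_of_negligible:
  assumes "negligible N" shows "AE t in lborel. t \<notin> (N :: real set)"
proof -
  have "AE t in lebesgue. t \<notin> N" using assms by (intro AE_not_in) (simp add: negligible_iff_null_sets)
  then show ?thesis by (simp add: AE_completion_iff)
qed

text \<open>Lebesgue's differentiation theorem gives the averages to the right of \<open>t\<close>;
  reflecting \<open>f\<close> at the origin gives those to the left. Both sides are needed because
  the metric derivative is a two-sided upper limit.\<close>

lemma AE_average_less:
  fixes f :: "real \<Rightarrow> real"
  assumes f: "integrable lborel f"
  shows "AE t in lborel. \<forall>e>0. \<exists>\<delta>>0. \<forall>h. 0 < h \<and> h < \<delta> \<longrightarrow>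
     (LINT r:{t..t + h}|lborel. f r) \<le> h * (f t + e) \<and> (LINT r:{t - h..t}|lborel. f r) \<le> h * (f t + e)"
proof -
  have si: "set_integrable lborel {a..b} f" for a b
    unfolding set_integrable_def using f by (intro integrable_mult_indicator) auto
  note io = set_borel_integral_eq_integral[OF si]
  define f' where "f' r = f (- r)" for r
  have f': "integrable lborel f'"
    using lborel_integrable_real_affine[OF f, of "-1" 0] by (simp add: f'_def[abs_def])
  have si': "set_integrable lborel {a..b} f'" for a b
    unfolding set_integrable_def using f' by (intro integrable_mult_indicator) auto
  note io' = set_borel_integral_eq_integral[OF si']
  obtain N1 where N1: "negligible N1" "\<And>x e. x \<notin> N1 \<Longrightarrow> 0 < e \<Longrightarrow>
      \<exists>d>0. \<forall>h. 0 < h \<and> h < d \<longrightarrow> norm (integral (cbox x (x + h *\<^sub>R One)) f /\<^sub>R h ^ DIM(real) - f x) < e"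
    by (rule integrable_ccontinuous_explicit[of f]) (use io in auto)
  obtain N2 where N2: "negligible N2" "\<And>x e. x \<notin> N2 \<Longrightarrow> 0 < e \<Longrightarrow>
      \<exists>d>0. \<forall>h. 0 < h \<and> h < d \<longrightarrow> norm (integral (cbox x (x + h *\<^sub>R One)) f' /\<^sub>R h ^ DIM(real) - f' x) < e"
    by (rule integrable_ccontinuous_explicit[of f']) (use io' in auto)
  have "AE t in lborel. t \<notin> N1" by (rule AE_lborel_of_negligible[OF N1(1)])
  moreover have "AE t in lborel. t \<notin> uminus ` N2"
    by (intro AE_lborel_of_negligible negligible_differentiable_image_negligible[OF _ N2(1)])
       (auto intro!: differentiable_on_minus differentiable_on_id)
  ultimately show ?thesis
  proof eventually_elim
    case (elim t)
    have t2: "- t \<notin> N2" using elim by force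
    show ?case
    proof (intro allI impI)
      fix e :: real assume e: "0 < e"
      obtain d1 where d1: "d1 > 0" "\<And>h. 0 < h \<Longrightarrow> h < d1 \<Longrightarrow> norm (integral (cbox t (t + h *\<^sub>R One)) f /\<^sub>R h ^ DIM(real) - f t) < e"
        using N1(2)[OF elim(1) e] by blast
      obtain d2 where d2: "d2 > 0" "\<And>h. 0 < h \<Longrightarrow> h < d2 \<Longrightarrow> norm (integral (cbox (- t) (- t + h *\<^sub>R One)) f' /\<^sub>R h ^ DIM(real) - f' (- t)) < e"
        using N2(2)[OF t2 e] by blast
      have "(LINT r:{t..t + h}|lborel. f r) \<le> h * (f t + e) \<and> (LINT r:{t - h..t}|lborel. f r) \<le> h * (f t + e)"
        if h: "0 < h" "h < min d1 d2" for h
      proof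
        have "integral {t..t + h} f / h - f t < e" using d1(2)[of h] h by (simp add: divide_inverse mult.commute abs_less_iff)
        then show "(LINT r:{t..t + h}|lborel. f r) \<le> h * (f t + e)" unfolding io(2) using h by (simp add: field_simps)
        have "integral {- t..- t + h} f' = integral {t - h..t} f"
          using Henstock_Kurzweil_Integration.integral_reflect_real[where a = "t - h" and b = t and f = f]
          by (simp add: f'_def[abs_def])
        moreover have "integral {- t..- t + h} f' / h - f t < e"
          using d2(2)[of h] h by (simp add: divide_inverse mult.commute abs_less_iff f'_def)
        ultimately show "(LINT r:{t - h..t}|lborel. f r) \<le> h * (f t + e)" unfolding io(2) using h by (simp add: field_simps)
      qed
      then show "\<exists>\<delta>>0. \<forall>h. 0 < h \<and> h < \<delta> \<longrightarrow>
     (LINT r:{t..t + h}|lborel. f r) \<le> h * (f t + e) \<and> (LINT r:{t - h..t}|lborel. f r) \<le> h * (f t + e)"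
        using d1(1) d2(1) by (intro exI[of _ "min d1 d2"]) auto
    qed
  qed
qed

text \<open>Dividing the bound by the squared time difference leaves the average of \<open>m\<close>
  between \<open>s\<close> and \<open>t\<close>, which tends to \<open>m t\<close> at almost every
  \<open>t\<close>. The hypothesis is quadratic so that it can be obtained by averaging over a
  family of curves.\<close>

lemma mder_le:
  assumes T: "0 < T" and m [measurable]: "m \<in> borel_measurable borel"
    and fin: "(\<integral>\<^sup>+r\<in>{0..<T}. m r \<partial>lborel) < top"
    and sym: "\<And>s t. s \<in> {0..T} \<Longrightarrow> t \<in> {0..T} \<Longrightarrow> \<rho> s t = \<rho> t s"
    and bound: "\<And>s t. 0 \<le> s \<Longrightarrow> s \<le> t \<Longrightarrow> t \<le> T \<Longrightarrow> (\<rho> s t)\<^sup>2 \<le> ennreal (t - s) * (\<integral>\<^sup>+r\<in>{s..<t}. m r \<partial>lborel)"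
  shows "AE t in lborel. t \<in> {0<..<T} \<longrightarrow> (mder T \<rho> t)\<^sup>2 \<le> m t"
proof -
  \<comment> \<open>Cut off outside the interval and made real-valued, \<open>m\<close> becomes
    integrable on the whole line; as its integral is finite, this changes it inside the interval
    only on a null set.\<close>
  define f where "f r = enn2real (m r * indicator {0..<T} r)" for r
  have fm [measurable]: "f \<in> borel_measurable borel" unfolding f_def by measurable
  have AEf: "AE r in lborel. ennreal (f r) = m r * indicator {0..<T} r"
  proof -
    have "AE r in lborel. m r * indicator {0..<T} r \<noteq> \<infinity>"
      using fin by (intro nn_integral_noteq_infinite) auto
    then show ?thesis by eventually_elim (simp add: f_def less_top[symmetric])
  qed
  have f0: "0 \<le> f r" for r by (simp add: f_def)
  have f: "integrable lborel f"
  proof (rule integrableI_nonneg)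
    have "(\<integral>\<^sup>+r. ennreal (f r) \<partial>lborel) = (\<integral>\<^sup>+r\<in>{0..<T}. m r \<partial>lborel)"
      using AEf by (rule nn_integral_cong_AE)
    then show "(\<integral>\<^sup>+r. ennreal (f r) \<partial>lborel) < \<infinity>" using fin by simp
  qed (auto simp: f0)
  have int_eq: "(\<integral>\<^sup>+r\<in>{s..<t}. m r \<partial>lborel) = ennreal (LINT r:{s..t}|lborel. f r)" if "0 \<le> s" "t \<le> T" for s t
  proof -
    have "(\<integral>\<^sup>+r\<in>{s..<t}. m r \<partial>lborel) = (\<integral>\<^sup>+r. ennreal (indicator {s..t} r * f r) \<partial>lborel)"
      by (intro nn_integral_cong_AE, use AEf AE_lborel_singleton[of t] in eventually_elim)
         (use that in \<open>auto simp: indicator_def\<close>)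
    also have "\<dots> = ennreal (LINT r|lborel. indicator {s..t} r * f r)"
      using f0 integrable_mult_indicator[OF _ f, of "{s..t}"] by (intro nn_integral_eq_integral) auto
    finally show ?thesis by (simp add: set_lebesgue_integral_def)
  qed
  show ?thesis
    using AEf AE_average_less[OF f]
  proof eventually_elim
    case (elim t)
    show ?case
    proof
      assume t: "t \<in> {0<..<T}"
      then have mt: "m t = ennreal (f t)" using elim(1) by simp
      show "(mder T \<rho> t)\<^sup>2 \<le> m t"
      proof (rule ennreal_le_epsilon)
        fix e :: real assume e: "0 < e"
        obtain \<delta> where \<delta>: "\<delta> > 0" "\<And>h. 0 < h \<Longrightarrow> h < \<delta> \<Longrightarrow>
           (LINT r:{t..t + h}|lborel. f r) \<le> h * (f t + e) \<and> (LINT r:{t - h..t}|lborel. f r) \<le> h * (f t + e)"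
          using elim(2) e by blast
        have q: "\<rho> s t / ennreal \<bar>s - t\<bar> \<le> ennreal (sqrt (f t + e))"
          if s: "s \<in> {0..T}" "s \<noteq> t" "\<bar>s - t\<bar> < \<delta>" for s
        proof -
          define h where "h = \<bar>s - t\<bar>"
          have h: "0 < h" "h < \<delta>" using s by (auto simp: h_def)
          have fe: "0 \<le> f t + e" using f0[of t] e by simp
          have "(\<rho> s t)\<^sup>2 \<le> ennreal h * ennreal (h * (f t + e))"
          proof (cases "s < t")
            case True
            then have "(\<rho> s t)\<^sup>2 \<le> ennreal h * ennreal (LINT r:{t - h..t}|lborel. f r)"
              using bound[of s t] int_eq[of s t] s t by (simp add: h_def)
            also have "\<dots> \<le> ennreal h * ennreal (h * (f t + e))"
              using \<delta>(2)[OF h] by (intro mult_left_mono ennreal_leI) auto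
            finally show ?thesis .
          next
            case False
            then have "(\<rho> t s)\<^sup>2 \<le> ennreal h * ennreal (LINT r:{t..t + h}|lborel. f r)"
              using bound[of t s] int_eq[of t s] s t by (simp add: h_def)
            also have "\<dots> \<le> ennreal h * ennreal (h * (f t + e))"
              using \<delta>(2)[OF h] by (intro mult_left_mono ennreal_leI) auto
            finally show ?thesis using sym[of s t] s t by simp
          qed
          also have "\<dots> = (ennreal (h * sqrt (f t + e)))\<^sup>2"
            using h fe by (simp add: ennreal_mult[symmetric] ennreal_power power_mult_distrib power2_eq_square)
          finally have "\<rho> s t \<le> ennreal (h * sqrt (f t + e))" by (simp only: ennreal_power2_le_iff)
          then have "\<rho> s t / ennreal h \<le> ennreal (h * sqrt (f t + e)) / ennreal h" by (rule divide_right_mono_ennreal)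
          also have "\<dots> = ennreal (sqrt (f t + e))" using h fe by (simp add: divide_ennreal)
          finally show ?thesis by (simp add: h_def)
        qed
        have "mder T \<rho> t \<le> ennreal (sqrt (f t + e))"
          unfolding mder_def
        proof (rule Limsup_bounded)
          show "\<forall>\<^sub>F s in at t within {0..T}. \<rho> s t / ennreal \<bar>s - t\<bar> \<le> ennreal (sqrt (f t + e))"
            unfolding eventually_at using \<delta>(1) q by (intro exI[of _ \<delta>]) (auto simp: dist_real_def)
        qed
        then have "(mder T \<rho> t)\<^sup>2 \<le> (ennreal (sqrt (f t + e)))\<^sup>2" by (simp only: ennreal_power2_le_iff)
        also have "\<dots> = m t + ennreal e" using f0[of t] e by (simp add: mt ennreal_power)
        finally show "(mder T \<rho> t)\<^sup>2 \<le> m t + ennreal e" .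
      qed
    qed
  qed
qed

lemma semidistance_onD:
  assumes "semidistance_on S \<rho>"
  shows "s \<in> S \<Longrightarrow> \<rho> s s = 0" "s \<in> S \<Longrightarrow> t \<in> S \<Longrightarrow> \<rho> s t = \<rho> t s"
    "r \<in> S \<Longrightarrow> s \<in> S \<Longrightarrow> t \<in> S \<Longrightarrow> \<rho> r t \<le> \<rho> r s + \<rho> s t"
  using assms unfolding semidistance_on_def by blast+

text \<open>The cell around \<open>t\<close> is split at \<open>t\<close> by the triangle
  inequality. Since \<open>t\<close> lies between the end points, the two one-sided bounds add up to
  a multiple of the cell length with the same constant.\<close>

lemma difference_quotient_limsup_le:
  assumes T: "0 < T" and \<rho>: "semidistance_on {0..T} \<rho>" and t: "t \<in> {0<..<T}"
  shows "limsup (\<lambda>n. \<rho> (dyad T n (dyad_index T n t)) (dyad T n (Suc (dyad_index T n t))) / ennreal (T / 2 ^ n))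
    \<le> mder T \<rho> t"
proof (rule dense_ge)
  fix c assume c: "mder T \<rho> t < c"
  show "limsup (\<lambda>n. \<rho> (dyad T n (dyad_index T n t)) (dyad T n (Suc (dyad_index T n t))) / ennreal (T / 2 ^ n)) \<le> c"
  proof (cases "c = top")
    case False
    then obtain c' where c': "c = ennreal c'" "0 \<le> c'" by (cases c) auto
    have "\<forall>\<^sub>F s in at t within {0..T}. \<rho> s t / ennreal \<bar>s - t\<bar> < c"
      using c unfolding mder_def by (rule Limsup_lessD)
    then obtain \<delta> where \<delta>: "\<delta> > 0" "\<And>s. s \<in> {0..T} \<Longrightarrow> s \<noteq> t \<Longrightarrow> \<bar>s - t\<bar> < \<delta> \<Longrightarrow> \<rho> s t / ennreal \<bar>s - t\<bar> < c"
      unfolding eventually_at by (auto simp: dist_real_def)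
    have q: "\<rho> s t \<le> ennreal (c' * \<bar>s - t\<bar>)" if s: "s \<in> {0..T}" "\<bar>s - t\<bar> < \<delta>" for s
    proof (cases "s = t")
      case True
      then show ?thesis using semidistance_onD(1)[OF \<rho>] t by simp
    next
      case False
      then have "\<rho> s t / ennreal \<bar>s - t\<bar> \<le> c" using \<delta>(2) s by (simp add: less_imp_le)
      then have "\<rho> s t / ennreal \<bar>s - t\<bar> * ennreal \<bar>s - t\<bar> \<le> c * ennreal \<bar>s - t\<bar>" by (rule mult_right_mono) simp
      moreover have "\<rho> s t / ennreal \<bar>s - t\<bar> * ennreal \<bar>s - t\<bar> = \<rho> s t"
        using False by (simp add: ennreal_divide_times ennreal_mult_divide_eq) 
      ultimately show ?thesis using c' by (simp add: ennreal_mult)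
    qed
    have "\<forall>\<^sub>F n in sequentially. T / 2 ^ n < \<delta>" using step_width_tendsto \<delta>(1) by (rule order_tendstoD(2))
    then show ?thesis
    proof (intro Limsup_bounded, eventually_elim)
      case (elim n)
      let ?i = "dyad_index T n t"
      let ?a = "dyad T n ?i" and ?b = "dyad T n (Suc ?i)"
      have ab: "?a \<le> t" "t < ?b" "?b = ?a + T / 2 ^ n" using dyad_index_bounds[OF T, of t n] t by (auto simp: dyad_Suc)
      have "?i < 2 ^ n" using dyad_index_less[OF T, of t n] t by auto
      then have S: "?a \<in> {0..T}" "?b \<in> {0..T}" "t \<in> {0..T}" using dyad_in[OF T, of ?i n] dyad_in[OF T, of "Suc ?i" n] t by auto
      have "\<rho> ?a ?b \<le> \<rho> ?a t + \<rho> t ?b" using semidistance_onD(3)[OF \<rho>] S by blast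
      also have "\<rho> t ?b = \<rho> ?b t" using semidistance_onD(2)[OF \<rho>] S by blast
      also have "\<rho> ?a t + \<rho> ?b t \<le> ennreal (c' * \<bar>?a - t\<bar>) + ennreal (c' * \<bar>?b - t\<bar>)"
        using S ab elim by (intro add_mono q) auto
      also have "\<dots> = ennreal (c' * \<bar>?a - t\<bar> + c' * \<bar>?b - t\<bar>)" using c' by simp
      also have "c' * \<bar>?a - t\<bar> + c' * \<bar>?b - t\<bar> = c' * (T / 2 ^ n)"
        using ab by (simp add: ring_distribs(1)[symmetric])
      finally have "\<rho> ?a ?b / ennreal (T / 2 ^ n) \<le> ennreal (c' * (T / 2 ^ n)) / ennreal (T / 2 ^ n)"
        by (rule divide_right_mono_ennreal)
      also have "\<dots> = c" using c' T by (simp add: divide_ennreal)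
      finally show ?case .
    qed
  qed simp
qed

lemma hoelder_tendsto_zero:
  fixes x :: "nat \<Rightarrow> real"
  assumes H: "\<And>s t. s \<in> {0..T} \<Longrightarrow> t \<in> {0..T} \<Longrightarrow> (\<rho> s t)\<^sup>2 \<le> ennreal (K * \<bar>t - s\<bar>)" and K: "0 \<le> K"
    and x: "\<And>n. x n \<in> {0..T}" "x \<longlonglongrightarrow> t" "t \<in> {0..T}"
  shows "(\<lambda>n. \<rho> (x n) t) \<longlonglongrightarrow> 0"
proof (rule tendsto_sandwich[of "\<lambda>_. 0"])
  have "\<rho> (x n) t \<le> ennreal (sqrt (K * \<bar>t - x n\<bar>))" for n
  proof -
    have "(\<rho> (x n) t)\<^sup>2 \<le> (ennreal (sqrt (K * \<bar>t - x n\<bar>)))\<^sup>2"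
      using H[OF x(1)[of n] x(3)] K by (simp add: ennreal_power)
    then show ?thesis by (simp only: ennreal_power2_le_iff)
  qed
  then show "\<forall>\<^sub>F n in sequentially. \<rho> (x n) t \<le> ennreal (sqrt (K * \<bar>t - x n\<bar>))" by simp
  have "(\<lambda>n. ennreal (sqrt (K * \<bar>t - x n\<bar>))) \<longlonglongrightarrow> ennreal (sqrt (K * \<bar>t - t\<bar>))"
    by (intro tendsto_intros x)
  then show "(\<lambda>n. ennreal (sqrt (K * \<bar>t - x n\<bar>))) \<longlonglongrightarrow> 0" by simp
qed auto

text \<open>Hoelder continuity carries the integral bound from dyadic to arbitrary times. Lebesgue
  differentiation then gives one inequality between the metric derivative and \<open>g\<close>, and
  the dyadic quotients, which approach \<open>g\<close>, give the other.\<close>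

lemma speed_exists:
  assumes T: "0 < T" and \<rho>: "semidistance_on {0..T} \<rho>"
    and H: "\<And>s t. s \<in> {0..T} \<Longrightarrow> t \<in> {0..T} \<Longrightarrow> (\<rho> s t)\<^sup>2 \<le> ennreal (K * \<bar>t - s\<bar>)" and K: "0 \<le> K"
    and E: "\<And>n. step_energy T \<rho> n \<le> C" and C: "C < top"
  obtains g :: "real \<Rightarrow> real" where "g \<in> borel_measurable borel" "\<And>t. 0 \<le> g t"
    "(\<integral>\<^sup>+t\<in>{0..<T}. ennreal ((g t)\<^sup>2) \<partial>lborel) \<le> C"
    "\<And>s t. 0 \<le> s \<Longrightarrow> s \<le> t \<Longrightarrow> t \<le> T \<Longrightarrow> \<rho> s t \<le> (\<integral>\<^sup>+r\<in>{s..<t}. ennreal (g r) \<partial>lborel)"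
    "\<And>s t. 0 \<le> s \<Longrightarrow> s \<le> t \<Longrightarrow> t \<le> T \<Longrightarrow> (\<rho> s t)\<^sup>2 \<le> ennreal (t - s) * (\<integral>\<^sup>+r\<in>{s..<t}. ennreal ((g r)\<^sup>2) \<partial>lborel)"
    "AE t in lborel. t \<in> {0<..<T} \<longrightarrow> mder T \<rho> t = ennreal (g t)"
proof -
  obtain g :: "real \<Rightarrow> real" where g [measurable]: "g \<in> borel_measurable borel" and g0: "\<And>t. 0 \<le> g t"
    and gC: "(\<integral>\<^sup>+t\<in>{0..<T}. ennreal ((g t)\<^sup>2) \<partial>lborel) \<le> C"
    and gd: "\<And>n i j. i \<le> j \<Longrightarrow> j \<le> 2 ^ n \<Longrightarrow>
       \<rho> (dyad T n i) (dyad T n j) \<le> (\<integral>\<^sup>+t\<in>{dyad T n i..<dyad T n j}. ennreal (g t) \<partial>lborel)"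
    and gl: "AE t in lborel. t \<in> {0..<T} \<longrightarrow> ennreal (g t) \<le>
       limsup (\<lambda>n. \<rho> (dyad T n (dyad_index T n t)) (dyad T n (Suc (dyad_index T n t))) / ennreal (T / 2 ^ n))"
    by (rule dyadic_speed[OF T \<rho> E C], rule that)
  have g1: "\<rho> s t \<le> (\<integral>\<^sup>+r\<in>{s..<t}. ennreal (g r) \<partial>lborel)" if st: "0 \<le> s" "s \<le> t" "t \<le> T" for s t
  proof (cases "s = t")
    case True
    then show ?thesis using semidistance_onD(1)[OF \<rho>] st by simp
  next
    case False
    then have "s < t" "s < T" using st by auto
    let ?I = "\<integral>\<^sup>+r\<in>{s..<t}. ennreal (g r) \<partial>lborel"
    \<comment> \<open>The first grid time after \<open>s\<close> and the last one up to
      \<open>t\<close>: the interval between them lies inside \<open>{s..<t}\<close>, and both tend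
      to the respective time.\<close>
    define a where "a n = dyad T n (Suc (dyad_index T n s))" for n
    define b where "b n = dyad T n (dyad_index T n t)" for n
    have a_in: "a n \<in> {0..T}" for n unfolding a_def
      using dyad_index_less[OF T st(1) \<open>s < T\<close>, of n] by (intro dyad_in T) simp
    have b_in: "b n \<in> {0..T}" for n unfolding b_def
      using dyad_index_le[OF T, of t n] st by (intro dyad_in T) simp
    have b_lim: "b \<longlonglongrightarrow> t" unfolding b_def using dyad_index_tendsto[OF T, of t] st by simp
    have "(\<lambda>n. dyad T n (dyad_index T n s) + T / 2 ^ n) \<longlonglongrightarrow> s + 0"
      by (intro tendsto_add dyad_index_tendsto[OF T st(1)] step_width_tendsto)
    then have a_lim: "a \<longlonglongrightarrow> s" by (simp add: a_def[abs_def] dyad_Suc)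
    have st_in: "s \<in> {0..T}" "t \<in> {0..T}" using st by auto
    have "(\<lambda>n. \<rho> (a n) s + ?I + \<rho> (b n) t) \<longlonglongrightarrow> 0 + ?I + 0"
      by (intro tendsto_add tendsto_const hoelder_tendsto_zero[OF H K a_in a_lim st_in(1)]
          hoelder_tendsto_zero[OF H K b_in b_lim st_in(2)])
    then have lim: "(\<lambda>n. \<rho> (a n) s + ?I + \<rho> (b n) t) \<longlonglongrightarrow> ?I" by simp
    have "\<forall>\<^sub>F n in sequentially. a n < (s + t) / 2" using \<open>s < t\<close> by (intro order_tendstoD(2)[OF a_lim]) simp
    moreover have "\<forall>\<^sub>F n in sequentially. (s + t) / 2 < b n" using \<open>s < t\<close> by (intro order_tendstoD(1)[OF b_lim]) simp
    ultimately have "\<forall>\<^sub>F n in sequentially. \<rho> s t \<le> \<rho> (a n) s + ?I + \<rho> (b n) t"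
    proof eventually_elim
      case (elim n)
      then have ab: "a n < b n" by simp
      have "\<rho> s t \<le> \<rho> s (a n) + \<rho> (a n) t" using semidistance_onD(3)[OF \<rho>] st_in a_in by blast
      also have "\<rho> (a n) t \<le> \<rho> (a n) (b n) + \<rho> (b n) t" using semidistance_onD(3)[OF \<rho>] st_in a_in b_in by blast
      also have "\<rho> (a n) (b n) \<le> (\<integral>\<^sup>+r\<in>{a n..<b n}. ennreal (g r) \<partial>lborel)"
        unfolding a_def b_def
      proof (rule gd)
        show "Suc (dyad_index T n s) \<le> dyad_index T n t"
          using ab unfolding a_def b_def by (simp only: dyad_less_iff[OF T])
        show "dyad_index T n t \<le> 2 ^ n" using dyad_index_le[OF T, of t n] st by simp
      qed
      also have "\<dots> \<le> ?I"
        using dyad_index_bounds(2)[OF T st(1), of n] dyad_index_bounds(1)[OF T, of t n] st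
        by (intro nn_set_integral_mono) (auto simp: a_def b_def)
      also have "\<rho> s (a n) = \<rho> (a n) s" using semidistance_onD(2)[OF \<rho>] st_in a_in by blast
      finally show ?case by (simp add: add.assoc add_left_mono add_right_mono)
    qed
    then show ?thesis by (rule tendsto_lowerbound[OF lim _ sequentially_bot])
  qed
  have g2: "(\<rho> s t)\<^sup>2 \<le> ennreal (t - s) * (\<integral>\<^sup>+r\<in>{s..<t}. ennreal ((g r)\<^sup>2) \<partial>lborel)" if st: "0 \<le> s" "s \<le> t" "t \<le> T" for s t
  proof -
    have "(\<rho> s t)\<^sup>2 \<le> (\<integral>\<^sup>+r\<in>{s..<t}. ennreal (g r) \<partial>lborel)\<^sup>2"
      using g1[OF st] by (simp add: ennreal_power2_le_iff)
    also have "\<dots> \<le> ennreal (t - s) * (\<integral>\<^sup>+r\<in>{s..<t}. (ennreal (g r))\<^sup>2 \<partial>lborel)"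
      by (rule set_Cauchy_Schwarz_lborel[OF _ st(2)]) measurable
    finally show ?thesis by (simp add: ennreal_power g0)
  qed
  have "AE t in lborel. t \<in> {0<..<T} \<longrightarrow> (mder T \<rho> t)\<^sup>2 \<le> ennreal ((g t)\<^sup>2)"
    using gC C by (intro mder_le[OF T] g2 semidistance_onD(2)[OF \<rho>]) (auto intro: le_less_trans)
  then have g3: "AE t in lborel. t \<in> {0<..<T} \<longrightarrow> mder T \<rho> t = ennreal (g t)"
    using gl
  proof eventually_elim
    case (elim t)
    show ?case
    proof
      assume t: "t \<in> {0<..<T}"
      then have "(mder T \<rho> t)\<^sup>2 \<le> (ennreal (g t))\<^sup>2" using elim(1) by (simp add: ennreal_power g0)
      then have "mder T \<rho> t \<le> ennreal (g t)" by (simp only: ennreal_power2_le_iff)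
      moreover have "ennreal (g t) \<le> mder T \<rho> t"
        using elim(2) difference_quotient_limsup_le[OF T \<rho> t] t by (auto intro: order_trans)
      ultimately show "mder T \<rho> t = ennreal (g t)" by (rule antisym)
    qed
  qed
  show thesis by (rule that[OF g g0 gC g1 g2 g3])
qed

lemma hoelder_tendsto:
  fixes x :: "nat \<Rightarrow> real"
  assumes \<rho>: "semidistance_on {0..T} \<rho>"
    and H: "\<And>s t. s \<in> {0..T} \<Longrightarrow> t \<in> {0..T} \<Longrightarrow> (\<rho> s t)\<^sup>2 \<le> ennreal (K * \<bar>t - s\<bar>)" and K: "0 \<le> K"
    and x: "\<And>n. x n \<in> {0..T}" "x \<longlonglongrightarrow> t" "t \<in> {0..T}" and r: "r \<in> {0..T}"
  shows "(\<lambda>n. \<rho> r (x n)) \<longlonglongrightarrow> \<rho> r t" "\<rho> r t < top"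
proof -
  have "(\<rho> r t)\<^sup>2 < top" using H[OF r x(3)] by (rule le_less_trans) simp
  then show fin: "\<rho> r t < top" by (simp add: power_less_top_ennreal)
  have z: "(\<lambda>n. \<rho> (x n) t) \<longlonglongrightarrow> 0" by (rule hoelder_tendsto_zero[OF H K x])
  show "(\<lambda>n. \<rho> r (x n)) \<longlonglongrightarrow> \<rho> r t"
  proof (rule tendsto_sandwich)
    have "\<rho> r t \<le> \<rho> r (x n) + \<rho> (x n) t" for n using semidistance_onD(3)[OF \<rho> r x(1,3)] .
    then have "\<rho> r t - \<rho> (x n) t \<le> \<rho> r (x n)" for n
      using fin by (auto simp: ennreal_minus_le_iff add.commute)
    then show "\<forall>\<^sub>F n in sequentially. \<rho> r t - \<rho> (x n) t \<le> \<rho> r (x n)" by simp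
    have "\<rho> r (x n) \<le> \<rho> r t + \<rho> (x n) t" for n
      using semidistance_onD(3)[OF \<rho> r x(3) x(1)[of n]] semidistance_onD(2)[OF \<rho> x(3) x(1)[of n]] by simp
    then show "\<forall>\<^sub>F n in sequentially. \<rho> r (x n) \<le> \<rho> r t + \<rho> (x n) t" by simp
    have "(\<lambda>n. \<rho> r t - \<rho> (x n) t) \<longlonglongrightarrow> \<rho> r t - 0" using fin by (intro tendsto_intros z) simp
    then show "(\<lambda>n. \<rho> r t - \<rho> (x n) t) \<longlonglongrightarrow> \<rho> r t" by simp
    have "(\<lambda>n. \<rho> r t + \<rho> (x n) t) \<longlonglongrightarrow> \<rho> r t + 0" by (intro tendsto_intros z)
    then show "(\<lambda>n. \<rho> r t + \<rho> (x n) t) \<longlonglongrightarrow> \<rho> r t" by simp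
  qed
qed

text \<open>The upper limit defining the metric derivative of a continuous curve may be taken along dyadic points.\<close>
lemma mder_joint_measurable:
  fixes \<rho> :: "'w \<Rightarrow> real \<Rightarrow> real \<Rightarrow> ennreal"
  assumes T: "0 < T"
    and meas: "\<And>s t. s \<in> {0..T} \<Longrightarrow> t \<in> {0..T} \<Longrightarrow> (\<lambda>w. \<rho> w s t) \<in> borel_measurable M"
  obtains \<Phi> where "\<Phi> \<in> borel_measurable (M \<Otimes>\<^sub>M lborel)"
    "\<And>w t K. semidistance_on {0..T} (\<rho> w) \<Longrightarrow> 0 \<le> K \<Longrightarrow>
       (\<And>s t. s \<in> {0..T} \<Longrightarrow> t \<in> {0..T} \<Longrightarrow> (\<rho> w s t)\<^sup>2 \<le> ennreal (K * \<bar>t - s\<bar>)) \<Longrightarrow> t \<in> {0<..<T} \<Longrightarrow>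
       mder T (\<rho> w) t = \<Phi> (w, t)"
proof -
  define I where "I = {(n, i). i \<le> (2::nat) ^ n}"
  \<comment> \<open>The minimum keeps the approximating grid time inside \<open>{0..T}\<close> for
    every real \<open>t\<close>, where measurability of \<open>\<rho>\<close> is known; for
    \<open>t\<close> in \<open>{0..T}\<close> it has no effect.\<close>
  define gr where "gr m t = dyad T m (min (dyad_index T m t) (2 ^ m))" for m t
  \<comment> \<open>Writing the distance to time \<open>t\<close> as a lower limit over grid times
    uses \<open>\<rho>\<close> at countably many pairs of fixed times only, so measurability in
    \<open>w\<close> becomes joint measurability. Grid times outside the punctured ball contribute
    0, which is harmless in a supremum.\<close>
  define q where "q k p z = (case p of (n, i) \<Rightarrow>
      if 0 < \<bar>dyad T n i - snd z\<bar> \<and> \<bar>dyad T n i - snd z\<bar> < 1 / real (Suc k)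
      then liminf (\<lambda>m. \<rho> (fst z) (dyad T n i) (gr m (snd z))) / ennreal \<bar>dyad T n i - snd z\<bar> else 0)"
    for k :: nat and p :: "nat \<times> nat" and z :: "'w \<times> real"
  define \<Phi> where "\<Phi> z = (INF k. SUP p\<in>I. q k p z)" for z
  have gr_in: "gr m t \<in> {0..T}" for m t unfolding gr_def by (intro dyad_in T) simp
  have gr_lim: "(\<lambda>m. gr m t) \<longlonglongrightarrow> t" if "t \<in> {0..T}" for t
    using dyad_index_tendsto[OF T, of t] dyad_index_le[OF T, of t] that by (simp add: gr_def min_absorb1)
  have qm: "q k p \<in> borel_measurable (M \<Otimes>\<^sub>M lborel)" if pI: "p \<in> I" for k p
  proof -
    obtain n i where p: "p = (n, i)" "i \<le> 2 ^ n" using pI by (auto simp: I_def)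
    have "(\<lambda>z. \<rho> (fst z) (dyad T n i) (gr m (snd z))) \<in> borel_measurable (M \<Otimes>\<^sub>M lborel)" for m
      unfolding gr_def
    proof (rule measurable_compose_countable[where f = "\<lambda>j z. \<rho> (fst z) (dyad T n i) (dyad T m (min j (2 ^ m)))"])
      show "(\<lambda>z. dyad_index T m (snd z)) \<in> measurable (M \<Otimes>\<^sub>M lborel) (count_space UNIV)"
        by (rule measurable_compose[OF measurable_snd]) (simp add: measurable_lborel1)
      show "(\<lambda>z. \<rho> (fst z) (dyad T n i) (dyad T m (min j (2 ^ m)))) \<in> borel_measurable (M \<Otimes>\<^sub>M lborel)" for j
        using p by (intro measurable_compose[OF measurable_fst] meas dyad_in T) auto
    qed
    then have [measurable]: "(\<lambda>z. liminf (\<lambda>m. \<rho> (fst z) (dyad T n i) (gr m (snd z)))) \<in> borel_measurable (M \<Otimes>\<^sub>M lborel)"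
      by (rule borel_measurable_liminf)
    have [measurable]: "snd \<in> borel_measurable (M \<Otimes>\<^sub>M lborel)"
      using measurable_snd[of M lborel] by (simp cong: measurable_cong_sets)
    show ?thesis unfolding q_def p by simp
  qed
  have \<Phi>m: "\<Phi> \<in> borel_measurable (M \<Otimes>\<^sub>M lborel)"
    unfolding \<Phi>_def
  proof (intro borel_measurable_INF borel_measurable_SUP qm)
    show "countable I" by (rule countableI_type)
  qed auto
  have "mder T (\<rho> w) t = \<Phi> (w, t)"
    if \<rho>: "semidistance_on {0..T} (\<rho> w)" and K: "0 \<le> K"
      and H: "\<And>s t. s \<in> {0..T} \<Longrightarrow> t \<in> {0..T} \<Longrightarrow> (\<rho> w s t)\<^sup>2 \<le> ennreal (K * \<bar>t - s\<bar>)"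
      and t: "t \<in> {0<..<T}" for w t K
  proof -
    have t': "t \<in> {0..T}" using t by auto
    have lim: "liminf (\<lambda>m. \<rho> w r (gr m t)) = \<rho> w r t" if "r \<in> {0..T}" for r
      by (rule lim_imp_Liminf[OF sequentially_bot hoelder_tendsto(1)[OF \<rho> H K gr_in gr_lim[OF t'] t' that]])
    have q_eq: "q k (n, i) (w, t) = (if 0 < \<bar>dyad T n i - t\<bar> \<and> \<bar>dyad T n i - t\<bar> < 1 / real (Suc k)
        then \<rho> w (dyad T n i) t / ennreal \<bar>dyad T n i - t\<bar> else 0)" if "(n, i) \<in> I" for k n i
      using lim[OF dyad_in[OF T, of i n]] that by (simp add: q_def I_def)
    have md: "mder T (\<rho> w) t = (INF e\<in>{0<..}. SUP s\<in>{0..T} \<inter> ball t e - {t}. \<rho> w s t / ennreal \<bar>s - t\<bar>)"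
      unfolding mder_def by (rule Limsup_within)
    show ?thesis
    proof (rule antisym)
      show "\<Phi> (w, t) \<le> mder T (\<rho> w) t"
        unfolding md
      proof (rule INF_greatest)
        fix e :: real assume "e \<in> {0<..}"
        then obtain k where k: "1 / real (Suc k) < e" using nat_approx_posE by (metis greaterThan_iff)
        have "\<Phi> (w, t) \<le> (SUP p\<in>I. q k p (w, t))" unfolding \<Phi>_def by (rule INF_lower) simp
        also have "\<dots> \<le> (SUP s\<in>{0..T} \<inter> ball t e - {t}. \<rho> w s t / ennreal \<bar>s - t\<bar>)"
        proof (rule SUP_least)
          fix p assume p: "p \<in> I"
          obtain n i where ni: "p = (n, i)" by (cases p)
          have i: "i \<le> 2 ^ n" using p ni by (simp add: I_def)
          show "q k p (w, t) \<le> (SUP s\<in>{0..T} \<inter> ball t e - {t}. \<rho> w s t / ennreal \<bar>s - t\<bar>)"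
          proof (cases "0 < \<bar>dyad T n i - t\<bar> \<and> \<bar>dyad T n i - t\<bar> < 1 / real (Suc k)")
            case True
            then have "dyad T n i \<in> {0..T} \<inter> ball t e - {t}"
              using dyad_in[OF T i] k by (auto simp: dist_real_def abs_minus_commute)
            then show ?thesis using True p unfolding ni by (subst q_eq) (auto intro: SUP_upper)
          next
            case False
            have "q k p (w, t) = 0" using False p unfolding ni by (subst q_eq) auto
            then show ?thesis by simp
          qed
        qed
        finally show "\<Phi> (w, t) \<le> (SUP s\<in>{0..T} \<inter> ball t e - {t}. \<rho> w s t / ennreal \<bar>s - t\<bar>)" .
      qed
      show "mder T (\<rho> w) t \<le> \<Phi> (w, t)"
        unfolding \<Phi>_def
      proof (rule INF_greatest)
        fix k
        have "mder T (\<rho> w) t \<le> (SUP s\<in>{0..T} \<inter> ball t (1 / real (Suc k)) - {t}. \<rho> w s t / ennreal \<bar>s - t\<bar>)"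
          unfolding md by (rule INF_lower) simp
        \<comment> \<open>A time \<open>s\<close> in the punctured ball is a limit of grid times
          that eventually lie in it too, and by Hoelder continuity their quotients converge to that
          of \<open>s\<close>.\<close>
        also have "\<dots> \<le> (SUP p\<in>I. q k p (w, t))"
        proof (rule SUP_least)
          fix s assume "s \<in> {0..T} \<inter> ball t (1 / real (Suc k)) - {t}"
          then have s: "s \<in> {0..T}" "0 < \<bar>s - t\<bar>" "\<bar>s - t\<bar> < 1 / real (Suc k)"
            by (auto simp: dist_real_def abs_minus_commute)
          have tr: "\<rho> w t s < top" "(\<lambda>m. \<rho> w t (gr m s)) \<longlonglongrightarrow> \<rho> w t s"
            using hoelder_tendsto[OF \<rho> H K gr_in gr_lim[OF s(1)] s(1) t'] by auto
          have sw: "\<rho> w t r = \<rho> w r t" if "r \<in> {0..T}" for r using semidistance_onD(2)[OF \<rho> t' that] .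
          have l1: "(\<lambda>m. \<rho> w (gr m s) t) \<longlonglongrightarrow> \<rho> w s t" using tr(2) sw gr_in s by simp
          have l2: "(\<lambda>m. \<bar>gr m s - t\<bar>) \<longlonglongrightarrow> \<bar>s - t\<bar>" by (intro tendsto_intros gr_lim s)
          have "(\<lambda>m. \<rho> w (gr m s) t * inverse (ennreal \<bar>gr m s - t\<bar>)) \<longlonglongrightarrow> \<rho> w s t * inverse (ennreal \<bar>s - t\<bar>)"
          proof (rule tendsto_mult_ennreal[OF l1])
            show "(\<lambda>m. inverse (ennreal \<bar>gr m s - t\<bar>)) \<longlonglongrightarrow> inverse (ennreal \<bar>s - t\<bar>)"
              using continuous_on_inverse_ennreal[of UNIV "\<lambda>x. x"]
              by (rule continuous_on_tendsto_compose[where s = UNIV]) (auto intro!: tendsto_intros l2[unfolded abs_minus_commute] l2)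
            show "\<not> (\<rho> w s t = 0 \<and> inverse (ennreal \<bar>s - t\<bar>) = \<infinity> \<or> \<rho> w s t = \<infinity> \<and> inverse (ennreal \<bar>s - t\<bar>) = 0)"
              using tr(1) sw s by (auto simp: ennreal_inverse_eq_top_iff)
          qed
          then have l3: "(\<lambda>m. \<rho> w (gr m s) t / ennreal \<bar>gr m s - t\<bar>) \<longlonglongrightarrow> \<rho> w s t / ennreal \<bar>s - t\<bar>"
            by (simp add: divide_ennreal_def)
          have "\<forall>\<^sub>F m in sequentially. 0 < \<bar>gr m s - t\<bar>" by (rule order_tendstoD(1)[OF l2 s(2)])
          moreover have "\<forall>\<^sub>F m in sequentially. \<bar>gr m s - t\<bar> < 1 / real (Suc k)" by (rule order_tendstoD(2)[OF l2 s(3)])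
          ultimately have "\<forall>\<^sub>F m in sequentially. \<rho> w (gr m s) t / ennreal \<bar>gr m s - t\<bar> \<le> (SUP p\<in>I. q k p (w, t))"
          proof eventually_elim
            case (elim m)
            have pI: "(m, min (dyad_index T m s) (2 ^ m)) \<in> I" by (simp add: I_def)
            have "\<rho> w (gr m s) t / ennreal \<bar>gr m s - t\<bar> = q k (m, min (dyad_index T m s) (2 ^ m)) (w, t)"
              using elim by (subst q_eq[OF pI]) (simp add: gr_def)
            then show ?case using pI by (auto intro: SUP_upper)
          qed
          then show "\<rho> w s t / ennreal \<bar>s - t\<bar> \<le> (SUP p\<in>I. q k p (w, t))"
            by (rule tendsto_upperbound[OF l3 _ sequentially_bot])
        qed
        finally show "mder T (\<rho> w) t \<le> (SUP p\<in>I. q k p (w, t))" .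
      qed
    qed
  qed
  then show thesis using that \<Phi>m by blast
qed

section \<open>Absolutely continuous curves and discrete energies\<close>

lemma AC2_energy:
  assumes "\<eta> \<in> AC2 T S \<delta>"
  obtains m :: "real \<Rightarrow> ennreal" where "m \<in> borel_measurable borel" "(\<integral>\<^sup>+r\<in>{0..<T}. m r \<partial>lborel) < top"
    "\<And>s t. 0 \<le> s \<Longrightarrow> s \<le> t \<Longrightarrow> t \<le> T \<Longrightarrow> (\<delta> (\<eta> s) (\<eta> t))\<^sup>2 \<le> ennreal (t - s) * (\<integral>\<^sup>+r\<in>{s..<t}. m r \<partial>lborel)"
proof -
  obtain g :: "real \<Rightarrow> real" where g: "set_borel_measurable lborel {0<..<T} g"
    "set_integrable lborel {0<..<T} (\<lambda>r. (g r)\<^sup>2)"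
    and b: "\<And>s t. 0 \<le> s \<Longrightarrow> s \<le> t \<Longrightarrow> t \<le> T \<Longrightarrow> enn2ereal (\<delta> (\<eta> s) (\<eta> t)) \<le> ereal (LBINT r:{s<..<t}. g r)"
    using assms unfolding AC2_def by blast
  define f where "f r = indicator {0<..<T} r * g r" for r
  have fm [measurable]: "f \<in> borel_measurable borel"
    using g(1) by (simp add: set_borel_measurable_def f_def[abs_def])
  \<comment> \<open>The absolute value is taken because \<open>g\<close> may be negative; the square
    is what Cauchy-Schwarz produces from the linear bound.\<close>
  define m where "m r = (ennreal \<bar>f r\<bar>)\<^sup>2" for r
  have mm [measurable]: "m \<in> borel_measurable borel" unfolding m_def by measurable
  have "integrable lborel (\<lambda>r. (f r)\<^sup>2)"
    using g(2) unfolding set_integrable_def f_def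
    by (rule back_subst[of "integrable lborel"]) (auto simp: indicator_def)
  then have "(\<integral>\<^sup>+r. ennreal (norm ((f r)\<^sup>2)) \<partial>lborel) < \<infinity>" by (simp add: integrable_iff_bounded)
  moreover have "(\<integral>\<^sup>+r\<in>{0..<T}. m r \<partial>lborel) \<le> (\<integral>\<^sup>+r. ennreal (norm ((f r)\<^sup>2)) \<partial>lborel)"
    by (intro nn_integral_mono) (auto simp: m_def indicator_def ennreal_power)
  ultimately have fin: "(\<integral>\<^sup>+r\<in>{0..<T}. m r \<partial>lborel) < top" by (simp add: le_less_trans)
  have "(\<delta> (\<eta> s) (\<eta> t))\<^sup>2 \<le> ennreal (t - s) * (\<integral>\<^sup>+r\<in>{s..<t}. m r \<partial>lborel)" if st: "0 \<le> s" "s \<le> t" "t \<le> T" for s t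
  proof -
    have eq: "(LBINT r:{s<..<t}. g r) = (LINT r|lborel. indicator {s<..<t} r * f r)"
      unfolding set_lebesgue_integral_def f_def using st by (intro Bochner_Integration.integral_cong) (auto simp: indicator_def)
    \<comment> \<open>The case without integrability is covered as well, since the Bochner integral
      is then 0.\<close>
    have "ennreal (norm (LINT r|lborel. indicator {s<..<t} r * f r)) \<le> (\<integral>\<^sup>+r. ennreal (norm (indicator {s<..<t} r * f r)) \<partial>lborel)"
    proof (cases "integrable lborel (\<lambda>r. indicator {s<..<t} r * f r)")
      case True then show ?thesis by (rule integral_norm_bound_ennreal)
    next
      case False then show ?thesis by (simp add: not_integrable_integral_eq)
    qed
    also have "\<dots> = (\<integral>\<^sup>+r\<in>{s<..<t}. ennreal \<bar>f r\<bar> \<partial>lborel)"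
      by (intro nn_integral_cong) (auto simp: indicator_def)
    finally have 1: "ennreal \<bar>LBINT r:{s<..<t}. g r\<bar> \<le> (\<integral>\<^sup>+r\<in>{s..<t}. ennreal \<bar>f r\<bar> \<partial>lborel)"
      unfolding eq nn_integral_Ioo_Ico by simp
    have "enn2ereal (\<delta> (\<eta> s) (\<eta> t)) \<le> ereal \<bar>LBINT r:{s<..<t}. g r\<bar>"
      using b[OF st] by (rule order_trans) simp
    also have "\<dots> = enn2ereal (ennreal \<bar>LBINT r:{s<..<t}. g r\<bar>)" by simp
    finally have "\<delta> (\<eta> s) (\<eta> t) \<le> ennreal \<bar>LBINT r:{s<..<t}. g r\<bar>" by (simp only: less_eq_ennreal.rep_eq)
    with 1 have "\<delta> (\<eta> s) (\<eta> t) \<le> (\<integral>\<^sup>+r\<in>{s..<t}. ennreal \<bar>f r\<bar> \<partial>lborel)" by (rule order_trans[rotated])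
    then have "(\<delta> (\<eta> s) (\<eta> t))\<^sup>2 \<le> (\<integral>\<^sup>+r\<in>{s..<t}. ennreal \<bar>f r\<bar> \<partial>lborel)\<^sup>2" by (simp add: ennreal_power2_le_iff)
    also have "\<dots> \<le> ennreal (t - s) * (\<integral>\<^sup>+r\<in>{s..<t}. (ennreal \<bar>f r\<bar>)\<^sup>2 \<partial>lborel)"
      by (rule set_Cauchy_Schwarz_lborel[OF _ st(2)]) measurable
    finally show ?thesis by (simp add: m_def)
  qed
  then show thesis by (rule that[OF mm fin])
qed

lemma AC2I:
  assumes \<eta>: "\<And>t. t \<in> {0..T} \<Longrightarrow> \<eta> t \<in> S"
    and g [measurable]: "g \<in> borel_measurable borel" and g0: "\<And>t. 0 \<le> g t"
    and fin: "(\<integral>\<^sup>+t\<in>{0..<T}. ennreal ((g t)\<^sup>2) \<partial>lborel) < top"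
    and b: "\<And>s t. 0 \<le> s \<Longrightarrow> s \<le> t \<Longrightarrow> t \<le> T \<Longrightarrow> \<delta> (\<eta> s) (\<eta> t) \<le> (\<integral>\<^sup>+r\<in>{s..<t}. ennreal (g r) \<partial>lborel)"
  shows "\<eta> \<in> AC2 T S \<delta>"
proof -
  have fin1: "(\<integral>\<^sup>+r\<in>{s..<t}. ennreal (g r) \<partial>lborel) < top" if st: "0 \<le> s" "s \<le> t" "t \<le> T" for s t
  proof -
    have "(\<integral>\<^sup>+r\<in>{s..<t}. ennreal (g r) \<partial>lborel)\<^sup>2 \<le> ennreal (t - s) * (\<integral>\<^sup>+r\<in>{s..<t}. (ennreal (g r))\<^sup>2 \<partial>lborel)"
      by (rule set_Cauchy_Schwarz_lborel[OF _ st(2)]) measurable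
    also have "\<dots> \<le> ennreal (t - s) * (\<integral>\<^sup>+t\<in>{0..<T}. ennreal ((g t)\<^sup>2) \<partial>lborel)"
      using st g0 by (intro mult_left_mono nn_integral_mono) (auto simp: indicator_def ennreal_power)
    also have "\<dots> < top" using fin by (simp add: ennreal_mult_less_top)
    finally show ?thesis by (simp add: power_less_top_ennreal)
  qed
  have sb: "set_borel_measurable lborel {0<..<T} g" unfolding set_borel_measurable_def by measurable
  have si: "set_integrable lborel {0<..<T} (\<lambda>r. (g r)\<^sup>2)"
    unfolding set_integrable_def
  proof (rule integrableI_bounded)
    have "(\<integral>\<^sup>+r. ennreal (norm (indicator {0<..<T} r *\<^sub>R (g r)\<^sup>2)) \<partial>lborel) \<le> (\<integral>\<^sup>+t\<in>{0..<T}. ennreal ((g t)\<^sup>2) \<partial>lborel)"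
      by (intro nn_integral_mono) (auto simp: indicator_def)
    then show "(\<integral>\<^sup>+r. ennreal (norm (indicator {0<..<T} r *\<^sub>R (g r)\<^sup>2)) \<partial>lborel) < \<infinity>" using fin by (simp add: le_less_trans)
  qed measurable
  have bd: "enn2ereal (\<delta> (\<eta> s) (\<eta> t)) \<le> ereal (LBINT r:{s<..<t}. g r)" if st: "0 \<le> s" "s \<le> t" "t \<le> T" for s t
  proof -
    have e: "(\<integral>\<^sup>+r. ennreal (indicator {s<..<t} r *\<^sub>R g r) \<partial>lborel) = (\<integral>\<^sup>+r\<in>{s..<t}. ennreal (g r) \<partial>lborel)"
      unfolding nn_integral_Ioo_Ico[symmetric] by (intro nn_integral_cong) (auto simp: indicator_def)
    have "integrable lborel (\<lambda>r. indicator {s<..<t} r *\<^sub>R g r)"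
      using e fin1[OF st] by (intro integrableI_nonneg) (auto simp: g0 indicator_def)
    then have "ennreal (LBINT r:{s<..<t}. g r) = (\<integral>\<^sup>+r\<in>{s..<t}. ennreal (g r) \<partial>lborel)"
      unfolding e[symmetric] set_lebesgue_integral_def by (intro nn_integral_eq_integral[symmetric]) (auto simp: g0 indicator_def)
    then have "\<delta> (\<eta> s) (\<eta> t) \<le> ennreal (LBINT r:{s<..<t}. g r)" using b[OF st] by simp
    then have "enn2ereal (\<delta> (\<eta> s) (\<eta> t)) \<le> enn2ereal (ennreal (LBINT r:{s<..<t}. g r))" by (simp only: less_eq_ennreal.rep_eq)
    moreover have "0 \<le> (LBINT r:{s<..<t}. g r)"
      unfolding set_lebesgue_integral_def by (intro Bochner_Integration.integral_nonneg) (auto simp: g0)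
    ultimately show ?thesis by simp
  qed
  show ?thesis unfolding AC2_def using \<eta> sb si bd by blast
qed

lemma metric_derivative_eq: "metric_derivative T \<delta> \<eta> = mder T (\<lambda>s t. \<delta> (\<eta> s) (\<eta> t))"
  by (simp add: metric_derivative_def mder_def fun_eq_iff)

text \<open>On each cell the length factor of the hypothesis cancels the one in the energy, so that
  the integral of \<open>m\<close> over the cell remains, and the cells are disjoint.\<close>

lemma step_energy_le:
  assumes T: "0 < T" and [measurable]: "m \<in> borel_measurable borel"
    and b: "\<And>s t. 0 \<le> s \<Longrightarrow> s \<le> t \<Longrightarrow> t \<le> T \<Longrightarrow> (\<rho> s t)\<^sup>2 \<le> ennreal (t - s) * (\<integral>\<^sup>+r\<in>{s..<t}. m r \<partial>lborel)"
  shows "step_energy T \<rho> n \<le> (\<integral>\<^sup>+r\<in>{0..<T}. m r \<partial>lborel)"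
proof -
  let ?c = "\<lambda>i. {dyad T n i..<dyad T n (Suc i)}"
  have h: "0 < T / 2 ^ n" using T by simp
  have "step_energy T \<rho> n \<le> (\<Sum>i<2 ^ n. \<integral>\<^sup>+r\<in>?c i. m r \<partial>lborel)"
    unfolding step_energy_def
  proof (rule sum_mono)
    fix i :: nat assume "i \<in> {..<2 ^ n}"
    then have "dyad T n i \<in> {0..T}" "dyad T n (Suc i) \<in> {0..T}" using dyad_in[OF T, of i n] dyad_in[OF T, of "Suc i" n] by auto
    then have "(\<rho> (dyad T n i) (dyad T n (Suc i)))\<^sup>2 \<le> ennreal (dyad T n (Suc i) - dyad T n i) * (\<integral>\<^sup>+r\<in>?c i. m r \<partial>lborel)"
      using T by (intro b) (auto simp: dyad_Suc)
    also have "dyad T n (Suc i) - dyad T n i = T / 2 ^ n" by (simp add: dyad_Suc)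
    finally have "(\<rho> (dyad T n i) (dyad T n (Suc i)))\<^sup>2 / ennreal (T / 2 ^ n)
        \<le> ennreal (T / 2 ^ n) * (\<integral>\<^sup>+r\<in>?c i. m r \<partial>lborel) / ennreal (T / 2 ^ n)" by (rule divide_right_mono_ennreal)
    also have "\<dots> = (\<integral>\<^sup>+r\<in>?c i. m r \<partial>lborel)"
      using h by (subst mult.commute, subst ennreal_mult_divide_eq) auto
    finally show "(\<rho> (dyad T n i) (dyad T n (Suc i)))\<^sup>2 / ennreal (T / 2 ^ n) \<le> (\<integral>\<^sup>+r\<in>?c i. m r \<partial>lborel)" .
  qed
  also have "\<dots> = (\<integral>\<^sup>+r. (\<Sum>i<2 ^ n. m r * indicator (?c i) r) \<partial>lborel)"
    by (rule nn_integral_sum[symmetric]) measurable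
  also have "\<dots> \<le> (\<integral>\<^sup>+r\<in>{0..<T}. m r \<partial>lborel)"
  proof (rule nn_integral_mono)
    fix r
    show "(\<Sum>i<2 ^ n. m r * indicator (?c i) r) \<le> m r * indicator {0..<T} r"
    proof (cases "r \<in> {0..<T}")
      case True
      then have "indicator (?c i) r = (if i = dyad_index T n r then 1 else 0 :: ennreal)" for i
        using dyad_index_eq_iff[OF T, of r n i] by (auto simp: indicator_def)
      then have "(\<Sum>i<2 ^ n. m r * indicator (?c i) r) = (\<Sum>i<2 ^ n. if i = dyad_index T n r then m r else 0)"
        by (intro sum.cong) auto
      then show ?thesis using True by (simp add: sum.delta)
    next
      case False
      have "r \<notin> ?c i" if "i < 2 ^ n" for i
        using False dyad_in[OF T, of i n] dyad_in[OF T, of "Suc i" n] that by auto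
      then show ?thesis by (simp add: sum.neutral)
    qed
  qed
  finally show ?thesis .
qed

text \<open>The factor 2 in \<open>(u + v)\<^sup>2 \<le> 2 * u\<^sup>2 + 2 * v\<^sup>2\<close> is
  absorbed by the halving of the cell length. The set \<open>S\<close> is a parameter because paths
  are first given at dyadic times only.\<close>

lemma step_energy_mono:
  assumes T: "0 < T" and \<rho>: "semidistance_on S \<rho>" and S: "\<And>n i. i \<le> 2 ^ n \<Longrightarrow> dyad T n i \<in> S"
    and nm: "n \<le> m"
  shows "step_energy T \<rho> n \<le> step_energy T \<rho> m"
  using nm
proof (induction m rule: dec_induct)
  case (step m)
  let ?h = "T / 2 ^ m" and ?r = "\<lambda>j. (\<rho> (dyad T (Suc m) j) (dyad T (Suc m) (Suc j)))\<^sup>2 / ennreal (T / 2 ^ Suc m)"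
  have h: "0 < ?h" using T by simp
  have ref: "dyad T (Suc m) (i * 2) = dyad T m i" for i using dyad_refine[of T m 1 i] by simp
  have "step_energy T \<rho> m \<le> (\<Sum>i<2 ^ m. ?r (i * 2) + ?r (i * 2 + 1))"
    unfolding step_energy_def
  proof (rule sum_mono)
    fix i :: nat assume i: "i \<in> {..<2 ^ m}"
    define a b c where "a = dyad T (Suc m) (i * 2)" and "b = dyad T (Suc m) (i * 2 + 1)" and "c = dyad T (Suc m) (i * 2 + 2)"
    have "a \<in> S" "b \<in> S" "c \<in> S" unfolding a_def b_def c_def using i by (auto intro!: S)
    then have "\<rho> a c \<le> \<rho> a b + \<rho> b c" by (rule semidistance_onD(3)[OF \<rho>])
    then have "(\<rho> a c)\<^sup>2 \<le> (\<rho> a b + \<rho> b c)\<^sup>2" by (simp add: ennreal_power2_le_iff)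
    also have "\<dots> \<le> 2 * (\<rho> a b)\<^sup>2 + 2 * (\<rho> b c)\<^sup>2" using power2_add_le_weighted[of 1 1 "\<rho> a b" "\<rho> b c"] by simp
    finally have "(\<rho> a c)\<^sup>2 / ennreal ?h \<le> (2 * (\<rho> a b)\<^sup>2 + 2 * (\<rho> b c)\<^sup>2) / ennreal ?h" by (rule divide_right_mono_ennreal)
    also have "\<dots> = (\<rho> a b)\<^sup>2 / ennreal (T / 2 ^ Suc m) + (\<rho> b c)\<^sup>2 / ennreal (T / 2 ^ Suc m)"
    proof -
      have "inverse (ennreal (T / 2 ^ Suc m)) = 2 * inverse (ennreal ?h)"
        using T by (simp add: inverse_ennreal ennreal_mult[symmetric] ennreal_numeral[symmetric] del: ennreal_numeral)
      then show ?thesis by (simp add: divide_ennreal_def algebra_simps)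
    qed
    finally show "(\<rho> (dyad T m i) (dyad T m (Suc i)))\<^sup>2 / ennreal ?h \<le> ?r (i * 2) + ?r (i * 2 + 1)"
      using ref[of i] ref[of "Suc i"] by (simp add: a_def b_def c_def)
  qed
  also have "\<dots> = (\<Sum>i<2 ^ m. sum ?r {i * 2..<i * 2 + 2})"
    by (intro sum.cong refl) (simp add: numeral_2_eq_2)
  also have "\<dots> = step_energy T \<rho> (Suc m)"
  proof -
    have "(2::nat) ^ Suc m = 2 ^ m * 2" by simp
    then show ?thesis using sum.nat_group[of ?r 2 "2 ^ m"] unfolding step_energy_def by (simp only:)
  qed
  finally show ?case using step.IH by (rule order_trans[rotated])
qed simp

lemma sum_squared_le_ennreal:
  fixes f :: "nat \<Rightarrow> ennreal"
  shows "(\<Sum>l<N. f l)\<^sup>2 \<le> of_nat N * (\<Sum>l<N. (f l)\<^sup>2)"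
proof -
  have "(\<integral>\<^sup>+l. f l * 1 \<partial>count_space {..<N})\<^sup>2 \<le> (\<integral>\<^sup>+l. (f l)\<^sup>2 \<partial>count_space {..<N}) * (\<integral>\<^sup>+l. 1\<^sup>2 \<partial>count_space {..<N})"
    by (rule Cauchy_Schwarz_nn_integral) auto
  then show ?thesis by (simp add: nn_integral_count_space_finite mult.commute)
qed

text \<open>Cauchy-Schwarz over the \<open>j - i\<close> cells between the two times produces the
  factor \<open>j - i\<close>, and that many cell lengths make up the time difference.\<close>

lemma step_energy_hoelder:
  assumes T: "0 < T" and \<rho>: "semidistance_on S \<rho>" and S: "\<And>n i. i \<le> 2 ^ n \<Longrightarrow> dyad T n i \<in> S"
    and ij: "i \<le> j" "j \<le> 2 ^ n"
  shows "(\<rho> (dyad T n i) (dyad T n j))\<^sup>2 \<le> ennreal (dyad T n j - dyad T n i) * step_energy T \<rho> n"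
proof -
  let ?h = "T / 2 ^ n" and ?N = "j - i" and ?f = "\<lambda>l. \<rho> (dyad T n l) (dyad T n (Suc l))"
  have h: "0 < ?h" using T by simp
  have "\<rho> (dyad T n (i + 0)) (dyad T n (i + ?N)) \<le> (\<Sum>l<?N. \<rho> (dyad T n (i + l)) (dyad T n (i + Suc l)))"
    by (rule semidistance_chain[OF \<rho>]) (use ij in \<open>auto intro!: S\<close>)
  then have "(\<rho> (dyad T n i) (dyad T n j))\<^sup>2 \<le> (\<Sum>l<?N. ?f (i + l))\<^sup>2"
    using ij by (simp add: ennreal_power2_le_iff)
  also have "\<dots> \<le> of_nat ?N * (\<Sum>l<?N. (?f (i + l))\<^sup>2)" by (rule sum_squared_le_ennreal)
  also have "(\<Sum>l<?N. (?f (i + l))\<^sup>2) = (\<Sum>l\<in>{i..<j}. (?f l)\<^sup>2)"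
    using ij by (subst sum.atLeastLessThan_shift_0) (simp add: atLeast0LessThan)
  also have "\<dots> \<le> (\<Sum>l<2 ^ n. (?f l)\<^sup>2)" using ij by (intro sum_mono2) auto
  also have "\<dots> = ennreal ?h * step_energy T \<rho> n"
    unfolding step_energy_def sum_distrib_left
  proof (rule sum.cong[OF refl])
    fix l
    show "(?f l)\<^sup>2 = ennreal ?h * ((?f l)\<^sup>2 / ennreal ?h)"
    proof -
      have "ennreal ?h * ((?f l)\<^sup>2 / ennreal ?h) = (?f l)\<^sup>2 * ennreal ?h / ennreal ?h"
        by (simp add: ennreal_times_divide mult.commute)
      also have "\<dots> = (?f l)\<^sup>2" using h by (subst ennreal_mult_divide_eq) auto
      finally show ?thesis by simp
    qed
  qed
  also have "of_nat ?N * (ennreal ?h * step_energy T \<rho> n) = ennreal (real ?N * ?h) * step_energy T \<rho> n"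
  proof -
    have "ennreal (real ?N * ?h) = ennreal (real ?N) * ennreal ?h" using h by (intro ennreal_mult) auto
    then show ?thesis by (simp only: mult.assoc ennreal_of_nat_eq_real_of_nat)
  qed
  also have "real ?N * ?h = dyad T n j - dyad T n i"
    using ij by (simp add: dyad_def of_nat_diff algebra_simps diff_divide_distrib)
  finally show ?thesis by (simp add: mult_left_mono)
qed

section \<open>Measures on path spaces\<close>

text \<open>An open preimage is a countable union of relatively open parts of the Borel sets
  \<open>S n\<close>; on the uncovered remainder the map is constant, so the remainder enters as a
  whole or not at all.\<close>

lemma piecewise_continuous_measurable:
  assumes S: "\<And>n::nat. S n \<in> sets (borel_of Y)"
    and cont: "\<And>n. continuous_map (subtopology Y (S n)) Z f"
    and f: "\<And>y. y \<in> topspace Y \<Longrightarrow> f y \<in> topspace Z"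
    and const: "\<And>y. y \<in> topspace Y \<Longrightarrow> y \<notin> (\<Union>n. S n) \<Longrightarrow> f y = z0"
  shows "f \<in> measurable (borel_of Y) (borel_of Z)"
  unfolding borel_of_def[of Z]
proof (rule measurable_measure_of)
  show "{U. openin Z U} \<subseteq> Pow (topspace Z)" by (auto dest: openin_subset)
  show "f \<in> space (borel_of Y) \<rightarrow> topspace Z" using f by auto
  fix U assume "U \<in> {U. openin Z U}"
  then have U: "openin Z U" by simp
  have SY: "S n \<subseteq> topspace Y" for n using sets.sets_into_space[OF S[of n]] by simp
  have piece: "f -` U \<inter> S n \<in> sets (borel_of Y)" for n
  proof -
    have "openin (subtopology Y (S n)) {y \<in> topspace (subtopology Y (S n)). f y \<in> U}"
      using cont U by (rule openin_continuous_map_preimage)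
    then obtain V where V: "openin Y V" "{y \<in> topspace (subtopology Y (S n)). f y \<in> U} = V \<inter> S n"
      unfolding openin_subtopology by blast
    then have "f -` U \<inter> S n = V \<inter> S n" using SY[of n] by (auto simp: topspace_subtopology)
    then show ?thesis using V S by (auto simp: borel_of_open)
  qed
  have "f -` U \<inter> space (borel_of Y) = (\<Union>n. f -` U \<inter> S n) \<union> (if z0 \<in> U then topspace Y - (\<Union>n. S n) else {})"
  proof -
    have "y \<in> (\<Union>n. S n) \<or> f y = z0" if "y \<in> topspace Y" for y using const that by blast
    then show ?thesis using SY by (cases "z0 \<in> U") fastforce+
  qed
  also have "\<dots> \<in> sets (borel_of Y)"
  proof (rule sets.Un)
    show "(\<Union>n. f -` U \<inter> S n) \<in> sets (borel_of Y)" by (intro sets.countable_UN) (use piece in auto)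
    have "(\<Union>n. S n) \<in> sets (borel_of Y)" by (intro sets.countable_UN) (use S in auto)
    from sets.compl_sets[OF this]
    show "(if z0 \<in> U then topspace Y - (\<Union>n. S n) else {}) \<in> sets (borel_of Y)" by simp
  qed
  finally show "f -` U \<inter> space (borel_of Y) \<in> sets (borel_of Y)" .
qed

text \<open>A product of compact sets is compact by Tychonoff's theorem, and the mass it misses is
  at most the sum of the errors of the coordinates. Countability of \<open>I\<close> allows these
  errors to be summable.\<close>

lemma product_tight:
  fixes P :: "nat \<Rightarrow> ('i \<Rightarrow> 'a) measure"
  assumes X: "Hausdorff_space X" and I: "countable I"
    and P: "\<And>n. P n \<in> radon_prob (product_topology (\<lambda>_. X) I)"
    and t: "\<And>i e. i \<in> I \<Longrightarrow> 0 < e \<Longrightarrow>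
      \<exists>K. compactin X K \<and> (\<forall>n. 1 - e \<le> measure (distr (P n) (borel_of X) (\<lambda>\<eta>. \<eta> i)) K)"
    and e: "0 < e"
  shows "\<exists>K. compactin (product_topology (\<lambda>_. X) I) K \<and> (\<forall>n. 1 - e \<le> measure (P n) K)"
proof -
  let ?Y = "product_topology (\<lambda>_. X) I"
  interpret P: prob_space "P n" for n using radon_prob_D[OF P] by simp
  note sp [simp] = radon_prob_D(2,3)[OF P]
  have hY: "Hausdorff_space ?Y" using X by (simp add: Hausdorff_space_product_topology)
  \<comment> \<open>The coordinate with number \<open>k\<close> may miss mass
    \<open>e / 2^(k+1)\<close>; over all \<open>k\<close> this adds up to \<open>e\<close>.\<close>
  define \<epsilon> where "\<epsilon> i = e * (1 / 2) ^ Suc (to_nat_on I i)" for i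
  have \<epsilon>: "0 < \<epsilon> i" for i using e by (simp add: \<epsilon>_def)
  have "\<forall>i\<in>I. \<exists>K. compactin X K \<and> (\<forall>n. 1 - \<epsilon> i \<le> measure (distr (P n) (borel_of X) (\<lambda>\<eta>. \<eta> i)) K)"
    using t \<epsilon> by blast
  then obtain K where K: "\<And>i. i \<in> I \<Longrightarrow> compactin X (K i)"
    "\<And>i n. i \<in> I \<Longrightarrow> 1 - \<epsilon> i \<le> measure (distr (P n) (borel_of X) (\<lambda>\<eta>. \<eta> i)) (K i)" by metis
  have cK: "compactin ?Y (PiE I K)" using K(1) by (simp add: compactin_PiE)
  have ev: "(\<lambda>\<eta>. \<eta> i) \<in> measurable (P n) (borel_of X)" if "i \<in> I" for i n
    using continuous_map_measurable[OF continuous_map_product_projection[OF that]] by (simp cong: measurable_cong_sets)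
  define B where "B i = {\<eta> \<in> topspace ?Y. \<eta> i \<notin> K i}" for i
  have Bs: "B i \<in> sets (borel_of ?Y)" if i: "i \<in> I" for i
  proof -
    have "(\<lambda>\<eta>. \<eta> i) -` (topspace X - K i) \<inter> space (P 0) \<in> sets (P 0)"
      using ev[OF i] sets.compl_sets[OF borel_of_compact[OF X K(1)[OF i]]] by (intro measurable_sets) auto
    moreover have "(\<lambda>\<eta>. \<eta> i) -` (topspace X - K i) \<inter> space (P 0) = B i"
      using i by (auto simp: B_def)
    ultimately show ?thesis by simp
  qed
  have PB: "emeasure (P n) (B i) \<le> ennreal (\<epsilon> i)" if i: "i \<in> I" for i n
  proof -
    have "measure (distr (P n) (borel_of X) (\<lambda>\<eta>. \<eta> i)) (K i) = measure (P n) ((\<lambda>\<eta>. \<eta> i) -` K i \<inter> space (P n))"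
      using ev[OF i] borel_of_compact[OF X K(1)[OF i]] by (rule measure_distr)
    also have "(\<lambda>\<eta>. \<eta> i) -` K i \<inter> space (P n) = space (P n) - B i" by (auto simp: B_def)
    also have "measure (P n) \<dots> = 1 - measure (P n) (B i)" using Bs[OF i] by (intro P.prob_compl) simp
    finally have "measure (P n) (B i) \<le> \<epsilon> i" using K(2)[OF i, of n] by simp
    then show ?thesis by (simp add: P.emeasure_eq_measure ennreal_leI)
  qed
  have "1 - e \<le> measure (P n) (PiE I K)" for n
  proof -
    have KY: "PiE I K \<in> sets (borel_of ?Y)" by (rule borel_of_compact[OF hY cK])
    \<comment> \<open>The exceptional sets listed along the naturals; the empty set fills the
      numbers that no coordinate has, as happens for finite \<open>I\<close>.\<close>
    define B' where "B' k = (if k \<in> to_nat_on I ` I then B (from_nat_into I k) else {})" for k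
    have B's: "B' k \<in> sets (P n)" for k using Bs I by (auto simp: B'_def)
    have "space (P n) - PiE I K \<subseteq> (\<Union>k. B' k)"
    proof
      fix \<eta> assume \<eta>: "\<eta> \<in> space (P n) - PiE I K"
      then obtain i where i: "i \<in> I" "\<eta> i \<notin> K i" by (auto simp: PiE_iff)
      then have "\<eta> \<in> B' (to_nat_on I i)" using \<eta> I by (auto simp: B'_def B_def)
      then show "\<eta> \<in> (\<Union>k. B' k)" by blast
    qed
    then have "emeasure (P n) (space (P n) - PiE I K) \<le> emeasure (P n) (\<Union>k. B' k)"
      using B's by (intro emeasure_mono) auto
    also have "\<dots> \<le> (\<Sum>k. emeasure (P n) (B' k))" using B's by (intro emeasure_subadditive_countably) auto
    also have "\<dots> \<le> (\<Sum>k. ennreal (e * (1 / 2) ^ Suc k))"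
    proof (intro suminf_le summableI)
      fix k
      show "emeasure (P n) (B' k) \<le> ennreal (e * (1 / 2) ^ Suc k)"
        using PB[of "from_nat_into I k" n] I by (auto simp: B'_def \<epsilon>_def)
    qed
    also have "\<dots> = ennreal (\<Sum>k. e * (1 / 2) ^ Suc k)"
      using e power_half_series by (intro suminf_ennreal2) (auto intro: summable_mult sums_summable)
    also have "(\<Sum>k. e * (1 / 2) ^ Suc k) = e"
      using sums_unique[OF sums_mult[OF power_half_series, of e]] by simp
    finally have "measure (P n) (space (P n) - PiE I K) \<le> e" using e by (simp add: P.emeasure_eq_measure)
    then show ?thesis using P.prob_compl[of "PiE I K" n] KY by simp
  qed
  then show ?thesis using cK by blast
qed

section \<open>Chains of transport plans\<close>

context ext_metric_top
begin

text \<open>Plans are glued one after the other along their common marginals. The carrier is the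
  space of all sequences throughout, so that the induction does not have to change spaces;
  coordinates beyond \<open>N\<close> carry no requirement.\<close>

lemma plan_chain:
  assumes \<nu>: "\<And>i. \<nu> i \<in> radon_prob X"
    and \<pi>: "\<And>i. i < N \<Longrightarrow> \<pi> i \<in> transport_plans X (\<nu> i) (\<nu> (Suc i))"
  shows "\<exists>P\<in>radon_prob (product_topology (\<lambda>_. X) (UNIV :: nat set)).
     (\<forall>i<N. distr P (borel_of (prod_topology X X)) (\<lambda>\<xi>. (\<xi> i, \<xi> (Suc i))) = \<pi> i) \<and>
     (\<forall>i\<le>N. distr P (borel_of X) (\<lambda>\<xi>. \<xi> i) = \<nu> i)"
  using \<pi>
proof (induction N)
  case 0
  let ?Y = "product_topology (\<lambda>_. X) (UNIV :: nat set)"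
  have hY: "Hausdorff_space ?Y" using hausX by (simp add: Hausdorff_space_product_topology)
  have c: "continuous_map X ?Y (\<lambda>x _. x)" by (simp add: continuous_map_componentwise_UNIV)
  have pr: "(\<lambda>\<xi>. \<xi> 0) \<in> measurable (borel_of ?Y) (borel_of X)"
    by (intro continuous_map_measurable continuous_map_product_projection) simp
  have cm: "(\<lambda>x _. x) \<in> measurable (\<nu> 0) (borel_of ?Y)"
    using continuous_map_measurable[OF c] radon_prob_D[OF \<nu>] by (simp cong: measurable_cong_sets)
  have "distr (distr (\<nu> 0) (borel_of ?Y) (\<lambda>x _. x)) (borel_of X) (\<lambda>\<xi>. \<xi> 0) = distr (\<nu> 0) (borel_of X) (\<lambda>x. x)"
    using distr_distr[OF pr cm] by (simp add: o_def)
  also have "\<dots> = \<nu> 0" using radon_prob_D[OF \<nu>] by (intro distr_id2) simp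
  finally show ?case using radon_prob_distr[OF hY \<nu> c] by (intro bexI[of _ "distr (\<nu> 0) (borel_of ?Y) (\<lambda>x _. x)"]) auto
next
  case (Suc N)
  let ?Y = "product_topology (\<lambda>_. X) (UNIV :: nat set)" and ?XX = "prod_topology X X"
  have hY: "Hausdorff_space ?Y" using hausX by (simp add: Hausdorff_space_product_topology)
  obtain P where P: "P \<in> radon_prob ?Y"
    and P2: "\<And>i. i < N \<Longrightarrow> distr P (borel_of ?XX) (\<lambda>\<xi>. (\<xi> i, \<xi> (Suc i))) = \<pi> i"
    and P1: "\<And>i. i \<le> N \<Longrightarrow> distr P (borel_of X) (\<lambda>\<xi>. \<xi> i) = \<nu> i" using Suc by auto
  note \<pi>D = transport_plansD[OF Suc.prems[of N]]
  have cp: "continuous_map ?Y X (\<lambda>\<xi>. \<xi> i)" for i by (rule continuous_map_product_projection) simp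
  obtain R where R: "R \<in> radon_prob (prod_topology ?Y ?XX)"
    "distr R (borel_of ?Y) fst = P" "distr R (borel_of ?XX) snd = \<pi> N" "AE p in R. fst p N = fst (snd p)"
  proof (rule radon_prob_glue[OF hausX hY hausXX P \<pi>D(1) cp[of N] continuous_map_fst])
    show "distr P (borel_of X) (\<lambda>\<xi>. \<xi> N) = distr (\<pi> N) (borel_of X) fst" using P1[of N] \<pi>D(2) by simp
  qed simp_all
  let ?YZ = "prod_topology ?Y ?XX"
  note spR [simp] = radon_prob_D(2,3)[OF R(1)]
  \<comment> \<open>Position \<open>Suc N\<close> is overwritten with the second component of the
    new plan. Earlier consecutive pairs do not see this, and at \<open>N\<close> the gluing relation
    identifies the old coordinate with the first component, so the pair has law
    \<open>\<pi> N\<close>.\<close>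
  define J where "J p = (\<lambda>k. if k = Suc N then snd (snd p) else fst p k)" for p :: "(nat \<Rightarrow> 'a) \<times> 'a \<times> 'a"
  have c1: "continuous_map ?YZ X (\<lambda>p. fst p k)" for k
    using continuous_map_compose[OF continuous_map_fst[of ?Y ?XX] cp[of k]] by (simp add: o_def)
  have c2: "continuous_map ?YZ X (\<lambda>p. snd (snd p))"
    using continuous_map_compose[OF continuous_map_snd[of ?Y ?XX] continuous_map_snd] by (simp add: o_def)
  have cJ: "continuous_map ?YZ ?Y J"
    unfolding continuous_map_componentwise_UNIV J_def using c1 c2 by simp
  have mJ: "J \<in> measurable R (borel_of ?Y)" using continuous_map_measurable[OF cJ] by (simp cong: measurable_cong_sets)
  have m1: "fst \<in> measurable R (borel_of ?Y)" and m2: "snd \<in> measurable R (borel_of ?XX)"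
    using continuous_map_measurable[OF continuous_map_fst[of ?Y ?XX]] continuous_map_measurable[OF continuous_map_snd[of ?Y ?XX]]
    by (simp_all cong: measurable_cong_sets)
  have cpp: "continuous_map ?Y ?XX (\<lambda>\<xi>. (\<xi> i, \<xi> (Suc i)))" for i
    using cp[of i] cp[of "Suc i"] by (simp add: continuous_map_pairwise o_def)
  note mp = continuous_map_measurable[OF cp] and mpp = continuous_map_measurable[OF cpp]
  let ?P = "distr R (borel_of ?Y) J"
  have "distr ?P (borel_of ?XX) (\<lambda>\<xi>. (\<xi> i, \<xi> (Suc i))) = \<pi> i" if i: "i < Suc N" for i
  proof (cases "i = N")
    case False
    then have "(\<lambda>\<xi>. (\<xi> i, \<xi> (Suc i))) \<circ> J = (\<lambda>\<xi>. (\<xi> i, \<xi> (Suc i))) \<circ> fst" using i by (auto simp: J_def)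
    then show ?thesis using distr_distr[OF mpp mJ] distr_distr[OF mpp m1] R(2) P2[of i] False i by simp
  next
    case True
    have "distr ?P (borel_of ?XX) (\<lambda>\<xi>. (\<xi> i, \<xi> (Suc i))) = distr R (borel_of ?XX) ((\<lambda>\<xi>. (\<xi> i, \<xi> (Suc i))) \<circ> J)"
      by (rule distr_distr[OF mpp mJ])
    also have "\<dots> = distr R (borel_of ?XX) snd"
    proof (rule distr_cong_AE)
      show "AE p in R. ((\<lambda>\<xi>. (\<xi> i, \<xi> (Suc i))) \<circ> J) p = snd p"
        using R(4) by eventually_elim (auto simp: J_def True)
      show "(\<lambda>\<xi>. (\<xi> i, \<xi> (Suc i))) \<circ> J \<in> measurable R (borel_of ?XX)" by (rule measurable_comp[OF mJ mpp])
    qed (use m2 in auto)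
    finally show ?thesis using R(3) True by simp
  qed
  moreover have "distr ?P (borel_of X) (\<lambda>\<xi>. \<xi> i) = \<nu> i" if i: "i \<le> Suc N" for i
  proof (cases "i = Suc N")
    case False
    then have "(\<lambda>\<xi>. \<xi> i) \<circ> J = (\<lambda>\<xi>. \<xi> i) \<circ> fst" by (auto simp: J_def)
    then show ?thesis using distr_distr[OF mp mJ] distr_distr[OF mp m1] R(2) P1[of i] False i by simp
  next
    case True
    then have "(\<lambda>\<xi>. \<xi> i) \<circ> J = snd \<circ> snd" by (auto simp: J_def)
    then show ?thesis
      using distr_distr[OF mp mJ] distr_distr[OF continuous_map_measurable[OF continuous_map_snd[of X X]] m2] R(3) \<pi>D(3) True by simp
  qed
  ultimately show ?case using radon_prob_distr[OF hY R(1) cJ] by blast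
qed

end

section \<open>Dyadic times and laws of paths on them\<close>

definition dyads :: "real \<Rightarrow> real set" where
  "dyads T = {dyad T n i | n i. i \<le> 2 ^ n}"

lemma dyad_in_dyads: "i \<le> 2 ^ n \<Longrightarrow> dyad T n i \<in> dyads T"
  by (auto simp: dyads_def)

lemma countable_dyads: "countable (dyads T)"
proof -
  have "dyads T \<subseteq> (\<lambda>(n, i). dyad T n i) ` UNIV" by (auto simp: dyads_def)
  then show ?thesis by (rule countable_subset) simp
qed

lemma dyads_subset: "0 < T \<Longrightarrow> dyads T \<subseteq> {0..T}"
  using dyad_in by (auto simp: dyads_def)

lemma dyads_level:
  assumes "t \<in> dyads T" shows "\<exists>m. \<forall>n\<ge>m. \<exists>i\<le>2 ^ n. t = dyad T n i"
proof -
  obtain m j where mj: "t = dyad T m j" "j \<le> 2 ^ m" using assms by (auto simp: dyads_def)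
  have "\<exists>i\<le>2 ^ n. t = dyad T n i" if "n \<ge> m" for n
  proof (intro exI[of _ "j * 2 ^ (n - m)"] conjI)
    have "j * 2 ^ (n - m) \<le> 2 ^ m * 2 ^ (n - m)" using mj(2) by (rule mult_le_mono1)
    then show "j * 2 ^ (n - m) \<le> 2 ^ n" using that by (simp add: power_add[symmetric])
    show "t = dyad T n (j * 2 ^ (n - m))" using dyad_refine[of T m "n - m" j] that mj(1) by simp
  qed
  then show ?thesis by blast
qed

lemma dyads_on_grid:
  assumes T: "0 < T" and t: "t \<in> dyads T"
  shows "\<forall>\<^sub>F n in sequentially. dyad T n (dyad_index T n t) = t"
proof -
  obtain m where m: "\<And>n. n \<ge> m \<Longrightarrow> \<exists>i\<le>2 ^ n. t = dyad T n i" using dyads_level[OF t] by blast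
  have "dyad T n (dyad_index T n t) = t" if "n \<ge> m" for n
    using m[OF that] dyad_index_dyad[OF T] by auto
  then show ?thesis unfolding eventually_sequentially by blast
qed

context ext_metric_top
begin

abbreviation path_energy :: "real \<Rightarrow> nat \<Rightarrow> (real \<Rightarrow> 'a) \<Rightarrow> ennreal" where
  "path_energy T n \<eta> \<equiv> step_energy T (\<lambda>s t. d (\<eta> s) (\<eta> t)) n"

lemma semidistance_path:
  "(\<And>t. t \<in> I \<Longrightarrow> \<eta> t \<in> topspace X) \<Longrightarrow> semidistance_on I (\<lambda>s t. d (\<eta> s) (\<eta> t))"
  unfolding semidistance_on_def using d_self d_sym d_tri by blast

lemma lsc_path_dist:
  assumes "s \<in> I" "t \<in> I" shows "lsc_on (product_topology (\<lambda>_. X) I) (\<lambda>\<eta>. d (\<eta> s) (\<eta> t))"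
  using assms by (intro d_pair_measurable(1) continuous_map_product_projection)

text \<open>The index set is arbitrary because the energies are used both for paths on
  \<open>dyads T\<close> and for paths on \<open>{0..T}\<close>.\<close>

lemma lsc_path_energy:
  assumes T: "0 < T" and I: "dyads T \<subseteq> I"
  shows "lsc_on (product_topology (\<lambda>_. X) I) (path_energy T n)"
  unfolding step_energy_def
proof (intro lsc_on_sum lsc_on_divide_const lsc_on_power2 lsc_path_dist)
  fix i :: nat assume "i \<in> {..<2 ^ n}"
  then show "dyad T n i \<in> I" "dyad T n (Suc i) \<in> I" using I dyad_in_dyads[of i n T] dyad_in_dyads[of "Suc i" n T] by auto
qed (use T in auto)

lemma path_energy_mono:
  assumes T: "0 < T" and \<eta>: "\<And>t. t \<in> dyads T \<Longrightarrow> \<eta> t \<in> topspace X" and nm: "n \<le> m"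
  shows "path_energy T n \<eta> \<le> path_energy T m \<eta>"
  by (rule step_energy_mono[OF T semidistance_path[OF \<eta>] dyad_in_dyads nm])

text \<open>At times off the grid of level \<open>n\<close> the approximating path sits at an arbitrary fixed point,
  which keeps all one-time marginals uniformly tight.\<close>
lemma dyadic_law_approx:
  assumes T: "0 < T" and \<mu>: "\<And>t. t \<in> {0..T} \<Longrightarrow> \<mu> t \<in> radon_prob X"
    and E: "step_energy T (\<lambda>s t. wasserstein X d (\<mu> s) (\<mu> t)) n \<le> C" and C: "C < top"
    and x0: "x0 \<in> topspace X"
  shows "\<exists>Q\<in>radon_prob (product_topology (\<lambda>_. X) (dyads T)).
    (\<forall>t\<in>dyads T. dyad T n (dyad_index T n t) = t \<longrightarrow> distr Q (borel_of X) (\<lambda>\<eta>. \<eta> t) = \<mu> t) \<and>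
    (\<forall>t\<in>dyads T. dyad T n (dyad_index T n t) \<noteq> t \<longrightarrow> (\<forall>K. compactin X K \<and> x0 \<in> K \<longrightarrow>
        measure (distr Q (borel_of X) (\<lambda>\<eta>. \<eta> t)) K = 1)) \<and>
    (\<integral>\<^sup>+\<eta>. path_energy T n \<eta> \<partial>Q) \<le> C + ennreal (1 / 2 ^ n)"
proof -
  let ?D = "dyads T" and ?XX = "prod_topology X X" and ?h = "T / 2 ^ n"
  let ?Y = "product_topology (\<lambda>_. X) (UNIV :: nat set)" and ?Z = "product_topology (\<lambda>_. X) (dyads T)"
  have h: "0 < ?h" using T by simp
  have hZ: "Hausdorff_space ?Z" using hausX by (simp add: Hausdorff_space_product_topology)
  \<comment> \<open>The minimum freezes the sequence after the last grid time, so that every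
    \<open>\<nu> i\<close> is a Radon probability measure, as \<open>plan_chain\<close>
    demands.\<close>
  define \<nu> where "\<nu> i = \<mu> (dyad T n (min i (2 ^ n)))" for i
  have \<nu>: "\<nu> i \<in> radon_prob X" for i unfolding \<nu>_def by (intro \<mu> dyad_in T) simp
  let ?W = "\<lambda>i. wasserstein X d (\<nu> i) (\<nu> (Suc i))"
  have W_fin: "?W i < top" if i: "i < 2 ^ n" for i
  proof -
    have "(wasserstein X d (\<mu> (dyad T n i)) (\<mu> (dyad T n (Suc i))))\<^sup>2 / ennreal ?h
        \<le> step_energy T (\<lambda>s t. wasserstein X d (\<mu> s) (\<mu> t)) n"
      unfolding step_energy_def using i by (intro sum_nonneg_leq_bound[OF _ _ refl]) auto
    also have "\<dots> < top" using E C by (rule le_less_trans)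
    finally show ?thesis using i
      by (cases "?W i") (auto simp: ennreal_top_divide \<nu>_def min_absorb1)
  qed
  have "\<exists>\<pi>. \<pi> \<in> transport_plans X (\<nu> i) (\<nu> (Suc i)) \<and> cost \<pi> \<le> (?W i)\<^sup>2 + ennreal (?h / 4 ^ n)" if "i < 2 ^ n" for i
    using wasserstein_approx[OF W_fin[OF that], of "?h / 4 ^ n"] h by (metis divide_pos_pos zero_less_numeral zero_less_power)
  then obtain \<pi> where \<pi>: "\<And>i. i < 2 ^ n \<Longrightarrow> \<pi> i \<in> transport_plans X (\<nu> i) (\<nu> (Suc i))"
    and \<pi>c: "\<And>i. i < 2 ^ n \<Longrightarrow> cost (\<pi> i) \<le> (?W i)\<^sup>2 + ennreal (?h / 4 ^ n)" by metis
  obtain P where P: "P \<in> radon_prob ?Y"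
    and P2: "\<And>i. i < 2 ^ n \<Longrightarrow> distr P (borel_of ?XX) (\<lambda>\<xi>. (\<xi> i, \<xi> (Suc i))) = \<pi> i"
    and P1: "\<And>i. i \<le> 2 ^ n \<Longrightarrow> distr P (borel_of X) (\<lambda>\<xi>. \<xi> i) = \<nu> i"
    using plan_chain[where \<nu> = \<nu> and N = "2 ^ n" and \<pi> = \<pi>, OF \<nu> \<pi>] by auto
  interpret P: prob_space P using radon_prob_D[OF P] by simp
  note spP [simp] = radon_prob_D(2,3)[OF P]
  let ?on = "\<lambda>t. dyad T n (dyad_index T n t) = t"
  define J where "J \<xi> = (\<lambda>t\<in>?D. if ?on t then \<xi> (dyad_index T n t) else x0)" for \<xi> :: "nat \<Rightarrow> 'a"
  have cp: "continuous_map ?Y X (\<lambda>\<xi>. \<xi> i)" for i by (rule continuous_map_product_projection) simp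
  have cJ: "continuous_map ?Y ?Z J"
    unfolding continuous_map_componentwise
  proof (intro conjI ballI)
    show "J ` topspace ?Y \<subseteq> extensional ?D" by (auto simp: J_def)
    fix t assume t: "t \<in> ?D"
    show "continuous_map ?Y X (\<lambda>\<xi>. J \<xi> t)"
      using t cp x0 by (cases "?on t") (simp_all add: J_def)
  qed
  have mJ: "J \<in> measurable P (borel_of ?Z)" using continuous_map_measurable[OF cJ] by (simp cong: measurable_cong_sets)
  let ?Q = "distr P (borel_of ?Z) J"
  have mt: "(\<lambda>\<eta>. \<eta> t) \<in> measurable (borel_of ?Z) (borel_of X)" if "t \<in> ?D" for t
    by (rule continuous_map_measurable[OF continuous_map_product_projection[OF that]])
  have Qt: "distr ?Q (borel_of X) (\<lambda>\<eta>. \<eta> t) = distr P (borel_of X) (\<lambda>\<xi>. J \<xi> t)" if "t \<in> ?D" for t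
    using distr_distr[OF mt[OF that] mJ] by (simp add: o_def)
  have "distr ?Q (borel_of X) (\<lambda>\<eta>. \<eta> t) = \<mu> t" if t: "t \<in> ?D" "?on t" for t
  proof -
    have "t \<in> {0..T}" using t dyads_subset[OF T] by auto
    then have le: "dyad_index T n t \<le> 2 ^ n" using dyad_index_le[OF T, of t n] by simp
    have "(\<lambda>\<xi>. J \<xi> t) = (\<lambda>\<xi>. \<xi> (dyad_index T n t))" using t by (simp add: J_def)
    then show ?thesis using Qt[OF t(1)] P1[OF le] t(2) le by (simp add: \<nu>_def min_absorb1)
  qed
  moreover have "measure (distr ?Q (borel_of X) (\<lambda>\<eta>. \<eta> t)) K = 1"
    if t: "t \<in> ?D" "\<not> ?on t" and K: "compactin X K" "x0 \<in> K" for t K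
  proof -
    have "(\<lambda>\<xi>. J \<xi> t) = (\<lambda>\<xi>. x0)" using t by (simp add: J_def)
    then have "distr ?Q (borel_of X) (\<lambda>\<eta>. \<eta> t) = return (borel_of X) x0"
      using Qt[OF t(1)] x0 by simp
    then show ?thesis using borel_of_compact[OF hausX K(1)] K(2) by (simp add: measure_return)
  qed
  moreover have "(\<integral>\<^sup>+\<eta>. path_energy T n \<eta> \<partial>?Q) \<le> C + ennreal (1 / 2 ^ n)"
  proof -
    have Ji: "J \<xi> (dyad T n i) = \<xi> i" if "i \<le> 2 ^ n" for \<xi> i
      using dyad_in_dyads[OF that, of T] dyad_index_dyad[OF T, of n i] by (simp add: J_def)
    have "(\<integral>\<^sup>+\<eta>. path_energy T n \<eta> \<partial>?Q) = (\<integral>\<^sup>+\<xi>. path_energy T n (J \<xi>) \<partial>P)"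
      using lsc_on_measurable[OF lsc_path_energy[OF T order_refl]] mJ by (intro nn_integral_distr) auto
    also have "\<dots> = (\<integral>\<^sup>+\<xi>. (\<Sum>i<2 ^ n. (d (\<xi> i) (\<xi> (Suc i)))\<^sup>2 / ennreal ?h) \<partial>P)"
      unfolding step_energy_def by (intro nn_integral_cong sum.cong) (auto simp: Ji)
    also have "\<dots> = (\<Sum>i<2 ^ n. \<integral>\<^sup>+\<xi>. (d (\<xi> i) (\<xi> (Suc i)))\<^sup>2 / ennreal ?h \<partial>P)"
    proof (rule nn_integral_sum)
      fix i
      have "(\<lambda>\<xi>. d (\<xi> i) (\<xi> (Suc i))) \<in> borel_measurable P"
        using d_pair_measurable(2)[OF cp[of i] cp[of "Suc i"]] by (simp cong: measurable_cong_sets)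
      then show "(\<lambda>\<xi>. (d (\<xi> i) (\<xi> (Suc i)))\<^sup>2 / ennreal ?h) \<in> borel_measurable P" by measurable
    qed
    also have "\<dots> = (\<Sum>i<2 ^ n. cost (\<pi> i) / ennreal ?h)"
    proof (rule sum.cong[OF refl])
      fix i :: nat assume "i \<in> {..<2 ^ n}"
      then have i: "i < 2 ^ n" by simp
      have m: "(\<lambda>\<xi>. d (\<xi> i) (\<xi> (Suc i))) \<in> borel_measurable P"
        using d_pair_measurable(2)[OF cp[of i] cp[of "Suc i"]] by (simp cong: measurable_cong_sets)
      have cpp: "continuous_map ?Y ?XX (\<lambda>\<xi>. (\<xi> i, \<xi> (Suc i)))"
        using cp[of i] cp[of "Suc i"] by (simp add: continuous_map_pairwise o_def)
      have mpp: "(\<lambda>\<xi>. (\<xi> i, \<xi> (Suc i))) \<in> measurable P (borel_of ?XX)"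
        using continuous_map_measurable[OF cpp] by (simp cong: measurable_cong_sets)
      have "cost (\<pi> i) = (\<integral>\<^sup>+\<xi>. (d (\<xi> i) (\<xi> (Suc i)))\<^sup>2 \<partial>P)"
        unfolding cost_def P2[OF i, symmetric] using lsc_on_measurable[OF lsc_on_power2[OF lsc_d]] mpp
        by (subst nn_integral_distr) auto
      then show "(\<integral>\<^sup>+\<xi>. (d (\<xi> i) (\<xi> (Suc i)))\<^sup>2 / ennreal ?h \<partial>P) = cost (\<pi> i) / ennreal ?h"
        using m by (simp add: nn_integral_divide)
    qed
    also have "\<dots> \<le> (\<Sum>i<2 ^ n. (?W i)\<^sup>2 / ennreal ?h + ennreal (1 / 4 ^ n))"
    proof (rule sum_mono)
      fix i :: nat assume "i \<in> {..<2 ^ n}"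
      then have "cost (\<pi> i) / ennreal ?h \<le> ((?W i)\<^sup>2 + ennreal (?h / 4 ^ n)) / ennreal ?h"
        by (intro divide_right_mono_ennreal \<pi>c) simp
      also have "\<dots> = (?W i)\<^sup>2 / ennreal ?h + ennreal (1 / 4 ^ n)"
      proof -
        have "ennreal (?h / 4 ^ n) / ennreal ?h = ennreal (?h / 4 ^ n / ?h)" using h T by (intro divide_ennreal divide_nonneg_nonneg) auto
        also have "?h / 4 ^ n / ?h = 1 / 4 ^ n" using T by simp
        finally show ?thesis by (simp add: add_divide_distrib_ennreal)
      qed
      finally show "cost (\<pi> i) / ennreal ?h \<le> (?W i)\<^sup>2 / ennreal ?h + ennreal (1 / 4 ^ n)" .
    qed
    also have "\<dots> = (\<Sum>i<2 ^ n. (?W i)\<^sup>2 / ennreal ?h) + (\<Sum>i<(2::nat) ^ n. ennreal (1 / 4 ^ n))" by (rule sum.distrib)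
    also have "(\<Sum>i<2 ^ n. (?W i)\<^sup>2 / ennreal ?h) = step_energy T (\<lambda>s t. wasserstein X d (\<mu> s) (\<mu> t)) n"
      unfolding step_energy_def by (intro sum.cong) (auto simp: \<nu>_def min_absorb1)
    also have "(\<Sum>i<(2::nat) ^ n. ennreal (1 / 4 ^ n)) = ennreal (\<Sum>i<(2::nat) ^ n. 1 / 4 ^ n)" by (rule sum_ennreal) simp
    also have "(\<Sum>i<(2::nat) ^ n. 1 / 4 ^ n :: real) = 1 / 2 ^ n"
      by (simp add: power_mult_distrib[symmetric] field_simps)
    finally show ?thesis using E by (meson add_right_mono order_trans)
  qed
  ultimately show ?thesis using radon_prob_distr[OF hZ P cJ] by (intro bexI[of _ ?Q]) auto
qed

lemma dyadic_law:
  assumes T: "0 < T" and \<mu>: "\<And>t. t \<in> {0..T} \<Longrightarrow> \<mu> t \<in> radon_prob X"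
    and E: "\<And>n. step_energy T (\<lambda>s t. wasserstein X d (\<mu> s) (\<mu> t)) n \<le> C" and C: "C < top"
  obtains P where "P \<in> radon_prob (product_topology (\<lambda>_. X) (dyads T))"
    "\<And>t. t \<in> dyads T \<Longrightarrow> distr P (borel_of X) (\<lambda>\<eta>. \<eta> t) = \<mu> t"
    "\<And>n. (\<integral>\<^sup>+\<eta>. path_energy T n \<eta> \<partial>P) \<le> C"
proof -
  let ?D = "dyads T" and ?Z = "product_topology (\<lambda>_. X) (dyads T)"
  let ?on = "\<lambda>n t. dyad T n (dyad_index T n t) = t"
  have hZ: "Hausdorff_space ?Z" using hausX by (simp add: Hausdorff_space_product_topology)
  have "\<mu> 0 \<in> radon_prob X" using \<mu>[of 0] T by simp
  then have "topspace X \<noteq> {}" using prob_space.not_empty[of "\<mu> 0"] radon_prob_D[of "\<mu> 0" X] by simp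
  then obtain x0 where x0: "x0 \<in> topspace X" by blast
  define ok where "ok n Q \<longleftrightarrow> Q \<in> radon_prob ?Z \<and>
    (\<forall>t\<in>?D. ?on n t \<longrightarrow> distr Q (borel_of X) (\<lambda>\<eta>. \<eta> t) = \<mu> t) \<and>
    (\<forall>t\<in>?D. \<not> ?on n t \<longrightarrow> (\<forall>K. compactin X K \<and> x0 \<in> K \<longrightarrow> measure (distr Q (borel_of X) (\<lambda>\<eta>. \<eta> t)) K = 1)) \<and>
    (\<integral>\<^sup>+\<eta>. path_energy T n \<eta> \<partial>Q) \<le> C + ennreal (1 / 2 ^ n)" for n Q
  have "\<exists>Q. ok n Q" for n
    using dyadic_law_approx[OF T \<mu> E C x0, where n = n] unfolding ok_def by blast
  then obtain Q where ok: "\<And>n. ok n (Q n)" by metis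
  have Q: "Q n \<in> radon_prob ?Z" for n using ok[of n] unfolding ok_def by blast
  have Q_on: "distr (Q n) (borel_of X) (\<lambda>\<eta>. \<eta> t) = \<mu> t" if "t \<in> ?D" "?on n t" for n t
    using ok[of n] that unfolding ok_def by blast
  have Q_off: "measure (distr (Q n) (borel_of X) (\<lambda>\<eta>. \<eta> t)) K = 1"
    if "t \<in> ?D" "\<not> ?on n t" "compactin X K" "x0 \<in> K" for n t K
    using ok[of n] that unfolding ok_def by blast
  have QE: "(\<integral>\<^sup>+\<eta>. path_energy T n \<eta> \<partial>Q n) \<le> C + ennreal (1 / 2 ^ n)" for n
    using ok[of n] unfolding ok_def by blast
  have tight: "\<exists>K. compactin ?Z K \<and> (\<forall>n. 1 - e \<le> measure (Q n) K)" if e: "0 < e" for e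
  proof (rule product_tight[OF hausX countable_dyads Q _ e])
    fix t and e :: real assume t: "t \<in> ?D" and e: "0 < e"
    have \<mu>t: "\<mu> t \<in> radon_prob X" using t dyads_subset[OF T] \<mu> by auto
    interpret \<mu>t: prob_space "\<mu> t" using radon_prob_D[OF \<mu>t] by simp
    obtain K0 where K0: "compactin X K0" "1 - e \<le> measure (\<mu> t) K0" by (rule radon_prob_tight[OF \<mu>t e])
    \<comment> \<open>Adding \<open>x0\<close> makes one compact set serve all levels: those where
      \<open>t\<close> is a grid time and the law is \<open>\<mu> t\<close>, and those where the
      path sits at \<open>x0\<close>.\<close>
    have cK: "compactin X (insert x0 K0)" using K0(1) x0 compactin_Un[of X "{x0}" K0] by simp
    have "measure (\<mu> t) K0 \<le> measure (\<mu> t) (insert x0 K0)"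
      using borel_of_compact[OF hausX cK] radon_prob_D[OF \<mu>t] by (intro \<mu>t.finite_measure_mono) auto
    then have "1 - e \<le> measure (distr (Q n) (borel_of X) (\<lambda>\<eta>. \<eta> t)) (insert x0 K0)" for n
      using Q_on[OF t, of n] Q_off[OF t _ cK, of n] K0(2) e by (cases "?on n t") auto
    then show "\<exists>K. compactin X K \<and> (\<forall>n. 1 - e \<le> measure (distr (Q n) (borel_of X) (\<lambda>\<eta>. \<eta> t)) K)"
      using cK by blast
  qed
  obtain P where P: "P \<in> radon_prob ?Z"
    and lim: "\<And>\<phi> C. lsc_on ?Z \<phi> \<Longrightarrow> \<forall>\<^sub>F n in sequentially. (\<integral>\<^sup>+x. \<phi> x \<partial>Q n) \<le> C \<Longrightarrow> (\<integral>\<^sup>+x. \<phi> x \<partial>P) \<le> C"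
    using radon_seq_limit[OF hZ, of Q] Q tight by blast
  have P1: "distr P (borel_of X) (\<lambda>\<eta>. \<eta> t) = \<mu> t" if t: "t \<in> ?D" for t
  proof (rule radon_limit_marginal[OF Q P lim hausX continuous_map_product_projection[OF t]])
    show "\<mu> t \<in> radon_prob X" using t dyads_subset[OF T] \<mu> by auto
    show "\<forall>\<^sub>F n in sequentially. distr (Q n) (borel_of X) (\<lambda>\<eta>. \<eta> t) = \<mu> t"
      using dyads_on_grid[OF T t] by eventually_elim (rule Q_on[OF t])
  qed
  have P2: "(\<integral>\<^sup>+\<eta>. path_energy T k \<eta> \<partial>P) \<le> C" for k
  proof (rule ennreal_le_epsilon)
    fix e :: real assume e: "0 < e"
    have "\<forall>\<^sub>F n in sequentially. 1 / 2 ^ n < e" using step_width_tendsto[of 1] e by (rule order_tendstoD(2))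
    then have "\<forall>\<^sub>F n in sequentially. (\<integral>\<^sup>+\<eta>. path_energy T k \<eta> \<partial>Q n) \<le> C + ennreal e"
      using eventually_ge_at_top[of k]
    proof eventually_elim
      case (elim n)
      \<comment> \<open>Refinement only increases the energy, so the bound at level
        \<open>n\<close>, whose error vanishes, also bounds the fixed functional of level
        \<open>k\<close>, to which lower semicontinuity applies.\<close>
      have "(\<integral>\<^sup>+\<eta>. path_energy T k \<eta> \<partial>Q n) \<le> (\<integral>\<^sup>+\<eta>. path_energy T n \<eta> \<partial>Q n)"
        using radon_prob_D[OF Q] elim by (intro nn_integral_mono path_energy_mono[OF T]) auto
      also have "\<dots> \<le> C + ennreal (1 / 2 ^ n)" by (rule QE)
      also have "\<dots> \<le> C + ennreal e" using elim by (intro add_left_mono ennreal_leI) simp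
      finally show ?case .
    qed
    then show "(\<integral>\<^sup>+\<eta>. path_energy T k \<eta> \<partial>P) \<le> C + ennreal e"
      by (rule lim[OF lsc_path_energy[OF T order_refl]])
  qed
  show thesis by (rule that[OF P P1 P2])
qed

section \<open>Extension of dyadic paths and of their laws to the whole interval\<close>

lemma Lip_b_topology:
  obtains \<S> where "X = topology_generated_by \<S>"
    "\<And>U. U \<in> \<S> \<Longrightarrow> \<exists>f V. f \<in> Lip_b X d \<and> open V \<and> U = {x \<in> topspace X. f x \<in> V}"
  using emt unfolding extended_metric_topological_space_def by blast

text \<open>Lipschitz functions turn uniform \<open>d\<close>-convergence into uniform convergence, so that a
  \<open>d\<close>-uniform limit of continuous maps is continuous although \<open>d\<close> does not metrize the topology.\<close>
lemma continuous_map_uniform_dist_limit: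
  assumes f: "\<And>n::nat. continuous_map Y X (f n)" and g: "\<And>y. y \<in> topspace Y \<Longrightarrow> g y \<in> topspace X"
    and b: "\<And>n y. y \<in> topspace Y \<Longrightarrow> d (f n y) (g y) \<le> ennreal (r n)" and r: "r \<longlonglongrightarrow> 0" "\<And>n. 0 \<le> r n"
  shows "continuous_map Y X g"
proof -
  obtain \<S> where S: "X = topology_generated_by \<S>"
    "\<And>U. U \<in> \<S> \<Longrightarrow> \<exists>f V. f \<in> Lip_b X d \<and> open V \<and> U = {x \<in> topspace X. f x \<in> V}"
    by (rule Lip_b_topology, rule that)
  have "continuous_map Y (topology_generated_by \<S>) g"
  proof (rule continuous_on_generated_topo)
    fix U assume "U \<in> \<S>"
    then obtain \<phi> V where \<phi>: "\<phi> \<in> Lip_b X d" "open V" "U = {x \<in> topspace X. \<phi> x \<in> V}" using S(2) by blast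
    obtain L where L: "0 \<le> L" "\<And>x y. x \<in> topspace X \<Longrightarrow> y \<in> topspace X \<Longrightarrow> ennreal \<bar>\<phi> x - \<phi> y\<bar> \<le> ennreal L * d x y"
      and c\<phi>: "continuous_map X euclideanreal \<phi>" using \<phi>(1) unfolding Lip_b_def by blast
    have fX: "f n y \<in> topspace X" if "y \<in> topspace Y" for n y
      using f[of n] that by (auto simp: continuous_map_def)
    have cg: "continuous_map Y Met_TC.mtopology (\<lambda>y. \<phi> (g y))"
    proof (rule Met_TC.continuous_map_uniform_limit[where f = "\<lambda>n y. \<phi> (f n y)" and F = sequentially])
      show "\<forall>\<^sub>F n in sequentially. continuous_map Y Met_TC.mtopology (\<lambda>y. \<phi> (f n y))"
        using continuous_map_compose[OF f c\<phi>] by (simp add: o_def)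
      fix e :: real assume e: "0 < e"
      have "(\<lambda>n. L * r n) \<longlonglongrightarrow> L * 0" by (intro tendsto_intros r)
      then have "\<forall>\<^sub>F n in sequentially. L * r n < e" using e by (intro order_tendstoD(2)) auto
      then show "\<forall>\<^sub>F n in sequentially. \<forall>y\<in>topspace Y. \<phi> (g y) \<in> UNIV \<and> dist (\<phi> (f n y)) (\<phi> (g y)) < e"
      proof eventually_elim
        case (elim n)
        have "dist (\<phi> (f n y)) (\<phi> (g y)) < e" if y: "y \<in> topspace Y" for y
        proof -
          have "ennreal \<bar>\<phi> (f n y) - \<phi> (g y)\<bar> \<le> ennreal L * d (f n y) (g y)" by (intro L fX g y)
          also have "\<dots> \<le> ennreal L * ennreal (r n)" by (intro mult_left_mono b y) simp
          also have "\<dots> = ennreal (L * r n)" using L r by (simp add: ennreal_mult)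
          finally have "\<bar>\<phi> (f n y) - \<phi> (g y)\<bar> \<le> L * r n" using L r by (subst (asm) ennreal_le_iff) auto
          then show ?thesis using elim by (simp add: dist_real_def)
        qed
        then show ?case by simp
      qed
    qed simp
    have "openin Y {y \<in> topspace Y. \<phi> (g y) \<in> V}"
      using cg \<phi>(2) openin_continuous_map_preimage[of Y euclideanreal "\<lambda>y. \<phi> (g y)" V] by simp
    moreover have "g -` U \<inter> topspace Y = {y \<in> topspace Y. \<phi> (g y) \<in> V}" using \<phi>(3) g by auto
    ultimately show "openin Y (g -` U \<inter> topspace Y)" by simp
  next
    have "topspace X = \<Union>\<S>" using S(1) topology_generated_by_topspace by metis
    then show "g ` topspace Y \<subseteq> \<Union>\<S>" using g by auto
  qed
  then show ?thesis using S(1) by metis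
qed

text \<open>Each of these sets is closed, being cut out by lower semicontinuous functions, and its
  paths share one Hoelder constant. Natural bounds \<open>c\<close> give countably many sets, whose
  union has full measure under a law with finite mean energy.\<close>

definition bounded_energy :: "real \<Rightarrow> nat \<Rightarrow> (real \<Rightarrow> 'a) set" where
  "bounded_energy T c = {\<eta> \<in> topspace (product_topology (\<lambda>_. X) (dyads T)). \<forall>n. path_energy T n \<eta> \<le> of_nat c}"

lemma bounded_energy_hoelder:
  assumes T: "0 < T" and \<eta>: "\<eta> \<in> bounded_energy T c" and st: "s \<in> dyads T" "t \<in> dyads T"
  shows "(d (\<eta> s) (\<eta> t))\<^sup>2 \<le> ennreal (real c * \<bar>t - s\<bar>)"
proof -
  have \<eta>X: "\<eta> t \<in> topspace X" if "t \<in> dyads T" for t using \<eta> that by (auto simp: bounded_energy_def PiE_iff)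
  have *: "(d (\<eta> s) (\<eta> t))\<^sup>2 \<le> ennreal (real c * \<bar>t - s\<bar>)" if st: "s \<in> dyads T" "t \<in> dyads T" "s \<le> t" for s t
  proof -
    obtain m1 where m1: "\<And>n. n \<ge> m1 \<Longrightarrow> \<exists>i\<le>2 ^ n. s = dyad T n i" using dyads_level[OF st(1)] by blast
    obtain m2 where m2: "\<And>n. n \<ge> m2 \<Longrightarrow> \<exists>i\<le>2 ^ n. t = dyad T n i" using dyads_level[OF st(2)] by blast
    define n where "n = max m1 m2"
    obtain i j where ij: "s = dyad T n i" "t = dyad T n j" "j \<le> 2 ^ n" using m1[of n] m2[of n] by (auto simp: n_def)
    have "i \<le> j" using st(3) ij dyad_le_iff[OF T] by simp
    have "semidistance_on (dyads T) (\<lambda>s t. d (\<eta> s) (\<eta> t))" by (rule semidistance_path) (rule \<eta>X)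
    from step_energy_hoelder[OF T this dyad_in_dyads \<open>i \<le> j\<close> ij(3)]
    have "(d (\<eta> s) (\<eta> t))\<^sup>2 \<le> ennreal (t - s) * path_energy T n \<eta>" by (simp add: ij(1,2))
    also have "\<dots> \<le> ennreal (t - s) * of_nat c" using \<eta> by (intro mult_left_mono) (auto simp: bounded_energy_def)
    also have "\<dots> = ennreal (real c * \<bar>t - s\<bar>)"
      using st(3) by (simp add: ennreal_of_nat_eq_real_of_nat ennreal_mult[symmetric] mult.commute)
    finally show ?thesis .
  qed
  show ?thesis
    using *[OF st] *[OF st(2,1)] d_sym[OF \<eta>X[OF st(1)] \<eta>X[OF st(2)]] by (cases "s \<le> t") (auto simp: abs_minus_commute)
qed

text \<open>Completeness supplies limits along dyadic approximations of \<open>t\<close>. On a set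
  of bounded energy they are uniform in the path, which makes the extension continuous there, for
  the product topologies of \<open>X\<close> and not only for \<open>d\<close>.\<close>

lemma dyadic_extension:
  assumes compl: "extended_complete_on (topspace X) d" and T: "0 < T" and x0: "x0 \<in> topspace X"
  obtains Ext where
    "Ext \<in> measurable (borel_of (product_topology (\<lambda>_. X) (dyads T))) (borel_of (path_space T X))"
    "\<And>c. continuous_map (subtopology (product_topology (\<lambda>_. X) (dyads T)) (bounded_energy T c)) (path_space T X) Ext"
    "\<And>c \<eta> t. \<eta> \<in> bounded_energy T c \<Longrightarrow> t \<in> dyads T \<Longrightarrow> Ext \<eta> t = \<eta> t"
    "\<And>c \<eta> s t. \<eta> \<in> bounded_energy T c \<Longrightarrow> s \<in> {0..T} \<Longrightarrow> t \<in> {0..T} \<Longrightarrow>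
       (d (Ext \<eta> s) (Ext \<eta> t))\<^sup>2 \<le> ennreal (real c * \<bar>t - s\<bar>)"
proof -
  let ?D = "dyads T" and ?Z = "product_topology (\<lambda>_. X) (dyads T)" and ?S = "bounded_energy T"
  define a where "a n t = dyad T n (dyad_index T n t)" for n t
  have aD: "a n t \<in> ?D" if "t \<in> {0..T}" for n t
    unfolding a_def using dyad_index_le[OF T, of t n] that by (intro dyad_in_dyads) simp
  have D01: "?D \<subseteq> {0..T}" by (rule dyads_subset[OF T])
  have a_le: "a n t \<le> t" "t < a n t + T / 2 ^ n" if "t \<in> {0..T}" for n t
    using dyad_index_bounds[OF T, of t n] that by (auto simp: a_def dyad_Suc)
  have a_lim: "(\<lambda>n. a n t) \<longlonglongrightarrow> t" if "t \<in> {0..T}" for t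
    unfolding a_def using dyad_index_tendsto[OF T, of t] that by simp
  define good where "good \<eta> t x \<longleftrightarrow> x \<in> topspace X \<and> (\<lambda>n. d (\<eta> (a n t)) x) \<longlonglongrightarrow> 0" for \<eta> t x
  \<comment> \<open>At dyadic times the given value is kept, so agreement with the path holds
    without appeal to uniqueness of limits.\<close>
  define ext where "ext \<eta> t = (if t \<in> ?D then \<eta> t else SOME x. good \<eta> t x)" for \<eta> t
  \<comment> \<open>Paths of unbounded energy are sent to one constant path; this keeps the map
    measurable and its values in the path space.\<close>
  define Ext where "Ext \<eta> = (if \<eta> \<in> (\<Union>c. ?S c) then restrict (ext \<eta>) {0..T} else restrict (\<lambda>_. x0) {0..T})" for \<eta>
  have \<eta>X: "\<eta> t \<in> topspace X" if "\<eta> \<in> ?S c" "t \<in> ?D" for \<eta> c t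
    using that by (auto simp: bounded_energy_def PiE_iff)
  have good_ext: "good \<eta> t (ext \<eta> t)" if \<eta>: "\<eta> \<in> ?S c" and t: "t \<in> {0..T}" for \<eta> c t
  proof (cases "t \<in> ?D")
    case True
    have "\<forall>\<^sub>F n in sequentially. d (\<eta> (a n t)) (\<eta> t) = 0"
      using dyads_on_grid[OF T True] by eventually_elim (simp add: a_def d_self[OF \<eta>X[OF \<eta> True]])
    then show ?thesis using True \<eta>X[OF \<eta> True] by (simp add: ext_def good_def tendsto_eventually)
  next
    case False
    \<comment> \<open>Approximants of level at least \<open>N\<close> lie in a window of length
      \<open>T / 2 ^ N\<close> to the left of \<open>t\<close>, and the Hoelder bound controls the
      distance of their values.\<close>
    have cauchy: "\<exists>N. \<forall>m\<ge>N. \<forall>n\<ge>N. d (\<eta> (a m t)) (\<eta> (a n t)) < \<epsilon>" if \<epsilon>: "0 < \<epsilon>" for \<epsilon> :: ennreal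
    proof -
      have "(\<lambda>n. ennreal (real c * (T / 2 ^ n))) \<longlonglongrightarrow> ennreal (real c * 0)"
        by (intro tendsto_intros step_width_tendsto)
      moreover have "0 < \<epsilon>\<^sup>2" using \<epsilon> by (simp add: zero_less_iff_neq_zero)
      ultimately have "\<forall>\<^sub>F n in sequentially. ennreal (real c * (T / 2 ^ n)) < \<epsilon>\<^sup>2" by (intro order_tendstoD(2)) auto
      then obtain N where N: "ennreal (real c * (T / 2 ^ N)) < \<epsilon>\<^sup>2" by (auto simp: eventually_sequentially)
      have near: "t - T / 2 ^ N \<le> a n t" if "n \<ge> N" for n
      proof -
        have "T / 2 ^ n \<le> T / 2 ^ N" using that T by (intro divide_left_mono) auto
        then show ?thesis using a_le(2)[OF t, of n] by simp
      qed
      have "d (\<eta> (a m t)) (\<eta> (a n t)) < \<epsilon>" if "m \<ge> N" "n \<ge> N" for m n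
      proof -
        have "(d (\<eta> (a m t)) (\<eta> (a n t)))\<^sup>2 \<le> ennreal (real c * \<bar>a n t - a m t\<bar>)"
          by (rule bounded_energy_hoelder[OF T \<eta> aD[OF t] aD[OF t]])
        also have "\<dots> \<le> ennreal (real c * (T / 2 ^ N))"
          using near[OF that(1)] near[OF that(2)] a_le(1)[OF t, of m] a_le(1)[OF t, of n]
          by (intro ennreal_leI mult_left_mono) auto
        also have "\<dots> < \<epsilon>\<^sup>2" by (rule N)
        finally show ?thesis by (simp only: ennreal_power2_less_iff)
      qed
      then show ?thesis by blast
    qed
    have "range (\<lambda>n. \<eta> (a n t)) \<subseteq> topspace X" using \<eta>X[OF \<eta> aD[OF t]] by auto
    then obtain x where "good \<eta> t x"
      using compl cauchy unfolding extended_complete_on_def good_def by blast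
    then show ?thesis using False by (simp add: ext_def someI)
  qed
  have extX: "ext \<eta> t \<in> topspace X" if "\<eta> \<in> ?S c" "t \<in> {0..T}" for \<eta> c t
    using good_ext[OF that] by (simp add: good_def)
  have ext_H: "d (ext \<eta> s) (ext \<eta> t) \<le> ennreal (sqrt (real c * \<bar>t - s\<bar>))"
    if \<eta>: "\<eta> \<in> ?S c" and s: "s \<in> {0..T}" and t: "t \<in> {0..T}" for \<eta> c s t
  proof -
    have "(\<lambda>n. d (\<eta> (a n s)) (ext \<eta> s) + ennreal (sqrt (real c * \<bar>a n t - a n s\<bar>)) + d (\<eta> (a n t)) (ext \<eta> t))
        \<longlonglongrightarrow> 0 + ennreal (sqrt (real c * \<bar>t - s\<bar>)) + 0"
      using good_ext[OF \<eta> s] good_ext[OF \<eta> t] by (intro tendsto_intros a_lim s t) (simp_all add: good_def)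
    then have lim: "(\<lambda>n. d (\<eta> (a n s)) (ext \<eta> s) + ennreal (sqrt (real c * \<bar>a n t - a n s\<bar>)) + d (\<eta> (a n t)) (ext \<eta> t))
        \<longlonglongrightarrow> ennreal (sqrt (real c * \<bar>t - s\<bar>))" by simp
    show ?thesis
    proof (rule tendsto_lowerbound[OF lim _ sequentially_bot], intro always_eventually allI)
      fix n
      let ?x = "ext \<eta> s" and ?y = "ext \<eta> t" and ?p = "\<eta> (a n s)" and ?q = "\<eta> (a n t)"
      have X: "?x \<in> topspace X" "?y \<in> topspace X" "?p \<in> topspace X" "?q \<in> topspace X"
        using extX[OF \<eta>] \<eta>X[OF \<eta>] aD s t by auto
      have "(d ?p ?q)\<^sup>2 \<le> (ennreal (sqrt (real c * \<bar>a n t - a n s\<bar>)))\<^sup>2"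
        using bounded_energy_hoelder[OF T \<eta> aD[OF s] aD[OF t], of n n] by (simp add: ennreal_power)
      then have "d ?p ?q \<le> ennreal (sqrt (real c * \<bar>a n t - a n s\<bar>))" by (simp only: ennreal_power2_le_iff)
      moreover have "d ?x ?y \<le> d ?p ?x + d ?p ?q + d ?q ?y"
      proof -
        have "d ?x ?y \<le> d ?x ?q + d ?q ?y" by (rule d_tri[OF X(1,4,2)])
        also have "d ?x ?q \<le> d ?x ?p + d ?p ?q" by (rule d_tri[OF X(1,3,4)])
        finally show ?thesis using d_sym[OF X(1,3)] by (simp add: add_right_mono)
      qed
      ultimately show "d ?x ?y \<le> d ?p ?x + ennreal (sqrt (real c * \<bar>a n t - a n s\<bar>)) + d ?q ?y"
        by (meson add_left_mono add_right_mono order_trans)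
    qed
  qed
  have cont: "continuous_map (subtopology ?Z (?S c)) (path_space T X) Ext" for c
    unfolding path_space_def continuous_map_componentwise
  proof (intro conjI ballI)
    show "Ext ` topspace (subtopology ?Z (?S c)) \<subseteq> extensional {0..T}" by (auto simp: Ext_def)
    fix t assume t: "t \<in> {0..T}"
    have SZ: "\<eta> \<in> ?S c" if "\<eta> \<in> topspace (subtopology ?Z (?S c))" for \<eta> using that by (simp add: topspace_subtopology)
    \<comment> \<open>Evaluation at \<open>t\<close> is a \<open>d\<close>-uniform limit of
      evaluations at grid times, which are projections; the common Hoelder constant \<open>c\<close>
      provides the rate.\<close>
    have "continuous_map (subtopology ?Z (?S c)) X (\<lambda>\<eta>. ext \<eta> t)"
    proof (rule continuous_map_uniform_dist_limit[where f = "\<lambda>n \<eta>. \<eta> (a n t)" and r = "\<lambda>n. sqrt (real c * (T / 2 ^ n))"])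
      show "continuous_map (subtopology ?Z (?S c)) X (\<lambda>\<eta>. \<eta> (a n t))" for n
        by (intro continuous_map_from_subtopology continuous_map_product_projection aD t)
      show "ext \<eta> t \<in> topspace X" if "\<eta> \<in> topspace (subtopology ?Z (?S c))" for \<eta> by (rule extX[OF SZ[OF that] t])
      show "d (\<eta> (a n t)) (ext \<eta> t) \<le> ennreal (sqrt (real c * (T / 2 ^ n)))"
        if "\<eta> \<in> topspace (subtopology ?Z (?S c))" for n \<eta>
      proof -
        have "d (ext \<eta> (a n t)) (ext \<eta> t) \<le> ennreal (sqrt (real c * \<bar>t - a n t\<bar>))"
          by (intro ext_H SZ that t subsetD[OF D01 aD[OF t]])
        also have "\<dots> \<le> ennreal (sqrt (real c * (T / 2 ^ n)))"
          using a_le[OF t, of n] by (intro ennreal_leI real_sqrt_le_mono mult_left_mono) auto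
        finally show ?thesis using aD[OF t, of n] by (simp add: ext_def)
      qed
      have "(\<lambda>n. sqrt (real c * (T / 2 ^ n))) \<longlonglongrightarrow> sqrt (real c * 0)" by (intro tendsto_intros step_width_tendsto)
      then show "(\<lambda>n. sqrt (real c * (T / 2 ^ n))) \<longlonglongrightarrow> 0" by simp
      show "0 \<le> sqrt (real c * (T / 2 ^ n))" for n using T by simp
    qed
    then show "continuous_map (subtopology ?Z (?S c)) X (\<lambda>\<eta>. Ext \<eta> t)"
      by (rule continuous_map_eq) (use t SZ in \<open>auto simp: Ext_def\<close>)
  qed
  have Sclosed: "closedin ?Z (?S c)" for c
  proof -
    have "?S c = (\<Inter>n. {\<eta> \<in> topspace ?Z. path_energy T n \<eta> \<le> of_nat c})" by (auto simp: bounded_energy_def)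
    also have "closedin ?Z \<dots>" by (intro closedin_INT closedin_lsc_le lsc_path_energy T) auto
    finally show ?thesis .
  qed
  have "Ext \<in> measurable (borel_of ?Z) (borel_of (path_space T X))"
  proof (rule piecewise_continuous_measurable[where S = ?S])
    show "?S n \<in> sets (borel_of ?Z)" for n by (rule borel_of_closed[OF Sclosed])
    show "continuous_map (subtopology ?Z (?S n)) (path_space T X) Ext" for n by (rule cont)
    show "Ext \<eta> \<in> topspace (path_space T X)" if "\<eta> \<in> topspace ?Z" for \<eta>
      using extX x0 by (auto simp: path_space_def Ext_def PiE_iff)
    show "Ext \<eta> = restrict (\<lambda>_. x0) {0..T}" if "\<eta> \<notin> (\<Union>n. ?S n)" for \<eta> using that by (simp add: Ext_def)
  qed
  moreover have "Ext \<eta> t = \<eta> t" if "\<eta> \<in> ?S c" "t \<in> ?D" for c \<eta> t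
    using that D01 by (auto simp: Ext_def ext_def)
  moreover have "(d (Ext \<eta> s) (Ext \<eta> t))\<^sup>2 \<le> ennreal (real c * \<bar>t - s\<bar>)"
    if st: "\<eta> \<in> ?S c" "s \<in> {0..T}" "t \<in> {0..T}" for c \<eta> s t
  proof -
    have "(d (Ext \<eta> s) (Ext \<eta> t))\<^sup>2 \<le> (ennreal (sqrt (real c * \<bar>t - s\<bar>)))\<^sup>2"
      using ext_H[OF st] st by (auto simp: Ext_def ennreal_power2_le_iff)
    then show ?thesis by (simp add: ennreal_power)
  qed
  ultimately show thesis using that cont by blast
qed

text \<open>The counterpart of \<open>bounded_energy\<close> on the whole interval. The Hoelder
  bound is demanded separately because the energies see dyadic times only.\<close>

definition regular_paths :: "real \<Rightarrow> nat \<Rightarrow> (real \<Rightarrow> 'a) set" where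
  "regular_paths T c = {\<eta> \<in> topspace (path_space T X). (\<forall>n. path_energy T n \<eta> \<le> of_nat c) \<and>
     (\<forall>s\<in>{0..T}. \<forall>t\<in>{0..T}. (d (\<eta> s) (\<eta> t))\<^sup>2 \<le> ennreal (real c * \<bar>t - s\<bar>))}"

text \<open>The Hoelder condition concerns uncountably many pairs of times. Closed sets survive this
  intersection, whereas mere measurability of the single conditions would not make the set
  Borel.\<close>

lemma closedin_regular_paths:
  assumes T: "0 < T" shows "closedin (path_space T X) (regular_paths T c)"
proof -
  let ?Y = "path_space T X"
  have "regular_paths T c = (\<Inter>n. {\<eta> \<in> topspace ?Y. path_energy T n \<eta> \<le> of_nat c}) \<inter>
      (\<Inter>(s, t)\<in>{0..T} \<times> {0..T}. {\<eta> \<in> topspace ?Y. (d (\<eta> s) (\<eta> t))\<^sup>2 \<le> ennreal (real c * \<bar>t - s\<bar>)})"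
    using T by (auto simp: regular_paths_def)
  also have "closedin ?Y \<dots>"
  proof (intro closedin_Int closedin_INT)
    show "closedin ?Y {\<eta> \<in> topspace ?Y. path_energy T n \<eta> \<le> of_nat c}" for n
      unfolding path_space_def by (intro closedin_lsc_le lsc_path_energy T dyads_subset)
    fix p assume "p \<in> {0..T} \<times> {0..T}"
    then obtain s t where p: "p = (s, t)" "s \<in> {0..T}" "t \<in> {0..T}" by auto
    have "closedin ?Y {\<eta> \<in> topspace ?Y. (d (\<eta> s) (\<eta> t))\<^sup>2 \<le> ennreal (real c * \<bar>t - s\<bar>)}"
      unfolding path_space_def by (intro closedin_lsc_le lsc_on_power2 lsc_path_dist p)
    then show "closedin ?Y (case p of (s, t) \<Rightarrow> {\<eta> \<in> topspace ?Y. (d (\<eta> s) (\<eta> t))\<^sup>2 \<le> ennreal (real c * \<bar>t - s\<bar>)})"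
      by (simp add: p)
  qed (use T in auto)
  finally show ?thesis .
qed

text \<open>Monotone convergence turns the bounds at the single levels into one for the mean of the
  supremum over all levels. Hence almost every dyadic path has bounded energy and the extension map
  acts as intended on it.\<close>

lemma path_law:
  assumes compl: "extended_complete_on (topspace X) d" and T: "0 < T"
    and \<mu>: "\<And>t. t \<in> {0..T} \<Longrightarrow> \<mu> t \<in> radon_prob X"
    and E: "\<And>n. step_energy T (\<lambda>s t. wasserstein X d (\<mu> s) (\<mu> t)) n \<le> C" and C: "C < top"
  obtains \<Lambda> where "\<Lambda> \<in> radon_prob (path_space T X)"
    "\<And>t. t \<in> dyads T \<Longrightarrow> distr \<Lambda> (borel_of X) (\<lambda>\<eta>. \<eta> t) = \<mu> t"
    "AE \<eta> in \<Lambda>. \<eta> \<in> (\<Union>c. regular_paths T c)"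
    "(\<integral>\<^sup>+\<eta>. (SUP n. path_energy T n \<eta>) \<partial>\<Lambda>) \<le> C"
proof -
  let ?D = "dyads T" and ?Z = "product_topology (\<lambda>_. X) (dyads T)" and ?Y = "path_space T X"
  have hY: "Hausdorff_space ?Y" using hausX by (simp add: path_space_def Hausdorff_space_product_topology)
  have "\<mu> 0 \<in> radon_prob X" using \<mu>[of 0] T by simp
  then have "topspace X \<noteq> {}" using prob_space.not_empty[of "\<mu> 0"] radon_prob_D[of "\<mu> 0" X] by simp
  then obtain x0 where x0: "x0 \<in> topspace X" by blast
  obtain P where P: "P \<in> radon_prob ?Z"
    and P1: "\<And>t. t \<in> ?D \<Longrightarrow> distr P (borel_of X) (\<lambda>\<eta>. \<eta> t) = \<mu> t"
    and P2: "\<And>n. (\<integral>\<^sup>+\<eta>. path_energy T n \<eta> \<partial>P) \<le> C"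
    using dyadic_law[OF T \<mu> E C] by blast
  interpret P: prob_space P using radon_prob_D[OF P] by simp
  note spP [simp] = radon_prob_D(2,3)[OF P]
  have Em: "path_energy T n \<in> borel_measurable P" for n
    using lsc_on_measurable[OF lsc_path_energy[OF T order_refl], of n] by (simp cong: measurable_cong_sets)
  have supE: "(\<integral>\<^sup>+\<eta>. (SUP n. path_energy T n \<eta>) \<partial>P) \<le> C"
  proof -
    have "(\<integral>\<^sup>+\<eta>. (SUP n. path_energy T n \<eta>) \<partial>P) = (SUP n. \<integral>\<^sup>+\<eta>. path_energy T n \<eta> \<partial>P)"
    proof (rule nn_integral_monotone_convergence_SUP_AE[OF _ Em])
      show "AE \<eta> in P. path_energy T n \<eta> \<le> path_energy T (Suc n) \<eta>" for n
        by (rule AE_I2) (intro path_energy_mono[OF T], auto)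
    qed
    also have "\<dots> \<le> C" using P2 by (intro SUP_least)
    finally show ?thesis .
  qed
  obtain Ext where Em': "Ext \<in> measurable (borel_of ?Z) (borel_of ?Y)"
    and Ec: "\<And>c. continuous_map (subtopology ?Z (bounded_energy T c)) ?Y Ext"
    and ED: "\<And>c \<eta> t. \<eta> \<in> bounded_energy T c \<Longrightarrow> t \<in> ?D \<Longrightarrow> Ext \<eta> t = \<eta> t"
    and EH: "\<And>c \<eta> s t. \<eta> \<in> bounded_energy T c \<Longrightarrow> s \<in> {0..T} \<Longrightarrow> t \<in> {0..T} \<Longrightarrow>
       (d (Ext \<eta> s) (Ext \<eta> t))\<^sup>2 \<le> ennreal (real c * \<bar>t - s\<bar>)"
    using dyadic_extension[OF compl T x0] by blast
  have ExtP [measurable]: "Ext \<in> measurable P (borel_of ?Y)" using Em' by (simp cong: measurable_cong_sets)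
  have Ss: "bounded_energy T c \<in> sets (borel_of ?Z)" for c
  proof -
    have "bounded_energy T c = (\<Inter>n. {\<eta> \<in> topspace ?Z. path_energy T n \<eta> \<le> of_nat c})" by (auto simp: bounded_energy_def)
    also have "closedin ?Z \<dots>" by (intro closedin_INT closedin_lsc_le lsc_path_energy T) auto
    finally show ?thesis by (rule borel_of_closed)
  qed
  have AES: "AE \<eta> in P. \<eta> \<in> (\<Union>c. bounded_energy T c)"
  proof -
    have "AE \<eta> in P. (SUP n. path_energy T n \<eta>) \<noteq> \<infinity>"
      using supE C Em by (intro nn_integral_noteq_infinite borel_measurable_SUP) (auto simp: top_unique less_top[symmetric])
    then show ?thesis using AE_space
    proof eventually_elim
      case (elim \<eta>)
      have "(SUP n. path_energy T n \<eta>) < top" using elim(1) by (simp only: infinity_ennreal_def less_top)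
      then obtain c where c: "(SUP n. path_energy T n \<eta>) < of_nat c" using ennreal_Ex_less_of_nat by blast
      have "path_energy T n \<eta> \<le> of_nat c" for n
        using SUP_upper[of n UNIV "\<lambda>n. path_energy T n \<eta>"] less_imp_le[OF c] by (meson UNIV_I order_trans)
      then show ?case using elim by (auto simp: bounded_energy_def)
    qed
  qed
  define \<Lambda> where "\<Lambda> = distr P (borel_of ?Y) Ext"
  have \<Lambda>: "\<Lambda> \<in> radon_prob ?Y"
    unfolding \<Lambda>_def
  proof (rule radon_prob_distr_piecewise[OF hY P Em' Ss _ _ Ec])
    show "incseq (bounded_energy T)"
      unfolding incseq_def bounded_energy_def by (auto intro: order_trans)
    have "P.prob (\<Union>c. bounded_energy T c) = 1"
      using AES Ss by (subst P.prob_eq_1) auto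
    then show "emeasure P (\<Union>c. bounded_energy T c) = 1" by (simp add: P.emeasure_eq_measure)
  qed
  have mt: "(\<lambda>\<eta>. \<eta> t) \<in> measurable (borel_of ?Y) (borel_of X)" if "t \<in> {0..T}" for t
    unfolding path_space_def by (rule continuous_map_measurable[OF continuous_map_product_projection[OF that]])
  have L1: "distr \<Lambda> (borel_of X) (\<lambda>\<eta>. \<eta> t) = \<mu> t" if t: "t \<in> ?D" for t
  proof -
    have t': "t \<in> {0..T}" using t dyads_subset[OF T] by auto
    have "distr \<Lambda> (borel_of X) (\<lambda>\<eta>. \<eta> t) = distr P (borel_of X) ((\<lambda>\<eta>. \<eta> t) \<circ> Ext)"
      unfolding \<Lambda>_def by (rule distr_distr[OF mt[OF t'] ExtP])
    also have "\<dots> = distr P (borel_of X) (\<lambda>\<eta>. \<eta> t)"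
    proof (rule distr_cong_AE)
      show "AE \<eta> in P. ((\<lambda>\<eta>. \<eta> t) \<circ> Ext) \<eta> = \<eta> t" using AES by eventually_elim (use ED t in auto)
      show "(\<lambda>\<eta>. \<eta> t) \<circ> Ext \<in> measurable P (borel_of X)" by (rule measurable_comp[OF ExtP mt[OF t']])
      show "(\<lambda>\<eta>. \<eta> t) \<in> measurable P (borel_of X)"
        using continuous_map_measurable[OF continuous_map_product_projection[OF t, of "\<lambda>_. X"]] by (simp cong: measurable_cong_sets)
    qed auto
    finally show ?thesis using P1[OF t] by simp
  qed
  have EE: "path_energy T n (Ext \<eta>) = path_energy T n \<eta>" if "\<eta> \<in> (\<Union>c. bounded_energy T c)" for \<eta> n
    unfolding step_energy_def using that ED dyad_in_dyads by (intro sum.cong refl) auto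
  have L2: "AE \<eta> in \<Lambda>. \<eta> \<in> (\<Union>c. regular_paths T c)"
    unfolding \<Lambda>_def
  proof (subst AE_distr_iff[OF ExtP])
    have "(\<Union>c. regular_paths T c) \<in> sets (borel_of ?Y)"
      by (intro sets.countable_UN) (use borel_of_closed[OF closedin_regular_paths[OF T]] in auto)
    moreover have "{\<eta> \<in> space (borel_of ?Y). \<eta> \<in> (\<Union>c. regular_paths T c)} = (\<Union>c. regular_paths T c)"
      by (auto simp: regular_paths_def)
    ultimately show "{\<eta> \<in> space (borel_of ?Y). \<eta> \<in> (\<Union>c. regular_paths T c)} \<in> sets (borel_of ?Y)" by simp
    show "AE \<eta> in P. Ext \<eta> \<in> (\<Union>c. regular_paths T c)"
      using AES AE_space
    proof eventually_elim
      case (elim \<eta>)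
      then obtain c where c: "\<eta> \<in> bounded_energy T c" by blast
      have "Ext \<eta> \<in> topspace ?Y" using measurable_space[OF ExtP elim(2)] by simp
      then have "Ext \<eta> \<in> regular_paths T c"
        using EH[OF c] EE[OF elim(1)] c by (auto simp: regular_paths_def bounded_energy_def)
      then show ?case by blast
    qed
  qed
  have L3: "(\<integral>\<^sup>+\<eta>. (SUP n. path_energy T n \<eta>) \<partial>\<Lambda>) \<le> C"
  proof -
    have "(\<integral>\<^sup>+\<eta>. (SUP n. path_energy T n \<eta>) \<partial>\<Lambda>) = (\<integral>\<^sup>+\<eta>. (SUP n. path_energy T n (Ext \<eta>)) \<partial>P)"
    proof -
      have "(\<lambda>\<eta>. SUP n. path_energy T n \<eta>) \<in> borel_measurable (borel_of ?Y)"
        unfolding path_space_def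
        by (intro borel_measurable_SUP lsc_on_measurable[OF lsc_path_energy[OF T dyads_subset[OF T]]]) auto
      then show ?thesis unfolding \<Lambda>_def by (intro nn_integral_distr[OF ExtP]) simp
    qed
    also have "\<dots> = (\<integral>\<^sup>+\<eta>. (SUP n. path_energy T n \<eta>) \<partial>P)"
    proof (rule nn_integral_cong_AE)
      show "AE \<eta> in P. (SUP n. path_energy T n (Ext \<eta>)) = (SUP n. path_energy T n \<eta>)"
        using AES
      proof eventually_elim
        case (elim \<eta>)
        show ?case by (simp only: EE[OF elim])
      qed
    qed
    also have "\<dots> \<le> C" by (rule supE)
    finally show ?thesis .
  qed
  show thesis by (rule that[OF \<Lambda> L1 L2 L3])
qed

text \<open>The function \<open>g\<close> of \<open>speed_exists\<close> is chosen separately for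
  each path and need not depend measurably on it. The estimates are therefore restated with the
  metric derivative, which equals \<open>g\<close> almost everywhere.\<close>

lemma regular_path_speed:
  assumes T: "0 < T" and \<eta>: "\<eta> \<in> regular_paths T c"
  shows "\<eta> \<in> AC2 T (topspace X) d"
    and "(\<integral>\<^sup>+t\<in>{0..<T}. (metric_derivative T d \<eta> t)\<^sup>2 \<partial>lborel) \<le> (SUP n. path_energy T n \<eta>)"
    and "\<And>s t. 0 \<le> s \<Longrightarrow> s \<le> t \<Longrightarrow> t \<le> T \<Longrightarrow>
       (d (\<eta> s) (\<eta> t))\<^sup>2 \<le> ennreal (t - s) * (\<integral>\<^sup>+r\<in>{s..<t}. (metric_derivative T d \<eta> r)\<^sup>2 \<partial>lborel)"
proof -
  let ?\<rho> = "\<lambda>s t. d (\<eta> s) (\<eta> t)" and ?C = "SUP n. path_energy T n \<eta>"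
  have \<eta>X: "\<eta> t \<in> topspace X" if "t \<in> {0..T}" for t using \<eta> that by (auto simp: regular_paths_def path_space_def PiE_iff)
  have sd: "semidistance_on {0..T} ?\<rho>" by (rule semidistance_path[OF \<eta>X])
  have "?C \<le> of_nat c" using \<eta> by (intro SUP_least) (auto simp: regular_paths_def)
  then have Cfin: "?C < top" by (rule le_less_trans) (simp add: ennreal_of_nat_eq_real_of_nat)
  obtain g :: "real \<Rightarrow> real" where g: "g \<in> borel_measurable borel" "\<And>t. 0 \<le> g t"
    and gC: "(\<integral>\<^sup>+t\<in>{0..<T}. ennreal ((g t)\<^sup>2) \<partial>lborel) \<le> ?C"
    and g1: "\<And>s t. 0 \<le> s \<Longrightarrow> s \<le> t \<Longrightarrow> t \<le> T \<Longrightarrow> ?\<rho> s t \<le> (\<integral>\<^sup>+r\<in>{s..<t}. ennreal (g r) \<partial>lborel)"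
    and g2: "\<And>s t. 0 \<le> s \<Longrightarrow> s \<le> t \<Longrightarrow> t \<le> T \<Longrightarrow> (?\<rho> s t)\<^sup>2 \<le> ennreal (t - s) * (\<integral>\<^sup>+r\<in>{s..<t}. ennreal ((g r)\<^sup>2) \<partial>lborel)"
    and g3: "AE t in lborel. t \<in> {0<..<T} \<longrightarrow> mder T ?\<rho> t = ennreal (g t)"
  proof (rule speed_exists[OF T sd _ _ _ Cfin])
    show "(?\<rho> s t)\<^sup>2 \<le> ennreal (real c * \<bar>t - s\<bar>)" if "s \<in> {0..T}" "t \<in> {0..T}" for s t
      using \<eta> that unfolding regular_paths_def by blast
    show "path_energy T n \<eta> \<le> ?C" for n by (rule SUP_upper) simp
  qed auto
  show "\<eta> \<in> AC2 T (topspace X) d"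
    using gC Cfin by (intro AC2I[OF \<eta>X g _ g1]) auto
  have eq: "(\<integral>\<^sup>+r\<in>{s..<t}. (metric_derivative T d \<eta> r)\<^sup>2 \<partial>lborel) = (\<integral>\<^sup>+r\<in>{s..<t}. ennreal ((g r)\<^sup>2) \<partial>lborel)"
    if "0 \<le> s" "t \<le> T" for s t
    by (intro nn_integral_cong_AE, use g3 AE_lborel_singleton[of 0] in eventually_elim)
       (use that in \<open>auto simp: indicator_def metric_derivative_eq ennreal_power g(2)\<close>)
  show "(\<integral>\<^sup>+t\<in>{0..<T}. (metric_derivative T d \<eta> t)\<^sup>2 \<partial>lborel) \<le> ?C"
    using gC eq[of 0 T] by simp
  show "(d (\<eta> s) (\<eta> t))\<^sup>2 \<le> ennreal (t - s) * (\<integral>\<^sup>+r\<in>{s..<t}. (metric_derivative T d \<eta> r)\<^sup>2 \<partial>lborel)"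
    if "0 \<le> s" "s \<le> t" "t \<le> T" for s t
    using g2[OF that] eq[OF that(1,3)] by simp
qed

end

section \<open>Lifting the curve of measures\<close>

lemma AE_eq_of_nn_integral_le:
  fixes f h :: "'b \<Rightarrow> ennreal"
  assumes [measurable]: "f \<in> borel_measurable M" "h \<in> borel_measurable M"
    and le: "AE x in M. f x \<le> h x" and int: "(\<integral>\<^sup>+x. h x \<partial>M) \<le> (\<integral>\<^sup>+x. f x \<partial>M)"
    and fin: "(\<integral>\<^sup>+x. f x \<partial>M) < top"
  shows "AE x in M. f x = h x"
proof -
  have "(\<integral>\<^sup>+x. h x - f x \<partial>M) = (\<integral>\<^sup>+x. h x \<partial>M) - (\<integral>\<^sup>+x. f x \<partial>M)"
    using le fin by (intro nn_integral_diff) auto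
  also have "\<dots> = 0" using int by (simp add: diff_eq_0_iff_ennreal le_less_trans[OF int fin])
  finally have "AE x in M. h x - f x = 0" by (subst (asm) nn_integral_0_iff_AE) auto
  then show ?thesis using le by eventually_elim (auto simp: diff_eq_0_iff_ennreal)
qed

theorem proposition5p5:
  fixes X :: "'a topology"
    and d :: "'a \<Rightarrow> 'a \<Rightarrow> ennreal"
    and T :: real
    and \<mu> :: "real \<Rightarrow> 'a measure"
  assumes "extended_metric_topological_space X d"
    and "extended_complete_on (topspace X) d"
    and "T > 0"
    and "\<mu> \<in> AC2 T (radon_prob X) (wasserstein X d)"
  shows "\<exists>\<Lambda> \<in> radon_prob (path_space T X).
           (AE \<eta> in \<Lambda>. \<eta> \<in> AC2 T (topspace X) d) \<and>
           (\<forall>t\<in>{0..T}. distr \<Lambda> (borel_of X) (\<lambda>\<eta>. \<eta> t) = \<mu> t) \<and>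
           (AE t in lborel. t \<in> {0<..<T} \<longrightarrow>
              (\<integral>\<^sup>+ \<eta>. (metric_derivative T d \<eta> t)\<^sup>2 \<partial>\<Lambda>) =
              (metric_derivative T (wasserstein X d) \<mu> t)\<^sup>2)"
proof -
  interpret ext_metric_top X d by unfold_locales (rule assms(1))
  note compl = assms(2) and T = assms(3) and AC = assms(4)
  let ?Y = "path_space T X" and ?W = "\<lambda>s t. wasserstein X d (\<mu> s) (\<mu> t)"
  have \<mu>: "\<mu> t \<in> radon_prob X" if "t \<in> {0..T}" for t using AC that by (auto simp: AC2_def)
  obtain m where m: "m \<in> borel_measurable borel" and mfin: "(\<integral>\<^sup>+r\<in>{0..<T}. m r \<partial>lborel) < top"
    and mb: "\<And>s t. 0 \<le> s \<Longrightarrow> s \<le> t \<Longrightarrow> t \<le> T \<Longrightarrow> (?W s t)\<^sup>2 \<le> ennreal (t - s) * (\<integral>\<^sup>+r\<in>{s..<t}. m r \<partial>lborel)"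
    using AC2_energy[OF AC] by blast
  have sdW: "semidistance_on {0..T} ?W"
    unfolding semidistance_on_def
  proof (intro conjI ballI)
    \<comment> \<open>At equal times the length factor in \<open>mb\<close> vanishes, which spares
      the construction of a diagonal plan.\<close>
    show "?W s s = 0" if "s \<in> {0..T}" for s using mb[of s s] that by simp
    show "?W s t = ?W t s" for s t by (rule wasserstein_sym)
    show "?W r t \<le> ?W r s + ?W s t" if "s \<in> {0..T}" for r s t by (rule wasserstein_triangle[OF \<mu>[OF that]])
  qed
  obtain K where K: "(\<integral>\<^sup>+r\<in>{0..<T}. m r \<partial>lborel) = ennreal K" "0 \<le> K"
    using mfin by (cases "\<integral>\<^sup>+r\<in>{0..<T}. m r \<partial>lborel") auto
  have HW: "(?W s t)\<^sup>2 \<le> ennreal (K * \<bar>t - s\<bar>)" if st: "s \<in> {0..T}" "t \<in> {0..T}" for s t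
  proof -
    have *: "(?W s t)\<^sup>2 \<le> ennreal (K * (t - s))" if "0 \<le> s" "s \<le> t" "t \<le> T" for s t
    proof -
      have "(?W s t)\<^sup>2 \<le> ennreal (t - s) * ennreal K"
        unfolding K(1)[symmetric] using that
        by (intro order_trans[OF mb[OF that]] mult_left_mono nn_set_integral_mono) auto
      then show ?thesis using K(2) that by (simp add: ennreal_mult[symmetric] mult.commute)
    qed
    show ?thesis
      using *[of s t] *[of t s] st wasserstein_sym[of "\<mu> s" "\<mu> t"] by (cases "s \<le> t") auto
  qed
  obtain g :: "real \<Rightarrow> real" where g [measurable]: "g \<in> borel_measurable borel" and g0: "\<And>t. 0 \<le> g t"
    and gC: "(\<integral>\<^sup>+t\<in>{0..<T}. ennreal ((g t)\<^sup>2) \<partial>lborel) \<le> (\<integral>\<^sup>+r\<in>{0..<T}. m r \<partial>lborel)"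
    and g2: "\<And>s t. 0 \<le> s \<Longrightarrow> s \<le> t \<Longrightarrow> t \<le> T \<Longrightarrow> (?W s t)\<^sup>2 \<le> ennreal (t - s) * (\<integral>\<^sup>+r\<in>{s..<t}. ennreal ((g r)\<^sup>2) \<partial>lborel)"
    and g3: "AE t in lborel. t \<in> {0<..<T} \<longrightarrow> mder T ?W t = ennreal (g t)"
  proof (rule speed_exists[OF T sdW _ K(2) _ mfin])
    show "(?W s t)\<^sup>2 \<le> ennreal (K * \<bar>t - s\<bar>)" if "s \<in> {0..T}" "t \<in> {0..T}" for s t by (rule HW[OF that])
    show "step_energy T ?W n \<le> (\<integral>\<^sup>+r\<in>{0..<T}. m r \<partial>lborel)" for n by (rule step_energy_le[OF T m mb])
    fix g :: "real \<Rightarrow> real"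
    assume A: "g \<in> borel_measurable borel" "\<And>t. 0 \<le> g t"
      "(\<integral>\<^sup>+t\<in>{0..<T}. ennreal ((g t)\<^sup>2) \<partial>lborel) \<le> (\<integral>\<^sup>+r\<in>{0..<T}. m r \<partial>lborel)"
      and B: "\<And>s t. 0 \<le> s \<Longrightarrow> s \<le> t \<Longrightarrow> t \<le> T \<Longrightarrow> (?W s t)\<^sup>2 \<le> ennreal (t - s) * (\<integral>\<^sup>+r\<in>{s..<t}. ennreal ((g r)\<^sup>2) \<partial>lborel)"
        "AE t in lborel. t \<in> {0<..<T} \<longrightarrow> mder T ?W t = ennreal (g t)"
    show thesis by (rule that[OF A B])
  qed
  \<comment> \<open>From here on the optimal majorant, the square of the speed \<open>g\<close>,
    replaces \<open>m\<close>: the comparison at the end needs a lift whose energy does not exceed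
    the integral of the squared speed.\<close>
  define C where "C = (\<integral>\<^sup>+t\<in>{0..<T}. ennreal ((g t)\<^sup>2) \<partial>lborel)"
  have C: "C < top" unfolding C_def using gC mfin by (rule le_less_trans)
  have EC: "step_energy T ?W n \<le> C" for n
    unfolding C_def by (rule step_energy_le[OF T _ g2]) measurable
  obtain \<Lambda> where \<Lambda>: "\<Lambda> \<in> radon_prob ?Y"
    and \<Lambda>D: "\<And>t. t \<in> dyads T \<Longrightarrow> distr \<Lambda> (borel_of X) (\<lambda>\<eta>. \<eta> t) = \<mu> t"
    and \<Lambda>G: "AE \<eta> in \<Lambda>. \<eta> \<in> (\<Union>c. regular_paths T c)"
    and \<Lambda>E: "(\<integral>\<^sup>+\<eta>. (SUP n. path_energy T n \<eta>) \<partial>\<Lambda>) \<le> C"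
  proof (rule path_law[where \<mu> = \<mu> and C = C, OF compl T _ EC C])
    show "\<mu> t \<in> radon_prob X" if "t \<in> {0..T}" for t by (rule \<mu>[OF that])
    fix \<Lambda> assume A: "\<Lambda> \<in> radon_prob ?Y" "\<And>t. t \<in> dyads T \<Longrightarrow> distr \<Lambda> (borel_of X) (\<lambda>\<eta>. \<eta> t) = \<mu> t"
      "AE \<eta> in \<Lambda>. \<eta> \<in> (\<Union>c. regular_paths T c)" "(\<integral>\<^sup>+\<eta>. (SUP n. path_energy T n \<eta>) \<partial>\<Lambda>) \<le> C"
    show thesis by (rule that[OF A])
  qed
  interpret \<Lambda>: prob_space \<Lambda> using radon_prob_D[OF \<Lambda>] by simp
  interpret \<Lambda>L: pair_sigma_finite \<Lambda> lborel ..
  note sp\<Lambda> [simp] = radon_prob_D(2,3)[OF \<Lambda>]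
  have ct: "continuous_map ?Y X (\<lambda>\<eta>. \<eta> t)" if "t \<in> {0..T}" for t
    unfolding path_space_def by (rule continuous_map_product_projection[OF that])
  have dm: "(\<lambda>\<eta>. d (\<eta> s) (\<eta> t)) \<in> borel_measurable \<Lambda>" if "s \<in> {0..T}" "t \<in> {0..T}" for s t
    using d_pair_measurable(2)[OF ct[OF that(1)] ct[OF that(2)]] by (simp cong: measurable_cong_sets)
  \<comment> \<open>A jointly measurable function that agrees with the speed of regular paths at
    interior times, that is, for \<Lambda>-almost every path; it makes Fubini's theorem
    applicable.\<close>
  obtain \<Phi> where \<Phi>m [measurable]: "\<Phi> \<in> borel_measurable (\<Lambda> \<Otimes>\<^sub>M lborel)"
    and \<Phi>: "\<And>\<eta> t K. semidistance_on {0..T} (\<lambda>s t. d (\<eta> s) (\<eta> t)) \<Longrightarrow> 0 \<le> K \<Longrightarrow>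
       (\<And>s t. s \<in> {0..T} \<Longrightarrow> t \<in> {0..T} \<Longrightarrow> (d (\<eta> s) (\<eta> t))\<^sup>2 \<le> ennreal (K * \<bar>t - s\<bar>)) \<Longrightarrow> t \<in> {0<..<T} \<Longrightarrow>
       mder T (\<lambda>s t. d (\<eta> s) (\<eta> t)) t = \<Phi> (\<eta>, t)"
  proof (rule mder_joint_measurable[where \<rho> = "\<lambda>\<eta> s t. d (\<eta> s) (\<eta> t)" and M = \<Lambda>, OF T])
    show "(\<lambda>\<eta>. d (\<eta> s) (\<eta> t)) \<in> borel_measurable \<Lambda>" if "s \<in> {0..T}" "t \<in> {0..T}" for s t by (rule dm[OF that])
    fix \<Phi> :: "(real \<Rightarrow> 'a) \<times> real \<Rightarrow> ennreal" assume A: "\<Phi> \<in> borel_measurable (\<Lambda> \<Otimes>\<^sub>M lborel)"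
      "\<And>\<eta> t K. semidistance_on {0..T} (\<lambda>s t. d (\<eta> s) (\<eta> t)) \<Longrightarrow> 0 \<le> K \<Longrightarrow>
       (\<And>s t. s \<in> {0..T} \<Longrightarrow> t \<in> {0..T} \<Longrightarrow> (d (\<eta> s) (\<eta> t))\<^sup>2 \<le> ennreal (K * \<bar>t - s\<bar>)) \<Longrightarrow> t \<in> {0<..<T} \<Longrightarrow>
       mder T (\<lambda>s t. d (\<eta> s) (\<eta> t)) t = \<Phi> (\<eta>, t)"
    show thesis by (rule that[OF A(1)]) (rule A(2))
  qed
  have \<Phi>_eq: "metric_derivative T d \<eta> t = \<Phi> (\<eta>, t)" if \<eta>: "\<eta> \<in> (\<Union>c. regular_paths T c)" and t: "t \<in> {0<..<T}" for \<eta> t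
  proof -
    obtain c where c: "\<eta> \<in> regular_paths T c" using \<eta> by blast
    have "\<eta> t \<in> topspace X" if "t \<in> {0..T}" for t using c that by (auto simp: regular_paths_def path_space_def PiE_iff)
    then have "semidistance_on {0..T} (\<lambda>s t. d (\<eta> s) (\<eta> t))" by (rule semidistance_path)
    then show ?thesis unfolding metric_derivative_eq
      by (rule \<Phi>[of _ "real c"]) (use c t in \<open>auto simp: regular_paths_def\<close>)
  qed
  have \<Phi>_int: "(\<integral>\<^sup>+r\<in>{s..<t}. (metric_derivative T d \<eta> r)\<^sup>2 \<partial>lborel) = (\<integral>\<^sup>+r\<in>{s..<t}. (\<Phi> (\<eta>, r))\<^sup>2 \<partial>lborel)"
    if \<eta>: "\<eta> \<in> (\<Union>c. regular_paths T c)" and "0 \<le> s" "t \<le> T" for s t \<eta>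
    by (intro nn_integral_cong_AE, use AE_lborel_singleton[of 0] in eventually_elim)
       (use that \<Phi>_eq[OF \<eta>] in \<open>auto simp: indicator_def\<close>)
  define M where "M t = (\<integral>\<^sup>+\<eta>. (\<Phi> (\<eta>, t))\<^sup>2 \<partial>\<Lambda>)" for t
  have Mm [measurable]: "M \<in> borel_measurable borel"
  proof -
    have "(\<lambda>p. (\<Phi> (snd p, fst p))\<^sup>2) \<in> borel_measurable (lborel \<Otimes>\<^sub>M \<Lambda>)" by measurable
    then have "M \<in> borel_measurable lborel"
      unfolding M_def by (intro \<Lambda>.borel_measurable_nn_integral) (simp add: case_prod_beta')
    then show ?thesis by simp
  qed
  have M_eq: "(\<integral>\<^sup>+ \<eta>. (metric_derivative T d \<eta> t)\<^sup>2 \<partial>\<Lambda>) = M t" if "t \<in> {0<..<T}" for t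
    unfolding M_def
  proof (rule nn_integral_cong_AE)
    show "AE \<eta> in \<Lambda>. (metric_derivative T d \<eta> t)\<^sup>2 = (\<Phi> (\<eta>, t))\<^sup>2"
      using \<Lambda>G
    proof eventually_elim
      case (elim \<eta>)
      show ?case by (simp only: \<Phi>_eq[OF elim that])
    qed
  qed
  have Fub: "(\<integral>\<^sup>+\<eta>. (\<integral>\<^sup>+r\<in>{s..<t}. (\<Phi> (\<eta>, r))\<^sup>2 \<partial>lborel) \<partial>\<Lambda>) = (\<integral>\<^sup>+r\<in>{s..<t}. M r \<partial>lborel)" for s t
  proof -
    have "(\<integral>\<^sup>+\<eta>. (\<integral>\<^sup>+r\<in>{s..<t}. (\<Phi> (\<eta>, r))\<^sup>2 \<partial>lborel) \<partial>\<Lambda>) = (\<integral>\<^sup>+r. (\<integral>\<^sup>+\<eta>. (\<Phi> (\<eta>, r))\<^sup>2 * indicator {s..<t} r \<partial>\<Lambda>) \<partial>lborel)"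
      by (rule \<Lambda>L.Fubini'[symmetric]) measurable
    also have "\<dots> = (\<integral>\<^sup>+r\<in>{s..<t}. M r \<partial>lborel)"
      unfolding M_def by (intro nn_integral_cong nn_integral_multc) measurable
    finally show ?thesis .
  qed
  have M_int: "(\<integral>\<^sup>+t\<in>{0..<T}. M t \<partial>lborel) \<le> C"
  proof -
    have "(\<integral>\<^sup>+t\<in>{0..<T}. M t \<partial>lborel) = (\<integral>\<^sup>+\<eta>. (\<integral>\<^sup>+r\<in>{0..<T}. (\<Phi> (\<eta>, r))\<^sup>2 \<partial>lborel) \<partial>\<Lambda>)" by (rule Fub[symmetric])
    also have "\<dots> \<le> (\<integral>\<^sup>+\<eta>. (SUP n. path_energy T n \<eta>) \<partial>\<Lambda>)"
    proof (rule nn_integral_mono_AE)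
      show "AE \<eta> in \<Lambda>. (\<integral>\<^sup>+r\<in>{0..<T}. (\<Phi> (\<eta>, r))\<^sup>2 \<partial>lborel) \<le> (SUP n. path_energy T n \<eta>)"
        using \<Lambda>G
      proof eventually_elim
        case (elim \<eta>)
        then obtain c where "\<eta> \<in> regular_paths T c" by blast
        from regular_path_speed(2)[OF T this] show ?case using \<Phi>_int[OF elim, of 0 T] by simp
      qed
    qed
    also have "\<dots> \<le> C" by (rule \<Lambda>E)
    finally show ?thesis .
  qed
  have dM: "(\<integral>\<^sup>+\<eta>. (d (\<eta> s) (\<eta> t))\<^sup>2 \<partial>\<Lambda>) \<le> ennreal (t - s) * (\<integral>\<^sup>+r\<in>{s..<t}. M r \<partial>lborel)"
    if st: "0 \<le> s" "s \<le> t" "t \<le> T" for s t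
  proof -
    have "(\<integral>\<^sup>+\<eta>. (d (\<eta> s) (\<eta> t))\<^sup>2 \<partial>\<Lambda>) \<le> (\<integral>\<^sup>+\<eta>. ennreal (t - s) * (\<integral>\<^sup>+r\<in>{s..<t}. (\<Phi> (\<eta>, r))\<^sup>2 \<partial>lborel) \<partial>\<Lambda>)"
    proof (rule nn_integral_mono_AE)
      show "AE \<eta> in \<Lambda>. (d (\<eta> s) (\<eta> t))\<^sup>2 \<le> ennreal (t - s) * (\<integral>\<^sup>+r\<in>{s..<t}. (\<Phi> (\<eta>, r))\<^sup>2 \<partial>lborel)"
        using \<Lambda>G
      proof eventually_elim
        case (elim \<eta>)
        then obtain c where "\<eta> \<in> regular_paths T c" by blast
        from regular_path_speed(3)[OF T this st] show ?case using \<Phi>_int[OF elim st(1,3)] by simp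
      qed
    qed
    also have "\<dots> = ennreal (t - s) * (\<integral>\<^sup>+\<eta>. (\<integral>\<^sup>+r\<in>{s..<t}. (\<Phi> (\<eta>, r))\<^sup>2 \<partial>lborel) \<partial>\<Lambda>)"
      by (rule nn_integral_cmult) measurable
    finally show ?thesis unfolding Fub .
  qed
  define N where "N t = distr \<Lambda> (borel_of X) (\<lambda>\<eta>. \<eta> t)" for t
  have Nr: "N t \<in> radon_prob X" if "t \<in> {0..T}" for t
    unfolding N_def by (rule radon_prob_distr[OF hausX \<Lambda> ct[OF that]])
  \<comment> \<open>Two evaluations couple the marginals through \<Lambda>, so the mean squared
    speed \<open>M\<close> of the paths is an admissible majorant for the curve of
    marginals.\<close>
  have WN: "(wasserstein X d (N s) (N t))\<^sup>2 \<le> ennreal (t - s) * (\<integral>\<^sup>+r\<in>{s..<t}. M r \<partial>lborel)"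
    if st: "0 \<le> s" "s \<le> t" "t \<le> T" for s t
    unfolding N_def using wasserstein_le_coupling[OF \<Lambda> ct[of s] ct[of t]] dM[OF st] st by (auto intro: order_trans)
  \<comment> \<open>Marginals are known at dyadic times only. At a general \<open>t\<close> the
    marginal of \<Lambda> and \<open>\<mu> t\<close> are both limits of \<open>\<mu> (a n)\<close>
    for the Wasserstein distance, along the dyadic times \<open>a n\<close> that approach
    \<open>t\<close> from the left.\<close>
  have N\<mu>: "N t = \<mu> t" if t: "t \<in> {0..T}" for t
  proof (rule wasserstein_zero[OF Nr[OF t] \<mu>[OF t]])
    obtain C' where C': "C = ennreal C'" "0 \<le> C'" using C by (cases C) auto
    define a where "a n = dyad T n (dyad_index T n t)" for n
    have aD: "a n \<in> dyads T" for n
      unfolding a_def using dyad_index_le[OF T, of t n] t by (intro dyad_in_dyads) simp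
    have a_in: "a n \<in> {0..T}" for n by (rule subsetD[OF dyads_subset[OF T] aD])
    have a_le: "a n \<le> t" for n unfolding a_def using dyad_index_bounds(1)[OF T, of t n] t by simp
    have a_lim: "a \<longlonglongrightarrow> t" unfolding a_def using dyad_index_tendsto[OF T, of t] t by simp
    have lim1: "(\<lambda>n. ?W (a n) t) \<longlonglongrightarrow> 0" by (rule hoelder_tendsto_zero[OF HW K(2) a_in a_lim t])
    have b: "wasserstein X d (N t) (\<mu> (a n)) \<le> ennreal (sqrt (C' * (t - a n)))" for n
    proof -
      have "(wasserstein X d (\<mu> (a n)) (N t))\<^sup>2 \<le> ennreal (t - a n) * (\<integral>\<^sup>+r\<in>{a n..<t}. M r \<partial>lborel)"
        using WN[of "a n" t] a_in[of n] a_le[of n] t \<Lambda>D[OF aD[of n]] by (simp add: N_def)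
      also have "\<dots> \<le> ennreal (t - a n) * C"
        using a_in[of n] t by (intro mult_left_mono order_trans[OF nn_set_integral_mono M_int]) auto
      also have "\<dots> = (ennreal (sqrt (C' * (t - a n))))\<^sup>2"
        using C' a_le[of n] by (simp add: ennreal_power ennreal_mult[symmetric] mult.commute)
      finally have "wasserstein X d (\<mu> (a n)) (N t) \<le> ennreal (sqrt (C' * (t - a n)))" by (simp only: ennreal_power2_le_iff)
      then show ?thesis by (simp add: wasserstein_sym)
    qed
    have "(\<lambda>n. ennreal (sqrt (C' * (t - a n))) + ?W (a n) t) \<longlonglongrightarrow> ennreal (sqrt (C' * (t - t))) + 0"
      by (intro tendsto_add tendsto_intros a_lim lim1)
    then have "(\<lambda>n. ennreal (sqrt (C' * (t - a n))) + ?W (a n) t) \<longlonglongrightarrow> 0" by simp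
    moreover have "wasserstein X d (N t) (\<mu> t) \<le> ennreal (sqrt (C' * (t - a n))) + ?W (a n) t" for n
      using wasserstein_triangle[OF \<mu>[OF a_in[of n]], of "N t" "\<mu> t"] b[of n] by (meson add_right_mono order_trans)
    ultimately have "wasserstein X d (N t) (\<mu> t) \<le> 0"
      by (intro tendsto_lowerbound[OF _ _ sequentially_bot]) auto
    then show "wasserstein X d (N t) (\<mu> t) = 0" by simp
  qed
  have WM: "(?W s t)\<^sup>2 \<le> ennreal (t - s) * (\<integral>\<^sup>+r\<in>{s..<t}. M r \<partial>lborel)" if "0 \<le> s" "s \<le> t" "t \<le> T" for s t
    using WN[OF that] N\<mu>[of s] N\<mu>[of t] that by simp
  have "AE t in lborel. t \<in> {0<..<T} \<longrightarrow> (mder T ?W t)\<^sup>2 \<le> M t"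
    using M_int C by (intro mder_le[OF T Mm _ semidistance_onD(2)[OF sdW] WM]) auto
  then have "AE t in lborel. ennreal ((g t)\<^sup>2) * indicator {0..<T} t \<le> M t * indicator {0..<T} t"
    using g3 AE_lborel_singleton[of 0]
    by eventually_elim (auto simp: indicator_def ennreal_power g0)
  \<comment> \<open>Coupling gives \<open>(g t)\<^sup>2 \<le> M t\<close> almost everywhere, while
    the construction gives \<open>M\<close> an integral of at most \<open>C\<close>, the finite
    integral of \<open>(g t)\<^sup>2\<close>; there is no room for strict inequality on a set of
    positive measure.\<close>
  then have "AE t in lborel. ennreal ((g t)\<^sup>2) * indicator {0..<T} t = M t * indicator {0..<T} t"
    using M_int C unfolding C_def by (intro AE_eq_of_nn_integral_le) auto
  then have main: "AE t in lborel. t \<in> {0<..<T} \<longrightarrow>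
      (\<integral>\<^sup>+ \<eta>. (metric_derivative T d \<eta> t)\<^sup>2 \<partial>\<Lambda>) = (metric_derivative T (wasserstein X d) \<mu> t)\<^sup>2"
    using g3
  proof eventually_elim
    case (elim t)
    show ?case
    proof
      assume t: "t \<in> {0<..<T}"
      then have "ennreal ((g t)\<^sup>2) = M t" "mder T ?W t = ennreal (g t)" using elim by (auto simp: indicator_def)
      then show "(\<integral>\<^sup>+ \<eta>. (metric_derivative T d \<eta> t)\<^sup>2 \<partial>\<Lambda>) = (metric_derivative T (wasserstein X d) \<mu> t)\<^sup>2"
        using M_eq[OF t] by (simp add: metric_derivative_eq ennreal_power g0)
    qed
  qed
  have "AE \<eta> in \<Lambda>. \<eta> \<in> AC2 T (topspace X) d"
    using \<Lambda>G by eventually_elim (use regular_path_speed(1)[OF T] in auto)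
  with \<Lambda> N\<mu> main show ?thesis unfolding N_def by blast
qed

end
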